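(* The category $\mathbf{qRel}$ of quantum sets and binary relations, equipped with the Cartesian product $(-\times-)$, the monoidal unit $\mathbf 1$, the dual/transpose operation $(-)^*$, and the adjoint operation $(-)^\dagger$, that is, the structure $(\mathbf{qRel},(-\times-),\mathbf 1,(-)^*,(-)^\dagger)$, is a dagger compact category.
   Context: A quantum set $\mathcal X$ is determined by a set $\mathrm{At}(\mathcal X)$ of nonzero finite-dimensional complex Hilbert spaces, called its atoms; $X\propto\mathcal X$ means $X\in\mathrm{At}(\mathcal X)$. $L(X,Y)$ is the space of linear operators $X\to Y$. A binary relation $R$ from $\mathcal X$ to $\mathcal Y$ assigns to each $X\propto\mathcal X$, $Y\propto\mathcal Y$ a linear subspace $R(X,Y)\le L(X,Y)$. Composition: $(S\circ R)(X,Z)=\mathrm{span}\{sr : Y\propto\mathcal Y,\ s\in S(Y,Z),\ r\in R(X,Y)\}$. Identity: $I_{\mathcal X}(X,X)=\mathbb C\cdot 1_X$ and $I_{\mathcal X}(X,X')=0$ for $X\neq X'$. These form the category $\mathbf{qRel}$. Cartesian product: $\mathcal X\times\mathcal Y$ has atoms $X\otimes Y$ for $X\propto\mathcal X$, $Y\propto\mathcal Y$ (distinct pairs give distinct atoms); $(R_1\times R_2)(X_1\otimes X_2,Y_1\otimes Y_2)=\mathrm{span}\{r_1\otimes r_2: r_i\in R_i(X_i,Y_i)\}$. The unit $\mathbf 1$ is the quantum set whose only atom is $\mathbb C$. Dual and transpose: $X^*=L(X,\mathbb C)$ is the dual Hilbert space, and for $v\in L(X,Y)$, $v^*\in L(Y^*,X^*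 )$ is $v^*(\varphi)=\varphi\circ v$. $\mathcal X^*$ is the quantum set with atoms $X^*$ for $X\propto\mathcal X$, and $R^*(Y^*,X^* )=\{v^*: v\in R(X,Y)\}$. Adjoint: $R^\dagger(Y,X)=\{v^\dagger: v\in R(X,Y)\}$, where $v^\dagger$ is the Hermitian adjoint; on objects, $\mathcal X^\dagger=\mathcal X$. Structure morphisms: each is obtained by lifting from the dagger compact category $\mathbf{FdHilb}$ of finite-dimensional Hilbert spaces. The associator $(\mathcal X\times\mathcal Y)\times\mathcal Z\to\mathcal X\times(\mathcal Y\times\mathcal Z)$, left and right unitors, and braiding $S_{\mathcal X,\mathcal Y}\colon\mathcal X\times\mathcal Y\to\mathcal Y\times\mathcal X$ take matching pairs of atoms, such as $(X\otimes Y,Y\otimes X)$, to the span of the corresponding structure operator of $\mathbf{FdHilb}$, and vanish on all other pairs of atoms. The unit $H_{\mathcal X}\colon\mathbf 1\to\mathcal X^*\times\mathcal X$ takes $(\mathbb C,X^*\otimes X)$ to the span of the operator $\mathbb C\to X^*\otimes X$ sending $1$ to the canonical (identity) element, and vanishes otherwise; the counit $E_{\mathcal X}\colon\mathcal X\times\mathcal X^*\to\mathbf 1$ takes $(X\otimes X^*,\mathbb C)$ to the span of the evaluation operator, and vanishes otherwise. "Dagger compact category" means here: (a) $(\mathbf{qRel},\times,\mathbf 1)$ with these morphisms is a symmetric monoidal category; (b) it is compact closed with duals given by the contravariant functor $(-)^*$, i.e. (suppressing associators and unitors) $(E_{\mathcal X}\times I_{\mathcal Y})\circ(I_{\mathcal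 X}\times R^*\times I_{\mathcal Y})\circ(I_{\mathcal X}\times H_{\mathcal Y})=R$ and $(I_{\mathcal X^*}\times E_{\mathcal Y})\circ(I_{\mathcal X^*}\times R\times I_{\mathcal Y^*})\circ(H_{\mathcal X}\times I_{\mathcal Y^*})=R^*$ for every binary relation $R$ from $\mathcal X$ to $\mathcal Y$; (c) $(-)^\dagger$ is an identity-on-objects involutive contravariant functor with $(R\times S)^\dagger=R^\dagger\times S^\dagger$, the associator, unitors and braiding have unitary components ($U^{-1}=U^\dagger$), and $E_{\mathcal X}^\dagger=S_{\mathcal X^*,\mathcal X}\circ H_{\mathcal X}$ for every quantum set $\mathcal X$. *)

theory Defs
  imports Complex_Main
begin

section \<open>Finite-dimensional Hilbert spaces\<close>

text \<open>
  Linear operators are represented by partial functions (\<^typ>\<open>'a \<Rightarrow> 'b option\<close>) whose domain is exactly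
  the carrier of the source space. So two operators out of \<open>X\<close> are equal iff they agree on \<open>X\<close>,
  composition is \<open>\<circ>\<^sub>m\<close>, and an operator determines the set it is defined on, as in set theory.
\<close>

definition ap :: "('a \<Rightarrow> 'b option) \<Rightarrow> 'a \<Rightarrow> 'b" (infixl \<open>\<cdot>\<close> 75) where
  "v \<cdot> x = the (v x)"

definition on :: "'a set \<Rightarrow> ('a \<Rightarrow> 'b) \<Rightarrow> 'a \<Rightarrow> 'b option" where
  "on A f = (\<lambda>x. if x \<in> A then Some (f x) else None)"

record 'a hilb =
  carr :: "'a set"
  vzero :: 'a
  vadd :: "'a \<Rightarrow> 'a \<Rightarrow> 'a"
  vscale :: "complex \<Rightarrow> 'a \<Rightarrow> 'a"
  vinner :: "'a \<Rightarrow> 'a \<Rightarrow> complex"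

definition hsubspace :: "'a hilb \<Rightarrow> 'a set \<Rightarrow> bool" where
  "hsubspace H V \<longleftrightarrow> V \<subseteq> carr H \<and> vzero H \<in> V \<and> (\<forall>x\<in>V. \<forall>y\<in>V. vadd H x y \<in> V) \<and>
     (\<forall>c. \<forall>x\<in>V. vscale H c x \<in> V)"

definition hspan :: "'a hilb \<Rightarrow> 'a set \<Rightarrow> 'a set" where
  "hspan H S = \<Inter>{V. hsubspace H V \<and> S \<subseteq> V}"

text \<open>
  Inner products are linear in the second argument. Completeness is automatic in finite dimension.
  The last three axioms normalise the values of the operations off the carrier, so that equality of
  records is equality of Hilbert spaces.
\<close>

locale fd_hilbert =
  fixes H :: "'a hilb"
  assumes zero_closed: "vzero H \<in> carr H"
    and add_closed: "\<lbrakk>x \<in> carr H; y \<in> carr H\<rbrakk> \<Longrightarrow> vadd H x y \<in> carr H"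
    and scale_closed: "x \<in> carr H \<Longrightarrow> vscale H c x \<in> carr H"
    and add_assoc: "\<lbrakk>x \<in> carr H; y \<in> carr H; z \<in> carr H\<rbrakk> \<Longrightarrow>
          vadd H (vadd H x y) z = vadd H x (vadd H y z)"
    and add_commute: "\<lbrakk>x \<in> carr H; y \<in> carr H\<rbrakk> \<Longrightarrow> vadd H x y = vadd H y x"
    and add_zero: "x \<in> carr H \<Longrightarrow> vadd H (vzero H) x = x"
    and add_inverse: "x \<in> carr H \<Longrightarrow> \<exists>y\<in>carr H. vadd H x y = vzero H"
    and scale_add: "\<lbrakk>x \<in> carr H; y \<in> carr H\<rbrakk> \<Longrightarrow>
          vscale H c (vadd H x y) = vadd H (vscale H c x) (vscale H c y)"
    and add_scale: "x \<in> carr H \<Longrightarrow> vscale H (c + d) x = vadd H (vscale H c x) (vscale H d x)"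
    and scale_scale: "x \<in> carr H \<Longrightarrow> vscale H c (vscale H d x) = vscale H (c * d) x"
    and scale_one: "x \<in> carr H \<Longrightarrow> vscale H 1 x = x"
    and inner_commute: "\<lbrakk>x \<in> carr H; y \<in> carr H\<rbrakk> \<Longrightarrow> vinner H x y = cnj (vinner H y x)"
    and inner_add: "\<lbrakk>x \<in> carr H; y \<in> carr H; z \<in> carr H\<rbrakk> \<Longrightarrow>
          vinner H x (vadd H y z) = vinner H x y + vinner H x z"
    and inner_scale: "\<lbrakk>x \<in> carr H; y \<in> carr H\<rbrakk> \<Longrightarrow> vinner H x (vscale H c y) = c * vinner H x y"
    and inner_pos: "\<lbrakk>x \<in> carr H; x \<noteq> vzero H\<rbrakk> \<Longrightarrow> 0 < Re (vinner H x x)"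
    and finite_dim: "\<exists>B. finite B \<and> B \<subseteq> carr H \<and> hspan H B = carr H"
    and add_off: "\<not> (x \<in> carr H \<and> y \<in> carr H) \<Longrightarrow> vadd H x y = undefined"
    and scale_off: "x \<notin> carr H \<Longrightarrow> vscale H c x = undefined"
    and inner_off: "\<not> (x \<in> carr H \<and> y \<in> carr H) \<Longrightarrow> vinner H x y = undefined"

definition mk_hilb ::
  "'a set \<Rightarrow> 'a \<Rightarrow> ('a \<Rightarrow> 'a \<Rightarrow> 'a) \<Rightarrow> (complex \<Rightarrow> 'a \<Rightarrow> 'a) \<Rightarrow> ('a \<Rightarrow> 'a \<Rightarrow> complex) \<Rightarrow> 'a hilb" where
  "mk_hilb C z a s i = \<lparr> carr = C, vzero = z,
     vadd = (\<lambda>x y. if x \<in> C \<and> y \<in> C then a x y else undefined),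
     vscale = (\<lambda>c x. if x \<in> C then s c x else undefined),
     vinner = (\<lambda>x y. if x \<in> C \<and> y \<in> C then i x y else undefined) \<rparr>"

definition is_onb :: "'a hilb \<Rightarrow> 'a set \<Rightarrow> bool" where
  "is_onb H B \<longleftrightarrow> finite B \<and> B \<subseteq> carr H \<and>
     (\<forall>e\<in>B. \<forall>f\<in>B. vinner H e f = (if e = f then 1 else 0)) \<and> hspan H B = carr H"

definition onb :: "'a hilb \<Rightarrow> 'a set" where
  "onb H = (SOME B. is_onb H B)"

definition cspace :: "complex hilb" where
  "cspace = mk_hilb UNIV 0 (+) (*) (\<lambda>x y. cnj x * y)"

definition lin :: "'a hilb \<Rightarrow> 'b hilb \<Rightarrow> ('a \<Rightarrow> 'b option) set" where
  "lin X Y = {v. dom v = carr X \<and> ran v \<subseteq> carr Y \<and>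
     (\<forall>x\<in>carr X. \<forall>x'\<in>carr X. v \<cdot> vadd X x x' = vadd Y (v \<cdot> x) (v \<cdot> x')) \<and>
     (\<forall>c. \<forall>x\<in>carr X. v \<cdot> vscale X c x = vscale Y c (v \<cdot> x))}"

text \<open>
  \<open>L(X,Y)\<close> as a Hilbert space, with pointwise operations and the Hilbert-Schmidt inner product
  \<open>tr (v\<^sup>\<dagger> w)\<close>, which does not depend on the orthonormal basis used to compute the trace. For
  \<open>Y = \<complex>\<close> this is the usual inner product of the dual Hilbert space.
\<close>

definition ops :: "'a hilb \<Rightarrow> 'b hilb \<Rightarrow> ('a \<Rightarrow> 'b option) hilb" where
  "ops X Y = mk_hilb (lin X Y)
     (on (carr X) (\<lambda>_. vzero Y))
     (\<lambda>v w. on (carr X) (\<lambda>x. vadd Y (v \<cdot> x) (w \<cdot> x)))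
     (\<lambda>c v. on (carr X) (\<lambda>x. vscale Y c (v \<cdot> x)))
     (\<lambda>v w. \<Sum>e\<in>onb X. vinner Y (v \<cdot> e) (w \<cdot> e))"

definition dual :: "'a hilb \<Rightarrow> ('a \<Rightarrow> complex option) hilb" where
  "dual X = ops X cspace"

text \<open>
  \<open>X \<otimes> Y\<close> is realised as \<open>L(X\<^sup>*,Y)\<close>, with \<open>x \<otimes> y\<close> the operator \<open>\<phi> \<mapsto> \<phi>(x) y\<close>. By itself \<open>L(X\<^sup>*,Y)\<close>
  does not determine \<open>X\<close> and \<open>Y\<close> (rescale the two inner products by inverse factors), so each of its
  elements is paired with \<open>(X,Y)\<close>: distinct pairs of atoms give distinct atoms of the product.
\<close>

type_synonym ('a, 'b) tens = "('a hilb \<times> 'b hilb) \<times> (('a \<Rightarrow> complex option) \<Rightarrow> 'b option)"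

definition tag :: "'t \<Rightarrow> 'a hilb \<Rightarrow> ('t \<times> 'a) hilb" where
  "tag t H = mk_hilb (Pair t ` carr H) (t, vzero H)
     (\<lambda>u w. (t, vadd H (snd u) (snd w)))
     (\<lambda>c u. (t, vscale H c (snd u)))
     (\<lambda>u w. vinner H (snd u) (snd w))"

definition tensor :: "'a hilb \<Rightarrow> 'b hilb \<Rightarrow> ('a, 'b) tens hilb" (infixr \<open>\<otimes>\<^sub>H\<close> 70) where
  "X \<otimes>\<^sub>H Y = tag (X, Y) (ops (dual X) Y)"

definition tens :: "'a hilb \<Rightarrow> 'b hilb \<Rightarrow> 'a \<Rightarrow> 'b \<Rightarrow> ('a, 'b) tens" where
  "tens X Y x y = ((X, Y), on (carr (dual X)) (\<lambda>\<phi>. vscale Y (\<phi> \<cdot> x) y))"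

section \<open>Operators\<close>

definition id_op :: "'a hilb \<Rightarrow> 'a \<Rightarrow> 'a option" where
  "id_op X = on (carr X) (\<lambda>x. x)"

definition adj_op :: "'a hilb \<Rightarrow> 'b hilb \<Rightarrow> ('a \<Rightarrow> 'b option) \<Rightarrow> 'b \<Rightarrow> 'a option" where
  "adj_op X Y v = (THE w. w \<in> lin Y X \<and>
     (\<forall>x\<in>carr X. \<forall>y\<in>carr Y. vinner X (w \<cdot> y) x = vinner Y y (v \<cdot> x)))"

definition dual_op ::
  "'b hilb \<Rightarrow> ('a \<Rightarrow> 'b option) \<Rightarrow> ('b \<Rightarrow> complex option) \<Rightarrow> ('a \<Rightarrow> complex option) option" where
  "dual_op Y v = on (carr (dual Y)) (\<lambda>\<phi>. \<phi> \<circ>\<^sub>m v)"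

definition tens_op :: "'a hilb \<Rightarrow> 'b hilb \<Rightarrow> 'c hilb \<Rightarrow> 'd hilb \<Rightarrow>
    ('a \<Rightarrow> 'c option) \<Rightarrow> ('b \<Rightarrow> 'd option) \<Rightarrow> ('a, 'b) tens \<Rightarrow> ('c, 'd) tens option" where
  "tens_op X1 X2 Y1 Y2 r1 r2 = (THE t. t \<in> lin (X1 \<otimes>\<^sub>H X2) (Y1 \<otimes>\<^sub>H Y2) \<and>
     (\<forall>x1\<in>carr X1. \<forall>x2\<in>carr X2. t \<cdot> tens X1 X2 x1 x2 = tens Y1 Y2 (r1 \<cdot> x1) (r2 \<cdot> x2)))"

definition assoc_op :: "'a hilb \<Rightarrow> 'b hilb \<Rightarrow> 'c hilb \<Rightarrow>
    (('a, 'b) tens, 'c) tens \<Rightarrow> ('a, ('b, 'c) tens) tens option" where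
  "assoc_op X Y Z = (THE t. t \<in> lin ((X \<otimes>\<^sub>H Y) \<otimes>\<^sub>H Z) (X \<otimes>\<^sub>H (Y \<otimes>\<^sub>H Z)) \<and>
     (\<forall>x\<in>carr X. \<forall>y\<in>carr Y. \<forall>z\<in>carr Z.
        t \<cdot> tens (X \<otimes>\<^sub>H Y) Z (tens X Y x y) z = tens X (Y \<otimes>\<^sub>H Z) x (tens Y Z y z)))"

definition lunit_op :: "'a hilb \<Rightarrow> (complex, 'a) tens \<Rightarrow> 'a option" where
  "lunit_op X = (THE t. t \<in> lin (cspace \<otimes>\<^sub>H X) X \<and>
     (\<forall>c. \<forall>x\<in>carr X. t \<cdot> tens cspace X c x = vscale X c x))"

definition runit_op :: "'a hilb \<Rightarrow> ('a, complex) tens \<Rightarrow> 'a option" where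
  "runit_op X = (THE t. t \<in> lin (X \<otimes>\<^sub>H cspace) X \<and>
     (\<forall>c. \<forall>x\<in>carr X. t \<cdot> tens X cspace x c = vscale X c x))"

definition braid_op :: "'a hilb \<Rightarrow> 'b hilb \<Rightarrow> ('a, 'b) tens \<Rightarrow> ('b, 'a) tens option" where
  "braid_op X Y = (THE t. t \<in> lin (X \<otimes>\<^sub>H Y) (Y \<otimes>\<^sub>H X) \<and>
     (\<forall>x\<in>carr X. \<forall>y\<in>carr Y. t \<cdot> tens X Y x y = tens Y X y x))"

text \<open>The isomorphism \<open>X\<^sup>* \<otimes> X \<rightarrow> L(X,X)\<close> sending \<open>\<phi> \<otimes> x\<close> to \<open>y \<mapsto> \<phi>(y) x\<close>, and the element
  corresponding to the identity operator.\<close>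

definition rank_one_iso :: "'a hilb \<Rightarrow> ('a \<Rightarrow> complex option, 'a) tens \<Rightarrow> ('a \<Rightarrow> 'a option) option" where
  "rank_one_iso X = (THE t. t \<in> lin (dual X \<otimes>\<^sub>H X) (ops X X) \<and>
     (\<forall>\<phi>\<in>carr (dual X). \<forall>x\<in>carr X.
        t \<cdot> tens (dual X) X \<phi> x = on (carr X) (\<lambda>y. vscale X (\<phi> \<cdot> y) x)))"

definition canonical :: "'a hilb \<Rightarrow> ('a \<Rightarrow> complex option, 'a) tens" where
  "canonical X = (THE u. u \<in> carr (dual X \<otimes>\<^sub>H X) \<and> rank_one_iso X \<cdot> u = id_op X)"

definition unit_op :: "'a hilb \<Rightarrow> complex \<Rightarrow> ('a \<Rightarrow> complex option, 'a) tens option" where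
  "unit_op X = on (carr cspace) (\<lambda>c. vscale (dual X \<otimes>\<^sub>H X) c (canonical X))"

definition counit_op :: "'a hilb \<Rightarrow> ('a, 'a \<Rightarrow> complex option) tens \<Rightarrow> complex option" where
  "counit_op X = (THE t. t \<in> lin (X \<otimes>\<^sub>H dual X) cspace \<and>
     (\<forall>x\<in>carr X. \<forall>\<phi>\<in>carr (dual X). t \<cdot> tens X (dual X) x \<phi> = \<phi> \<cdot> x))"

section \<open>Quantum sets and binary relations\<close>

text \<open>A quantum set is identified with its set of atoms.\<close>

type_synonym 'a qset = "'a hilb set"

definition is_qset :: "'a qset \<Rightarrow> bool" where
  "is_qset \<X> \<longleftrightarrow> (\<forall>X\<in>\<X>. fd_hilbert X \<and> carr X \<noteq> {vzero X})"

definition qprod :: "'a qset \<Rightarrow> 'b qset \<Rightarrow> ('a, 'b) tens qset" (infixr \<open>\<times>\<^sub>Q\<close> 70) where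
  "\<X> \<times>\<^sub>Q \<Y> = {X \<otimes>\<^sub>H Y | X Y. X \<in> \<X> \<and> Y \<in> \<Y>}"

definition qone :: "complex qset" (\<open>\<one>\<^sub>Q\<close>) where
  "\<one>\<^sub>Q = {cspace}"

definition qdual :: "'a qset \<Rightarrow> ('a \<Rightarrow> complex option) qset" where
  "qdual \<X> = dual ` \<X>"

text \<open>
  A relation carries its source and target. Only the values \<open>R(X,Y)\<close> at atoms are meaningful; at every
  other pair \<^term>\<open>rel_at\<close> is required to be the empty set (which is not a subspace), so that
  equality of records is equality of morphisms.
\<close>

record ('a, 'b) qrel =
  src :: "'a qset"
  tgt :: "'b qset"
  rel_at :: "'a hilb \<Rightarrow> 'b hilb \<Rightarrow> ('a \<Rightarrow> 'b option) set"

definition qRel :: "'a qset \<Rightarrow> 'b qset \<Rightarrow> ('a, 'b) qrel set" where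
  "qRel \<X> \<Y> = {R. src R = \<X> \<and> tgt R = \<Y> \<and>
     (\<forall>X Y. if X \<in> \<X> \<and> Y \<in> \<Y> then hsubspace (ops X Y) (rel_at R X Y) else rel_at R X Y = {})}"

text \<open>The relation whose value at a pair of atoms is the span of a given set of operators; it vanishes
  (is the zero subspace) where that set is empty.\<close>

definition span_rel ::
  "'a qset \<Rightarrow> 'b qset \<Rightarrow> ('a hilb \<Rightarrow> 'b hilb \<Rightarrow> ('a \<Rightarrow> 'b option) set) \<Rightarrow> ('a, 'b) qrel" where
  "span_rel \<X> \<Y> F = \<lparr> src = \<X>, tgt = \<Y>,
     rel_at = (\<lambda>X Y. if X \<in> \<X> \<and> Y \<in> \<Y> then hspan (ops X Y) (F X Y) else {}) \<rparr>"

definition rid :: "'a qset \<Rightarrow> ('a, 'a) qrel" where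
  "rid \<X> = span_rel \<X> \<X> (\<lambda>X X'. if X = X' then {id_op X} else {})"

definition rcomp :: "('b, 'c) qrel \<Rightarrow> ('a, 'b) qrel \<Rightarrow> ('a, 'c) qrel" (infixr \<open>\<circ>\<^sub>R\<close> 55) where
  "S \<circ>\<^sub>R R = span_rel (src R) (tgt S)
     (\<lambda>X Z. {s \<circ>\<^sub>m r | s r Y. Y \<in> tgt R \<and> s \<in> rel_at S Y Z \<and> r \<in> rel_at R X Y})"

definition rprod :: "('a, 'c) qrel \<Rightarrow> ('b, 'd) qrel \<Rightarrow> (('a, 'b) tens, ('c, 'd) tens) qrel"
    (infixr \<open>\<times>\<^sub>R\<close> 70) where
  "R1 \<times>\<^sub>R R2 = span_rel (src R1 \<times>\<^sub>Q src R2) (tgt R1 \<times>\<^sub>Q tgt R2)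
     (\<lambda>A B. {tens_op X1 X2 Y1 Y2 r1 r2 | X1 X2 Y1 Y2 r1 r2.
        A = X1 \<otimes>\<^sub>H X2 \<and> B = Y1 \<otimes>\<^sub>H Y2 \<and> X1 \<in> src R1 \<and> X2 \<in> src R2 \<and> Y1 \<in> tgt R1 \<and> Y2 \<in> tgt R2 \<and>
        r1 \<in> rel_at R1 X1 Y1 \<and> r2 \<in> rel_at R2 X2 Y2})"

definition rdual :: "('a, 'b) qrel \<Rightarrow> ('b \<Rightarrow> complex option, 'a \<Rightarrow> complex option) qrel" where
  "rdual R = \<lparr> src = qdual (tgt R), tgt = qdual (src R),
     rel_at = (\<lambda>B A. {dual_op Y v | X Y v. A = dual X \<and> B = dual Y \<and> X \<in> src R \<and> Y \<in> tgt R \<and>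
        v \<in> rel_at R X Y}) \<rparr>"

definition rdag :: "('a, 'b) qrel \<Rightarrow> ('b, 'a) qrel" where
  "rdag R = \<lparr> src = tgt R, tgt = src R, rel_at = (\<lambda>Y X. adj_op X Y ` rel_at R X Y) \<rparr>"

definition is_iso :: "('a, 'b) qrel \<Rightarrow> bool" where
  "is_iso U \<longleftrightarrow> (\<exists>V\<in>qRel (tgt U) (src U). V \<circ>\<^sub>R U = rid (src U) \<and> U \<circ>\<^sub>R V = rid (tgt U))"

definition rinv :: "('a, 'b) qrel \<Rightarrow> ('b, 'a) qrel" where
  "rinv U = (THE V. V \<in> qRel (tgt U) (src U) \<and> V \<circ>\<^sub>R U = rid (src U) \<and> U \<circ>\<^sub>R V = rid (tgt U))"

section \<open>Structure morphisms\<close>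

definition rassoc :: "'a qset \<Rightarrow> 'b qset \<Rightarrow> 'c qset \<Rightarrow>
    ((('a, 'b) tens, 'c) tens, ('a, ('b, 'c) tens) tens) qrel" where
  "rassoc \<X> \<Y> \<Z> = span_rel ((\<X> \<times>\<^sub>Q \<Y>) \<times>\<^sub>Q \<Z>) (\<X> \<times>\<^sub>Q (\<Y> \<times>\<^sub>Q \<Z>))
     (\<lambda>A B. {assoc_op X Y Z | X Y Z. X \<in> \<X> \<and> Y \<in> \<Y> \<and> Z \<in> \<Z> \<and>
        A = (X \<otimes>\<^sub>H Y) \<otimes>\<^sub>H Z \<and> B = X \<otimes>\<^sub>H (Y \<otimes>\<^sub>H Z)})"

definition rlunit :: "'a qset \<Rightarrow> ((complex, 'a) tens, 'a) qrel" where
  "rlunit \<X> = span_rel (\<one>\<^sub>Q \<times>\<^sub>Q \<X>) \<X> (\<lambda>A B. {lunit_op X | X. X \<in> \<X> \<and> A = cspace \<otimes>\<^sub>H X \<and> B = X})"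

definition rrunit :: "'a qset \<Rightarrow> (('a, complex) tens, 'a) qrel" where
  "rrunit \<X> = span_rel (\<X> \<times>\<^sub>Q \<one>\<^sub>Q) \<X> (\<lambda>A B. {runit_op X | X. X \<in> \<X> \<and> A = X \<otimes>\<^sub>H cspace \<and> B = X})"

definition rbraid :: "'a qset \<Rightarrow> 'b qset \<Rightarrow> (('a, 'b) tens, ('b, 'a) tens) qrel" where
  "rbraid \<X> \<Y> = span_rel (\<X> \<times>\<^sub>Q \<Y>) (\<Y> \<times>\<^sub>Q \<X>)
     (\<lambda>A B. {braid_op X Y | X Y. X \<in> \<X> \<and> Y \<in> \<Y> \<and> A = X \<otimes>\<^sub>H Y \<and> B = Y \<otimes>\<^sub>H X})"

definition qunit :: "'a qset \<Rightarrow> (complex, ('a \<Rightarrow> complex option, 'a) tens) qrel" where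
  "qunit \<X> = span_rel \<one>\<^sub>Q (qdual \<X> \<times>\<^sub>Q \<X>)
     (\<lambda>A B. {unit_op X | X. X \<in> \<X> \<and> A = cspace \<and> B = dual X \<otimes>\<^sub>H X})"

definition qcounit :: "'a qset \<Rightarrow> (('a, 'a \<Rightarrow> complex option) tens, complex) qrel" where
  "qcounit \<X> = span_rel (\<X> \<times>\<^sub>Q qdual \<X>) \<one>\<^sub>Q
     (\<lambda>A B. {counit_op X | X. X \<in> \<X> \<and> A = X \<otimes>\<^sub>H dual X \<and> B = cspace})"

end

theory Submission
  imports Defs
begin

text \<open>
  A relation is determined by any family of operators spanning its values. Composition, product,
  dual and adjoint of relations are spans of the elementwise operations on such families, since these
  operations on operators are linear or conjugate linear in each argument and since \<open>X \<otimes> Y\<close> and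
  \<open>X\<^sup>*\<close> determine the atoms \<open>X\<close> and \<open>Y\<close>. As every variable relation occurs at most once on each
  side of each law, the law holds as soon as the corresponding identity holds between operators
  of finite-dimensional Hilbert spaces, where it can be checked on pure tensors.

  In the snake identities and in \<open>E\<^sup>\<dagger> = S \<circ> H\<close> the canonical element of \<open>X\<^sup>* \<otimes> X\<close> enters linearly
  (or conjugate linearly). Both sides make sense with an arbitrary \<open>u\<close> in its place, with \<open>id\<close> replaced by
  the operator that \<open>u\<close> represents, so that it suffices to treat \<open>u = \<phi> \<otimes> x\<close>.
\<close>

section \<open>Vectors and orthonormal bases\<close>

text \<open>The families are sets of arrows (source atom, target atom, operator), and a law becomes
  an equality of two such sets, each indexed by independent choices of one arrow per occurrence of a
  relation. This is where single occurrence matters: for a relation occurring twice the two choices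
  would be independent, and an operator identity with the same operator in both places would not
  suffice. Identities and structure morphisms may recur, because the atoms at their ends determine
  their arrows.

  A composite of relations collects operators through all intermediate atoms, so a snake could a
  priori mix atoms. It does not: the counit lives only on an atom paired with its own dual, which
  leaves one snake of operators for each generator of \<open>R\<close>.

  Finite dimension is given only as a finite spanning set, while traces, adjoints and tensors need
  orthonormal bases; hence Gram-Schmidt. The structure operators are mostly definite descriptions,
  which denote something only after existence and uniqueness are shown; the universal property of
  the tensor product is the main source of both.\<close>

lemma on_ap [simp]: "x \<in> A \<Longrightarrow> on A f \<cdot> x = f x"
  by (simp add: on_def ap_def)

lemma dom_on [simp]: "dom (on A f) = A"
  by (auto simp: on_def split: if_splits)

lemma ran_on: "ran (on A f) = f ` A"
  by (auto simp: on_def ran_def split: if_splits)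

lemma on_cong: "(\<And>x. x \<in> A \<Longrightarrow> f x = g x) \<Longrightarrow> on A f = on A g"
  by (auto simp: on_def)

lemmas [simp] = fd_hilbert.zero_closed fd_hilbert.add_closed fd_hilbert.scale_closed
  fd_hilbert.add_zero fd_hilbert.scale_scale fd_hilbert.scale_one fd_hilbert.inner_add fd_hilbert.inner_scale

lemma inner_zero_right [simp]: "\<lbrakk>fd_hilbert H; x \<in> carr H\<rbrakk> \<Longrightarrow> vinner H x (vzero H) = 0"
  using fd_hilbert.inner_add[of H x "vzero H" "vzero H"] by simp

lemma inner_zero_left [simp]: "\<lbrakk>fd_hilbert H; x \<in> carr H\<rbrakk> \<Longrightarrow> vinner H (vzero H) x = 0"
  using fd_hilbert.inner_commute[of H "vzero H" x] by simp

lemma inner_add_left [simp]: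
  "\<lbrakk>fd_hilbert H; x \<in> carr H; y \<in> carr H; z \<in> carr H\<rbrakk> \<Longrightarrow>
    vinner H (vadd H x y) z = vinner H x z + vinner H y z"
  using fd_hilbert.inner_commute[of H "vadd H x y" z] fd_hilbert.inner_commute[of H x z]
    fd_hilbert.inner_commute[of H y z] by simp

lemma inner_scale_left [simp]:
  "\<lbrakk>fd_hilbert H; x \<in> carr H; y \<in> carr H\<rbrakk> \<Longrightarrow> vinner H (vscale H c x) y = cnj c * vinner H x y"
  using fd_hilbert.inner_commute[of H "vscale H c x" y] fd_hilbert.inner_commute[of H x y] by simp

lemma inner_eq_0: "\<lbrakk>fd_hilbert H; x \<in> carr H; vinner H x x = 0\<rbrakk> \<Longrightarrow> x = vzero H"
  using fd_hilbert.inner_pos[of H x] by force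

text \<open>The squared norm of the left side is 0, so positive definiteness replaces the usual
  cancellation argument.\<close>

lemma scale_0 [simp]:
  assumes "fd_hilbert H" "x \<in> carr H" shows "vscale H 0 x = vzero H"
  by (rule inner_eq_0) (use assms in auto)

lemma scale_zero [simp]:
  assumes "fd_hilbert H" shows "vscale H c (vzero H) = vzero H"
  by (rule inner_eq_0) (use assms in auto)

text \<open>Reduces identities between vectors to identities between complex numbers, and so avoids
  associative-commutative rewriting relative to the carrier.\<close>

lemma vec_eqI:
  assumes H: "fd_hilbert H" and x: "x \<in> carr H" and y: "y \<in> carr H"
    and eq: "\<And>z. z \<in> carr H \<Longrightarrow> vinner H z x = vinner H z y"
  shows "x = y"
proof -
  let ?n = "vscale H (-1) y"
  \<comment> \<open>\<open>d\<close> is the difference of \<open>x\<close> and \<open>y\<close>.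
    Testing \<open>eq\<close> against \<open>d\<close> itself makes its norm vanish.\<close>
  define d where "d = vadd H x ?n"
  have d: "d \<in> carr H" and "vinner H d d = 0"
    using H x y eq[of d] by (auto simp: d_def)
  then have "d = vzero H" by (rule inner_eq_0[OF H])
  then have "y = vadd H d y" using H y by simp
  also have "\<dots> = vadd H x (vadd H ?n y)"
    unfolding d_def using H x y by (simp add: fd_hilbert.add_assoc)
  also have "vadd H ?n y = vzero H"
    using fd_hilbert.add_scale[OF H y, of "-1" 1] H y by simp
  also have "vadd H x (vzero H) = x"
    using H x fd_hilbert.add_commute[of H x "vzero H"] by simp
  finally show ?thesis ..
qed

lemma add_zero_right [simp]: "\<lbrakk>fd_hilbert H; x \<in> carr H\<rbrakk> \<Longrightarrow> vadd H x (vzero H) = x"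
  by (rule vec_eqI) auto

text \<open>Sums run over lists because \<^const>\<open>vadd\<close> is associative and commutative only on the carrier.\<close>

primrec lsum :: "'a hilb \<Rightarrow> ('i \<Rightarrow> 'a) \<Rightarrow> 'i list \<Rightarrow> 'a" where
  "lsum H f [] = vzero H"
| "lsum H f (i # is) = vadd H (f i) (lsum H f is)"

lemma lsum_closed [simp]:
  "fd_hilbert H \<Longrightarrow> (\<And>i. i \<in> set is \<Longrightarrow> f i \<in> carr H) \<Longrightarrow> lsum H f is \<in> carr H"
  by (induction "is") auto

lemma lsum_cong: "(\<And>i. i \<in> set is \<Longrightarrow> f i = g i) \<Longrightarrow> lsum H f is = lsum H g is"
  by (induction "is") auto

lemma lsum_subspace: "hsubspace H V \<Longrightarrow> (\<And>i. i \<in> set is \<Longrightarrow> f i \<in> V) \<Longrightarrow> lsum H f is \<in> V"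
  by (induction "is") (auto simp: hsubspace_def)

lemma inner_lsum:
  "\<lbrakk>fd_hilbert H; z \<in> carr H; \<And>i. i \<in> set is \<Longrightarrow> f i \<in> carr H\<rbrakk> \<Longrightarrow>
    vinner H z (lsum H f is) = (\<Sum>i\<leftarrow>is. vinner H z (f i))"
  by (induction "is") auto

lemma lsum_add:
  assumes H: "fd_hilbert H" and "\<And>i. i \<in> set is \<Longrightarrow> f i \<in> carr H" "\<And>i. i \<in> set is \<Longrightarrow> g i \<in> carr H"
  shows "lsum H (\<lambda>i. vadd H (f i) (g i)) is = vadd H (lsum H f is) (lsum H g is)"
  by (rule vec_eqI[OF H])
    (use assms in \<open>auto simp: inner_lsum sum_list_addf[symmetric] intro!: arg_cong[where f = sum_list]\<close>)

lemma lsum_scale: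
  assumes H: "fd_hilbert H" and "\<And>i. i \<in> set is \<Longrightarrow> f i \<in> carr H"
  shows "lsum H (\<lambda>i. vscale H c (f i)) is = vscale H c (lsum H f is)"
  by (rule vec_eqI[OF H])
    (use assms in \<open>auto simp: inner_lsum sum_list_const_mult[symmetric] intro!: arg_cong[where f = sum_list]\<close>)

section \<open>Linear spans\<close>

lemma carr_subspace: "fd_hilbert H \<Longrightarrow> hsubspace H (carr H)"
  by (auto simp: hsubspace_def)

lemma hspan_base: "S \<subseteq> hspan H S"
  by (auto simp: hspan_def)

lemma hspan_minimal: "hsubspace H V \<Longrightarrow> S \<subseteq> V \<Longrightarrow> hspan H S \<subseteq> V"
  by (auto simp: hspan_def)

text \<open>If \<open>S\<close> leaves the carrier, no subspace contains it and the intersection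
  defining \<open>hspan H S\<close> is the whole type. Hence the second premise here, and the first
  conjunct of \<open>spans\<close> below.\<close>

lemma hspan_subspace: "fd_hilbert H \<Longrightarrow> S \<subseteq> carr H \<Longrightarrow> hsubspace H (hspan H S)"
  using carr_subspace[of H] unfolding hspan_def hsubspace_def by blast

lemma hspan_mono: "S \<subseteq> T \<Longrightarrow> hspan H S \<subseteq> hspan H T"
  by (auto simp: hspan_def)

lemma hspan_self: "hsubspace H V \<Longrightarrow> hspan H V = V"
  by (meson hspan_base hspan_minimal order_refl subset_antisym)

lemma hspan_carr: "fd_hilbert H \<Longrightarrow> S \<subseteq> carr H \<Longrightarrow> hspan H S \<subseteq> carr H"
  by (meson carr_subspace hspan_minimal)

text \<open>Induction on the list: the next vector minus its projection is either zero, and then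
  adds nothing to the span, or can be normalised and appended. The input need not be independent.
  Only an inclusion of spans is claimed; for a list that spans the carrier it is already an
  equality.\<close>

lemma gram_schmidt:
  assumes H: "fd_hilbert H" and "set bs \<subseteq> carr H"
  shows "\<exists>es. distinct es \<and> set es \<subseteq> carr H \<and>
    (\<forall>e\<in>set es. \<forall>f\<in>set es. vinner H e f = (if e = f then 1 else 0)) \<and>
    hspan H (set bs) \<subseteq> hspan H (set es)"
  using assms(2)
proof (induction bs)
  case Nil
  show ?case by (rule exI[of _ "[]"]) auto
next
  case (Cons b bs)
  then obtain es where es: "distinct es" "set es \<subseteq> carr H"
    "\<And>e f. e \<in> set es \<Longrightarrow> f \<in> set es \<Longrightarrow> vinner H e f = (if e = f then 1 else 0)"
    "hspan H (set bs) \<subseteq> hspan H (set es)" by auto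
  have b: "b \<in> carr H" using Cons.prems by auto
  \<comment> \<open>\<open>p\<close> is the orthogonal projection of \<open>b\<close> onto the span
    of \<open>es\<close>, and \<open>d\<close> the residual.\<close>
  define p where "p = lsum H (\<lambda>e. vscale H (vinner H e b) e) es"
  define d where "d = vadd H b (vscale H (-1) p)"
  have p: "p \<in> carr H" unfolding p_def using es(2) H b by (auto simp: subset_iff)
  have d: "d \<in> carr H" unfolding d_def using b p H by auto
  have b_eq: "b = vadd H p d"
    by (rule vec_eqI[OF H]) (use H b p in \<open>auto simp: d_def\<close>)
  \<comment> \<open>Common to both cases: once \<open>es\<close> and \<open>d\<close> are reached,
    so is \<open>b\<close>, being the sum of \<open>p\<close> and \<open>d\<close>.\<close>
  have extend: "hspan H (set (b # bs)) \<subseteq> hspan H T" if T: "set es \<subseteq> T" "T \<subseteq> carr H" "d \<in> hspan H T" for T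
  proof -
    have sub: "hsubspace H (hspan H T)" using hspan_subspace[OF H] T by auto
    have "p \<in> hspan H T" unfolding p_def
    proof (rule lsum_subspace[OF sub])
      fix e assume "e \<in> set es"
      then show "vscale H (vinner H e b) e \<in> hspan H T"
        using T(1) sub hspan_base[of T H] by (auto simp: hsubspace_def)
    qed
    then have "b \<in> hspan H T"
      using sub T(3) by (subst b_eq) (auto simp: hsubspace_def)
    moreover have "set bs \<subseteq> hspan H T"
      using es(4) hspan_base[of "set bs" H] hspan_mono[OF T(1), of H] by auto
    ultimately show ?thesis by (intro hspan_minimal[OF sub]) auto
  qed
  show ?case
  proof (cases "d = vzero H")
    case True
    then have "d \<in> hspan H (set es)"
      using hspan_subspace[OF H es(2)] by (auto simp: hsubspace_def)
    then have "hspan H (set (b # bs)) \<subseteq> hspan H (set es)" using es(2) by (intro extend) auto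
    with es show ?thesis by blast
  next
    case False
    define n where "n = sqrt (Re (vinner H d d))"
    have pos: "Re (vinner H d d) > 0" using fd_hilbert.inner_pos[OF H d False] .
    then have n: "n > 0" by (simp add: n_def)
    \<comment> \<open>Positivity concerns only the real part; conjugate symmetry removes the
      imaginary part, so that the norm \<open>n\<close> really squares to the complex number
      \<open>vinner H d d\<close>.\<close>
    have "vinner H d d \<in> \<real>"
      using fd_hilbert.inner_commute[OF H d d] by (metis Reals_cnj_iff)
    then have dd: "vinner H d d = complex_of_real (n * n)"
      using pos by (simp add: n_def)
    define e' where "e' = vscale H (complex_of_real (1 / n)) d"
    have e': "e' \<in> carr H" using H d by (simp add: e'_def)
    have ee: "vinner H e' e' = 1" using H d n by (simp add: e'_def dd)
    have orth_d: "vinner H e d = 0" if e: "e \<in> set es" for e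
    proof -
      have "vinner H e p = (\<Sum>f\<leftarrow>es. vinner H f b * vinner H e f)"
        unfolding p_def using H es(2) e b
        by (subst inner_lsum) (auto simp: subset_iff intro!: arg_cong[where f = sum_list])
      also have "\<dots> = (\<Sum>f\<in>set es. vinner H f b * vinner H e f)"
        using es(1) by (simp add: sum_list_distinct_conv_sum_set)
      also have "\<dots> = (\<Sum>f\<in>set es. if f = e then vinner H f b else 0)"
        by (rule sum.cong) (use es(3) e in auto)
      also have "\<dots> = vinner H e b" using e by simp
      finally show ?thesis using e es(2) H b p by (auto simp: d_def)
    qed
    have orth: "vinner H e e' = 0" "vinner H e' e = 0" if "e \<in> set es" for e
    proof -
      have e: "e \<in> carr H" using that es by auto
      show "vinner H e e' = 0" using H e d orth_d[OF that] by (simp add: e'_def)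
      then show "vinner H e' e = 0" using fd_hilbert.inner_commute[OF H e' e] by simp
    qed
    \<comment> \<open>A member of \<open>es\<close> would be orthogonal to \<open>e'\<close>,
      whereas \<open>e'\<close> has norm 1.\<close>
    then have "e' \<notin> set es" using ee by force
    moreover have "hspan H (set (b # bs)) \<subseteq> hspan H (set (e' # es))"
    proof (rule extend)
      have "d = vscale H n e'" using H d n by (simp add: e'_def)
      moreover have "hsubspace H (hspan H (set (e' # es)))"
        using H e' es(2) by (intro hspan_subspace) auto
      moreover have "e' \<in> hspan H (set (e' # es))" using hspan_base by fastforce
      ultimately show "d \<in> hspan H (set (e' # es))" by (auto simp: hsubspace_def)
    qed (use es e' in auto)
    ultimately show ?thesis
      using es e' ee orth by (intro exI[of _ "e' # es"]) auto
  qed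
qed

lemma is_onb_onb: assumes H: "fd_hilbert H" shows "is_onb H (onb H)"
proof -
  obtain B where B: "finite B" "B \<subseteq> carr H" "hspan H B = carr H"
    using fd_hilbert.finite_dim[OF H] by blast
  then obtain bs where "set bs = B" using finite_list by blast
  with gram_schmidt[OF H, of bs] B obtain es where
    "set es \<subseteq> carr H" "\<forall>e\<in>set es. \<forall>f\<in>set es. vinner H e f = (if e = f then 1 else 0)"
    "carr H \<subseteq> hspan H (set es)" by auto
  then have "is_onb H (set es)"
    using hspan_carr[OF H, of "set es"] by (simp add: is_onb_def subset_antisym)
  then show ?thesis unfolding onb_def by (rule someI)
qed

text \<open>An enumeration of the chosen orthonormal basis, needed because vector sums
  \<open>lsum\<close> run over lists; scalar sums stay over the set \<open>onb H\<close>.\<close>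

definition basis :: "'a hilb \<Rightarrow> 'a list" where
  "basis H = (SOME es. distinct es \<and> set es = onb H)"

lemma basis:
  assumes "fd_hilbert H" shows "distinct (basis H)" and "set (basis H) = onb H"
proof -
  have "finite (onb H)" using is_onb_onb[OF assms] by (simp add: is_onb_def)
  then have "\<exists>es. distinct es \<and> set es = onb H" using finite_distinct_list by blast
  from someI_ex[OF this] show "distinct (basis H)" and "set (basis H) = onb H"
    by (auto simp: basis_def)
qed

lemma basis_sum: "fd_hilbert H \<Longrightarrow> (\<Sum>e\<leftarrow>basis H. g e) = (\<Sum>e\<in>onb H. g e)"
  using basis[of H] by (simp add: sum_list_distinct_conv_sum_set)

lemma onb_carr [simp]: "fd_hilbert H \<Longrightarrow> e \<in> onb H \<Longrightarrow> e \<in> carr H"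
  using is_onb_onb[of H] by (auto simp: is_onb_def)

lemma basis_carr [simp]: "fd_hilbert H \<Longrightarrow> e \<in> set (basis H) \<Longrightarrow> e \<in> carr H"
  by (simp add: basis)

lemma onb_inner: "\<lbrakk>fd_hilbert H; e \<in> onb H; f \<in> onb H\<rbrakk> \<Longrightarrow> vinner H e f = (if e = f then 1 else 0)"
  using is_onb_onb[of H] by (auto simp: is_onb_def)

lemma finite_onb [simp]: "fd_hilbert H \<Longrightarrow> finite (onb H)"
  using is_onb_onb[of H] by (auto simp: is_onb_def)

definition spans :: "'a hilb \<Rightarrow> 'a set \<Rightarrow> bool" where
  "spans H S \<longleftrightarrow> S \<subseteq> carr H \<and> hspan H S = carr H"

lemma spans_carr: "fd_hilbert H \<Longrightarrow> spans H (carr H)"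
  by (simp add: spans_def carr_subspace hspan_self)

lemma spans_onb: "fd_hilbert H \<Longrightarrow> spans H (onb H)"
  using is_onb_onb[of H] by (auto simp: is_onb_def spans_def)

text \<open>The vectors with property \<open>P\<close> form a subspace containing \<open>S\<close>.
  Almost every extension from generators below, such as from pure tensors to all tensors, is an
  instance.\<close>

lemma spans_induct [consumes 3, case_names base zero add scale]:
  assumes "fd_hilbert H" "spans H S" "x \<in> carr H"
    and "\<And>x. x \<in> S \<Longrightarrow> P x" and "P (vzero H)"
    and "\<And>x y. \<lbrakk>x \<in> carr H; y \<in> carr H; P x; P y\<rbrakk> \<Longrightarrow> P (vadd H x y)"
    and "\<And>c x. \<lbrakk>x \<in> carr H; P x\<rbrakk> \<Longrightarrow> P (vscale H c x)"
  shows "P x"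
proof -
  have "hsubspace H {x \<in> carr H. P x}" using assms by (auto simp: hsubspace_def)
  then have "hspan H S \<subseteq> {x \<in> carr H. P x}"
    using assms by (intro hspan_minimal) (auto simp: spans_def)
  then show ?thesis using assms by (auto simp: spans_def)
qed

text \<open>Both sides are linear in \<open>x\<close>, so \<open>x\<close> may be taken in the basis
  itself; there orthonormality leaves the single summand \<open>e = x\<close>.\<close>

lemma onb_expand:
  assumes H: "fd_hilbert H" and x: "x \<in> carr H"
  shows "lsum H (\<lambda>e. vscale H (vinner H e x) e) (basis H) = x"
  using H spans_onb[OF H] x
proof (induction rule: spans_induct)
  case (base x)
  then have x: "x \<in> carr H" using H by simp
  show ?case
  proof (rule vec_eqI[OF H])
    fix z assume z: "z \<in> carr H"
    have "vinner H z (lsum H (\<lambda>e. vscale H (vinner H e x) e) (basis H)) =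
       (\<Sum>e\<leftarrow>basis H. vinner H e x * vinner H z e)"
      using H z x by (subst inner_lsum) (auto intro!: arg_cong[where f = sum_list])
    also have "\<dots> = (\<Sum>e\<in>onb H. if e = x then vinner H z e else 0)"
      unfolding basis_sum[OF H] by (rule sum.cong) (use H base onb_inner[OF H _ base] in auto)
    finally show "vinner H z (lsum H (\<lambda>e. vscale H (vinner H e x) e) (basis H)) = vinner H z x"
      using H base by simp
  qed (use H x in auto)
next
  case zero
  have "lsum H (\<lambda>e. vscale H (vinner H e (vzero H)) e) (basis H) = lsum H (\<lambda>e. vscale H 0 e) (basis H)"
    using H by (intro lsum_cong) simp
  then show ?case using H by (simp add: lsum_scale)
next
  case (add x y)
  have "lsum H (\<lambda>e. vscale H (vinner H e (vadd H x y)) e) (basis H) =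
    lsum H (\<lambda>e. vadd H (vscale H (vinner H e x) e) (vscale H (vinner H e y) e)) (basis H)"
    using H add by (intro lsum_cong) (simp add: fd_hilbert.add_scale)
  then show ?case using H add by (simp add: lsum_add)
next
  case (scale c x)
  have "lsum H (\<lambda>e. vscale H (vinner H e (vscale H c x)) e) (basis H) =
    lsum H (\<lambda>e. vscale H c (vscale H (vinner H e x) e)) (basis H)"
    using H scale by (intro lsum_cong) simp
  then show ?case using H scale by (simp add: lsum_scale)
qed

lemma parseval:
  assumes H: "fd_hilbert H" and x: "x \<in> carr H" and y: "y \<in> carr H"
  shows "(\<Sum>e\<in>onb H. vinner H x e * vinner H e y) = vinner H x y"
proof -
  have "vinner H x y = vinner H x (lsum H (\<lambda>e. vscale H (vinner H e y) e) (basis H))"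
    using onb_expand[OF H y] by simp
  also have "\<dots> = (\<Sum>e\<leftarrow>basis H. vinner H x e * vinner H e y)"
    using H x y by (subst inner_lsum) (auto intro!: arg_cong[where f = sum_list])
  finally show ?thesis using basis_sum[OF H] by metis
qed

section \<open>A criterion for concrete Hilbert spaces, and the complex line\<close>

lemma mk_hilb_simps [simp]:
  "carr (mk_hilb C z a s i) = C" "vzero (mk_hilb C z a s i) = z"
  "x \<in> C \<Longrightarrow> y \<in> C \<Longrightarrow> vadd (mk_hilb C z a s i) x y = a x y"
  "x \<in> C \<Longrightarrow> vscale (mk_hilb C z a s i) c x = s c x"
  "x \<in> C \<Longrightarrow> y \<in> C \<Longrightarrow> vinner (mk_hilb C z a s i) x y = i x y"
  by (auto simp: mk_hilb_def)

text \<open>The three axioms about values off the carrier hold for any record made by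
  \<open>mk_hilb\<close>. Inverses are asked for in the form \<open>vscale H (-1) x\<close>, and
  spanning only as an inclusion. Used for the complex numbers, operator spaces and tagged
  spaces.\<close>

lemma fd_hilbert_mkI:
  fixes H :: "'a hilb"
  assumes "H = mk_hilb C z a s i"
    and "vzero H \<in> carr H"
    and "\<And>x y. \<lbrakk>x \<in> carr H; y \<in> carr H\<rbrakk> \<Longrightarrow> vadd H x y \<in> carr H"
    and "\<And>c x. x \<in> carr H \<Longrightarrow> vscale H c x \<in> carr H"
    and "\<And>x y z. \<lbrakk>x \<in> carr H; y \<in> carr H; z \<in> carr H\<rbrakk> \<Longrightarrow>
          vadd H (vadd H x y) z = vadd H x (vadd H y z)"
    and "\<And>x y. \<lbrakk>x \<in> carr H; y \<in> carr H\<rbrakk> \<Longrightarrow> vadd H x y = vadd H y x"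
    and "\<And>x. x \<in> carr H \<Longrightarrow> vadd H (vzero H) x = x"
    and "\<And>x. x \<in> carr H \<Longrightarrow> vadd H x (vscale H (-1) x) = vzero H"
    and "\<And>c x y. \<lbrakk>x \<in> carr H; y \<in> carr H\<rbrakk> \<Longrightarrow>
          vscale H c (vadd H x y) = vadd H (vscale H c x) (vscale H c y)"
    and "\<And>c d x. x \<in> carr H \<Longrightarrow> vscale H (c + d) x = vadd H (vscale H c x) (vscale H d x)"
    and "\<And>c d x. x \<in> carr H \<Longrightarrow> vscale H c (vscale H d x) = vscale H (c * d) x"
    and "\<And>x. x \<in> carr H \<Longrightarrow> vscale H 1 x = x"
    and "\<And>x y. \<lbrakk>x \<in> carr H; y \<in> carr H\<rbrakk> \<Longrightarrow> vinner H x y = cnj (vinner H y x)"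
    and "\<And>x y z. \<lbrakk>x \<in> carr H; y \<in> carr H; z \<in> carr H\<rbrakk> \<Longrightarrow>
          vinner H x (vadd H y z) = vinner H x y + vinner H x z"
    and "\<And>c x y. \<lbrakk>x \<in> carr H; y \<in> carr H\<rbrakk> \<Longrightarrow> vinner H x (vscale H c y) = c * vinner H x y"
    and "\<And>x. \<lbrakk>x \<in> carr H; x \<noteq> vzero H\<rbrakk> \<Longrightarrow> 0 < Re (vinner H x x)"
    and "\<exists>B. finite B \<and> B \<subseteq> carr H \<and> carr H \<subseteq> hspan H B"
  shows "fd_hilbert H"
proof
  have "hsubspace H (carr H)" using assms(2-4) by (auto simp: hsubspace_def)
  then show "\<exists>B. finite B \<and> B \<subseteq> carr H \<and> hspan H B = carr H"
    using assms(17) hspan_minimal by (metis subset_antisym)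
  show "vadd H x y = undefined" if "\<not> (x \<in> carr H \<and> y \<in> carr H)" for x y
    using that unfolding assms(1) by (auto simp: mk_hilb_def)
  show "vscale H c x = undefined" if "x \<notin> carr H" for c x
    using that unfolding assms(1) by (auto simp: mk_hilb_def)
  show "vinner H x y = undefined" if "\<not> (x \<in> carr H \<and> y \<in> carr H)" for x y
    using that unfolding assms(1) by (auto simp: mk_hilb_def)
  show "\<exists>y\<in>carr H. vadd H x y = vzero H" if "x \<in> carr H" for x
    using assms(4,8) that by blast
qed (fact assms)+

lemma cspace_simps [simp]:
  "carr cspace = UNIV" "vzero cspace = 0" "vadd cspace x y = x + y" "vscale cspace c x = c * x"
  "vinner cspace x y = cnj x * y"
  by (auto simp: cspace_def)

lemma fd_hilbert_cspace [simp]: "fd_hilbert cspace"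
proof (rule fd_hilbert_mkI[OF cspace_def])
  have "UNIV \<subseteq> V" if V: "hsubspace cspace V" "{1} \<subseteq> V" for V
  proof
    fix c :: complex
    show "c \<in> V" using V by (auto simp: hsubspace_def dest!: spec[where x = c])
  qed
  then show "\<exists>B. finite B \<and> B \<subseteq> carr cspace \<and> carr cspace \<subseteq> hspan cspace B"
    by (intro exI[of _ "{1}"]) (auto simp: hspan_def)
  show "0 < Re (vinner cspace x x)" if "x \<noteq> vzero cspace" for x
    using that by (simp add: complex_neq_0 power2_eq_square)
qed (auto simp: algebra_simps)

lemma lsum_cspace [simp]: "lsum cspace f is = (\<Sum>i\<leftarrow>is. f i)"
  by (induction "is") auto

section \<open>Linear operators\<close>

lemma lin_closed [simp]: "v \<in> lin X Y \<Longrightarrow> x \<in> carr X \<Longrightarrow> v \<cdot> x \<in> carr Y"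
  by (force simp: lin_def ap_def ran_def dom_def)

lemma lin_add [simp]:
  "v \<in> lin X Y \<Longrightarrow> x \<in> carr X \<Longrightarrow> y \<in> carr X \<Longrightarrow> v \<cdot> vadd X x y = vadd Y (v \<cdot> x) (v \<cdot> y)"
  unfolding lin_def by blast

lemma lin_scale [simp]: "v \<in> lin X Y \<Longrightarrow> x \<in> carr X \<Longrightarrow> v \<cdot> vscale X c x = vscale Y c (v \<cdot> x)"
  unfolding lin_def by blast

lemma lin_zero [simp]:
  assumes "v \<in> lin X Y" "fd_hilbert X" "fd_hilbert Y" shows "v \<cdot> vzero X = vzero Y"
  using lin_scale[of v X Y "vzero X" 0] assms by simp

lemma lin_onI:
  assumes "fd_hilbert X" "\<And>x. x \<in> carr X \<Longrightarrow> f x \<in> carr Y"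
    and "\<And>x y. x \<in> carr X \<Longrightarrow> y \<in> carr X \<Longrightarrow> f (vadd X x y) = vadd Y (f x) (f y)"
    and "\<And>c x. x \<in> carr X \<Longrightarrow> f (vscale X c x) = vscale Y c (f x)"
  shows "on (carr X) f \<in> lin X Y"
  unfolding lin_def using assms by (auto simp del: lin_closed lin_add lin_scale simp: ran_on)

lemma op_eqI:
  assumes "dom v = A" "dom w = A" "\<And>x. x \<in> A \<Longrightarrow> v \<cdot> x = w \<cdot> x"
  shows "v = w"
proof
  fix x
  show "v x = w x"
  proof (cases "x \<in> A")
    case True
    then obtain a b where "v x = Some a" "w x = Some b" using assms(1,2) by blast
    then show ?thesis using assms(3)[OF True] by (simp add: ap_def)
  next
    case False
    then have "v x = None" "w x = None" using assms(1,2) by blast+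
    then show ?thesis by simp
  qed
qed

lemma lin_dom: "v \<in> lin X Y \<Longrightarrow> dom v = carr X"
  unfolding lin_def by blast

lemma lin_eqI:
  "\<lbrakk>v \<in> lin X Y; w \<in> lin X Y; \<And>x. x \<in> carr X \<Longrightarrow> v \<cdot> x = w \<cdot> x\<rbrakk> \<Longrightarrow> v = w"
  by (rule op_eqI[of v "carr X"]) (auto simp: lin_dom)

lemma lin_eq_spansI:
  assumes "fd_hilbert X" "fd_hilbert Y" and v: "v \<in> lin X Y" and w: "w \<in> lin X Y"
    and S: "spans X S" and eq: "\<And>x. x \<in> S \<Longrightarrow> v \<cdot> x = w \<cdot> x"
  shows "v = w"
proof (rule lin_eqI[OF v w])
  fix x assume "x \<in> carr X"
  with assms(1) S show "v \<cdot> x = w \<cdot> x"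
    by (induction rule: spans_induct) (use assms in auto)
qed

lemma lin_lsum:
  assumes "fd_hilbert X" "fd_hilbert Y" "v \<in> lin X Y" "\<And>i. i \<in> set is \<Longrightarrow> f i \<in> carr X"
  shows "v \<cdot> lsum X f is = lsum Y (\<lambda>i. v \<cdot> f i) is"
  using assms(4) by (induction "is") (use assms(1-3) in auto)

lemma lin_ap: "v \<in> lin X Y \<Longrightarrow> x \<in> carr X \<Longrightarrow> v x = Some (v \<cdot> x)"
  using lin_dom[of v X Y] by (force simp: ap_def)

lemma comp_ap [simp]: "r \<in> lin X Y \<Longrightarrow> x \<in> carr X \<Longrightarrow> (s \<circ>\<^sub>m r) \<cdot> x = s \<cdot> (r \<cdot> x)"
  using lin_dom[of r X Y] by (force simp: map_comp_def ap_def)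

lemma comp_lin [simp]:
  assumes X: "fd_hilbert X" and r: "r \<in> lin X Y" and s: "s \<in> lin Y Z"
  shows "s \<circ>\<^sub>m r \<in> lin X Z"
proof -
  have "s \<circ>\<^sub>m r = on (carr X) (\<lambda>x. s \<cdot> (r \<cdot> x))"
  proof
    fix x
    show "(s \<circ>\<^sub>m r) x = on (carr X) (\<lambda>x. s \<cdot> (r \<cdot> x)) x"
    proof (cases "x \<in> carr X")
      case True
      then show ?thesis using r s by (simp add: map_comp_def on_def lin_ap[OF r] lin_ap[OF s])
    next
      case False
      then have "r x = None" using lin_dom[OF r] by blast
      with False show ?thesis by (simp add: map_comp_def on_def)
    qed
  qed
  moreover have "on (carr X) (\<lambda>x. s \<cdot> (r \<cdot> x)) \<in> lin X Z"
    by (rule lin_onI) (use X in \<open>auto simp: lin_closed[OF r] lin_add[OF r] lin_scale[OF r]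
      lin_closed[OF s] lin_add[OF s] lin_scale[OF s]\<close>)
  ultimately show ?thesis by simp
qed

lemma id_lin [simp]: "fd_hilbert X \<Longrightarrow> id_op X \<in> lin X X"
  unfolding id_op_def by (rule lin_onI) auto

lemma id_ap [simp]: "x \<in> carr X \<Longrightarrow> id_op X \<cdot> x = x"
  by (simp add: id_op_def)

lemma comp_id [simp]: "fd_hilbert X \<Longrightarrow> r \<in> lin X Y \<Longrightarrow> r \<circ>\<^sub>m id_op X = r"
  by (rule lin_eqI[of _ X Y]) (auto intro: comp_lin[OF _ id_lin] simp: comp_ap[OF id_lin])

lemma id_comp [simp]: "\<lbrakk>fd_hilbert X; fd_hilbert Y; r \<in> lin X Y\<rbrakk> \<Longrightarrow> id_op Y \<circ>\<^sub>m r = r"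
  by (rule lin_eqI[of _ X Y]) (auto intro: comp_lin[OF _ _ id_lin])

lemma map_comp_assoc: "(t \<circ>\<^sub>m s) \<circ>\<^sub>m r = t \<circ>\<^sub>m (s \<circ>\<^sub>m r)"
  by (auto simp: map_comp_def split: option.splits)

section \<open>Spaces of operators\<close>

lemma carr_ops [simp]: "carr (ops X Y) = lin X Y"
  by (simp add: ops_def)

lemma ops_zero_ap [simp]: "x \<in> carr X \<Longrightarrow> vzero (ops X Y) \<cdot> x = vzero Y"
  by (simp add: ops_def)

lemma ops_add_ap [simp]:
  "\<lbrakk>v \<in> lin X Y; w \<in> lin X Y; x \<in> carr X\<rbrakk> \<Longrightarrow> vadd (ops X Y) v w \<cdot> x = vadd Y (v \<cdot> x) (w \<cdot> x)"
  by (simp add: ops_def)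

lemma ops_scale_ap [simp]:
  "\<lbrakk>v \<in> lin X Y; x \<in> carr X\<rbrakk> \<Longrightarrow> vscale (ops X Y) c v \<cdot> x = vscale Y c (v \<cdot> x)"
  by (simp add: ops_def)

lemma ops_inner:
  "\<lbrakk>v \<in> lin X Y; w \<in> lin X Y\<rbrakk> \<Longrightarrow> vinner (ops X Y) v w = (\<Sum>e\<in>onb X. vinner Y (v \<cdot> e) (w \<cdot> e))"
  by (simp add: ops_def)

lemma ops_zero_lin: "\<lbrakk>fd_hilbert X; fd_hilbert Y\<rbrakk> \<Longrightarrow> vzero (ops X Y) \<in> lin X Y"
  by (auto simp: ops_def intro!: lin_onI)

lemma ops_add_lin:
  assumes "fd_hilbert X" and Y: "fd_hilbert Y" and "v \<in> lin X Y" "w \<in> lin X Y"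
  shows "vadd (ops X Y) v w \<in> lin X Y"
proof -
  have "on (carr X) (\<lambda>x. vadd Y (v \<cdot> x) (w \<cdot> x)) \<in> lin X Y"
  proof (rule lin_onI)
    fix x y assume "x \<in> carr X" "y \<in> carr X"
    then show "vadd Y (v \<cdot> vadd X x y) (w \<cdot> vadd X x y) = vadd Y (vadd Y (v \<cdot> x) (w \<cdot> x)) (vadd Y (v \<cdot> y) (w \<cdot> y))"
      by (intro vec_eqI[OF Y]) (use assms in \<open>auto simp: lin_closed[of v X] lin_closed[of w X] lin_add[of v X] lin_add[of w X]\<close>)
  qed (use assms in \<open>auto simp: fd_hilbert.scale_add\<close>)
  then show ?thesis using assms by (simp add: ops_def)
qed

lemma ops_scale_lin:
  assumes "fd_hilbert X" "fd_hilbert Y" "v \<in> lin X Y"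
  shows "vscale (ops X Y) c v \<in> lin X Y"
proof -
  have "on (carr X) (\<lambda>x. vscale Y c (v \<cdot> x)) \<in> lin X Y"
    by (rule lin_onI) (use assms in \<open>auto simp: fd_hilbert.scale_add mult.commute\<close>)
  then show ?thesis using assms by (simp add: ops_def)
qed

text \<open>Available before \<open>ops X Y\<close> is known to be a Hilbert space. Through
  \<open>lsum_subspace\<close> it places sums of operators in \<open>lin X Y\<close>, where
  \<open>lsum_closed\<close> would already need the Hilbert space axioms.\<close>

lemma carr_ops_subspace: "\<lbrakk>fd_hilbert X; fd_hilbert Y\<rbrakk> \<Longrightarrow> hsubspace (ops X Y) (lin X Y)"
  by (simp add: hsubspace_def ops_zero_lin ops_add_lin ops_scale_lin)

lemma lsum_ops_ap:
  assumes "fd_hilbert X" "fd_hilbert Y" and f: "\<And>i. i \<in> set is \<Longrightarrow> f i \<in> lin X Y" and "x \<in> carr X"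
  shows "lsum (ops X Y) f is \<cdot> x = lsum Y (\<lambda>i. f i \<cdot> x) is"
  using f
proof (induction "is")
  case (Cons i "is")
  then have "lsum (ops X Y) f is \<in> lin X Y"
    using carr_ops_subspace[OF assms(1,2)] by (intro lsum_subspace) auto
  then show ?case using Cons assms(4) by simp
qed (use assms in simp)

text \<open>The operator |y><x| of Dirac notation, conjugate linear in \<open>x\<close> and linear
  in \<open>y\<close>.\<close>

definition ketbra :: "'a hilb \<Rightarrow> 'b hilb \<Rightarrow> 'a \<Rightarrow> 'b \<Rightarrow> 'a \<Rightarrow> 'b option" where
  "ketbra X Y x y = on (carr X) (\<lambda>z. vscale Y (vinner X x z) y)"

lemma ketbra_ap [simp]: "z \<in> carr X \<Longrightarrow> ketbra X Y x y \<cdot> z = vscale Y (vinner X x z) y"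
  by (simp add: ketbra_def)

lemma ketbra_lin [simp]:
  "\<lbrakk>fd_hilbert X; fd_hilbert Y; x \<in> carr X; y \<in> carr Y\<rbrakk> \<Longrightarrow> ketbra X Y x y \<in> lin X Y"
  unfolding ketbra_def by (rule lin_onI) (auto simp: fd_hilbert.add_scale)

text \<open>This is the matrix expansion of \<open>v\<close>: the sum of |f><e| with coefficients
  <f, v e>. It supplies the finite spanning set for the finite-dimension axiom of
  \<open>ops X Y\<close>, and is therefore proved without using that \<open>ops X Y\<close> is a
  Hilbert space.\<close>

lemma hspan_ketbra:
  assumes X: "fd_hilbert X" and Y: "fd_hilbert Y"
  shows "lin X Y \<subseteq> hspan (ops X Y) {ketbra X Y e f | e f. e \<in> onb X \<and> f \<in> onb Y}" (is "_ \<subseteq> hspan _ ?K")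
proof
  fix v assume v: "v \<in> lin X Y"
  \<comment> \<open>\<open>g e\<close> is the column of the matrix of \<open>v\<close> at
    \<open>e\<close>, that is the operator |v e><e| with \<open>v \<cdot> e\<close> expanded in the
    basis of \<open>Y\<close>.\<close>
  define g where "g e = lsum (ops X Y) (\<lambda>f. vscale (ops X Y) (vinner Y f (v \<cdot> e)) (ketbra X Y e f)) (basis Y)" for e
  have g: "g e \<in> lin X Y" if "e \<in> onb X" for e
    unfolding g_def using X Y that by (intro lsum_subspace[OF carr_ops_subspace] ops_scale_lin) auto
  have g_ap: "g e \<cdot> x = vscale Y (vinner X e x) (v \<cdot> e)" if e: "e \<in> onb X" and x: "x \<in> carr X" for e x
  proof -
    have "g e \<cdot> x = lsum Y (\<lambda>f. vscale (ops X Y) (vinner Y f (v \<cdot> e)) (ketbra X Y e f) \<cdot> x) (basis Y)"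
      unfolding g_def using X Y x e by (intro lsum_ops_ap ops_scale_lin) auto
    also have "\<dots> = lsum Y (\<lambda>f. vscale Y (vinner X e x) (vscale Y (vinner Y f (v \<cdot> e)) f)) (basis Y)"
      using X Y x e by (intro lsum_cong) (simp add: mult.commute)
    also have "\<dots> = vscale Y (vinner X e x) (v \<cdot> e)"
      using X Y v e by (simp add: lsum_scale onb_expand lin_closed[OF v])
    finally show ?thesis .
  qed
  have "v = lsum (ops X Y) g (basis X)"
  proof (rule lin_eqI[OF v])
    show "lsum (ops X Y) g (basis X) \<in> lin X Y"
      using X Y g by (intro lsum_subspace[OF carr_ops_subspace]) (auto simp: basis)
    fix x assume x: "x \<in> carr X"
    have "lsum (ops X Y) g (basis X) \<cdot> x = lsum Y (\<lambda>e. v \<cdot> vscale X (vinner X e x) e) (basis X)"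
      using X Y x v g by (subst lsum_ops_ap) (auto simp: basis g_ap lin_scale[OF v] intro!: lsum_cong)
    also have "\<dots> = v \<cdot> lsum X (\<lambda>e. vscale X (vinner X e x) e) (basis X)"
      using X Y x v by (subst lin_lsum) auto
    finally show "v \<cdot> x = lsum (ops X Y) g (basis X) \<cdot> x" using X x by (simp add: onb_expand)
  qed
  moreover have "lsum (ops X Y) g (basis X) \<in> V"
    if V: "hsubspace (ops X Y) V" "?K \<subseteq> V" for V
  proof (rule lsum_subspace[OF V(1)])
    fix e assume e: "e \<in> set (basis X)"
    show "g e \<in> V" unfolding g_def
    proof (rule lsum_subspace[OF V(1)])
      fix f assume "f \<in> set (basis Y)"
      then have "ketbra X Y e f \<in> V" using X Y e V(2) by (auto simp: basis)
      then show "vscale (ops X Y) (vinner Y f (v \<cdot> e)) (ketbra X Y e f) \<in> V"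
        using V(1) by (simp add: hsubspace_def)
    qed
  qed
  ultimately show "v \<in> hspan (ops X Y) ?K"
    by (auto simp: hspan_def)
qed

lemma Re_inner_nonneg: "fd_hilbert H \<Longrightarrow> x \<in> carr H \<Longrightarrow> 0 \<le> Re (vinner H x x)"
  using fd_hilbert.inner_pos[of H x] by (cases "x = vzero H") auto

lemma fd_hilbert_ops [simp]:
  assumes X: "fd_hilbert X" and Y: "fd_hilbert Y"
  shows "fd_hilbert (ops X Y)"
proof -
  note [simp] = ops_zero_lin[OF X Y] ops_add_lin[OF X Y] ops_scale_lin[OF X Y]
  show ?thesis
  \<comment> \<open>The cases are numbered as the premises of \<open>fd_hilbert_mkI\<close> after
    the one discharged here: 7 is the additive inverse, 12 to 15 concern the inner product, 16 is
    finite dimension. The vector space laws hold because they hold pointwise.\<close>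
  proof (rule fd_hilbert_mkI[OF ops_def], goal_cases)
    case (4 x y z) then show ?case
      by (intro lin_eqI[of _ X Y]) (use Y in \<open>auto simp: fd_hilbert.add_assoc\<close>)
  next
    case (5 x y) then show ?case
      by (intro lin_eqI[of _ X Y]) (use Y in \<open>auto simp: fd_hilbert.add_commute\<close>)
  next
    case (6 x) then show ?case by (intro lin_eqI[of _ X Y]) (use Y in auto)
  next
    case (7 x) show ?case
    proof (rule lin_eqI[of _ X Y])
      fix a assume "a \<in> carr X"
      then show "vadd (ops X Y) x (vscale (ops X Y) (-1) x) \<cdot> a = vzero (ops X Y) \<cdot> a"
        using 7 by (intro vec_eqI[OF Y]) (use Y in auto)
    qed (use 7 in auto)
  next
    case (8 c x y) then show ?case
      by (intro lin_eqI[of _ X Y]) (use Y in \<open>auto simp: fd_hilbert.scale_add\<close>)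
  next
    case (9 c d x) then show ?case
      by (intro lin_eqI[of _ X Y]) (use Y in \<open>auto simp: fd_hilbert.add_scale\<close>)
  next
    case (10 c d x) then show ?case by (intro lin_eqI[of _ X Y]) (use Y in auto)
  next
    case (11 x) then show ?case by (intro lin_eqI[of _ X Y]) (use Y in auto)
  next
    case (12 x y) then show ?case
      using X Y by (auto simp: ops_inner intro!: sum.cong fd_hilbert.inner_commute)
  next
    case (13 x y z) then show ?case using X Y by (simp add: ops_inner sum.distrib[symmetric])
  next
    case (14 c x y) then show ?case using X Y by (simp add: ops_inner sum_distrib_left)
  next
    case (15 x)
    have nonneg: "0 \<le> Re (vinner Y (x \<cdot> e) (x \<cdot> e))" if "e \<in> onb X" for e
      using that 15 X Y by (simp add: Re_inner_nonneg)
    \<comment> \<open>The Hilbert-Schmidt norm only sees values at basis vectors, but an operator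
      that vanishes on a spanning set is zero.\<close>
    have "\<exists>e\<in>onb X. x \<cdot> e \<noteq> vzero Y"
    proof (rule ccontr)
      assume "\<not> ?thesis"
      then have "x = vzero (ops X Y)"
        using 15 X Y by (intro lin_eq_spansI[OF X Y _ _ spans_onb[OF X]]) auto
      then show False using 15 by simp
    qed
    then obtain e where e: "e \<in> onb X" "x \<cdot> e \<noteq> vzero Y" by blast
    then have "0 < Re (vinner Y (x \<cdot> e) (x \<cdot> e))"
      using 15 X Y by (intro fd_hilbert.inner_pos) auto
    then have "0 < (\<Sum>e\<in>onb X. Re (vinner Y (x \<cdot> e) (x \<cdot> e)))"
      using e nonneg X by (intro sum_pos2) auto
    then show ?case using 15 by (simp add: ops_inner)
  next
    case 16
    let ?K = "{ketbra X Y e f | e f. e \<in> onb X \<and> f \<in> onb Y}"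
    have "?K = (\<lambda>(e, f). ketbra X Y e f) ` (onb X \<times> onb Y)"
      by auto
    then have "finite ?K" using X Y by simp
    then show ?case
      using X Y hspan_ketbra[OF X Y] by (intro exI[of _ ?K]) auto
  qed auto
qed

lemma spans_ketbra:
  assumes X: "fd_hilbert X" and Y: "fd_hilbert Y"
  shows "spans (ops X Y) {ketbra X Y e f | e f. e \<in> carr X \<and> f \<in> carr Y}" (is "spans _ ?K")
proof -
  have "?K \<subseteq> lin X Y" using X Y by auto
  moreover have "lin X Y \<subseteq> hspan (ops X Y) ?K"
    by (rule order_trans[OF hspan_ketbra[OF X Y] hspan_mono]) (use X Y in \<open>blast dest: onb_carr\<close>)
  ultimately show ?thesis
    using hspan_carr[of "ops X Y" ?K] X Y by (auto simp: spans_def)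
qed

section \<open>Dual spaces\<close>

lemma fd_hilbert_dual [simp]: "fd_hilbert X \<Longrightarrow> fd_hilbert (dual X)"
  by (simp add: dual_def)

lemma carr_dual [simp]: "carr (dual X) = lin X cspace"
  by (simp add: dual_def)

lemma dual_simps [simp]:
  "x \<in> carr X \<Longrightarrow> vzero (dual X) \<cdot> x = 0"
  "\<lbrakk>\<phi> \<in> lin X cspace; \<psi> \<in> lin X cspace; x \<in> carr X\<rbrakk> \<Longrightarrow> vadd (dual X) \<phi> \<psi> \<cdot> x = \<phi> \<cdot> x + \<psi> \<cdot> x"
  "\<lbrakk>\<phi> \<in> lin X cspace; x \<in> carr X\<rbrakk> \<Longrightarrow> vscale (dual X) c \<phi> \<cdot> x = c * (\<phi> \<cdot> x)"
  by (simp_all add: dual_def)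

lemma dual_lin [simp]:
  assumes "fd_hilbert X"
  shows "vzero (dual X) \<in> lin X cspace"
  "\<lbrakk>\<phi> \<in> lin X cspace; \<psi> \<in> lin X cspace\<rbrakk> \<Longrightarrow> vadd (dual X) \<phi> \<psi> \<in> lin X cspace"
  "\<phi> \<in> lin X cspace \<Longrightarrow> vscale (dual X) c \<phi> \<in> lin X cspace"
  using fd_hilbert.zero_closed[of "dual X"] fd_hilbert.add_closed[of "dual X"]
    fd_hilbert.scale_closed[of "dual X"] assms by simp_all

definition bra :: "'a hilb \<Rightarrow> 'a \<Rightarrow> 'a \<Rightarrow> complex option" where
  "bra X x = on (carr X) (vinner X x)"

lemma bra_ap [simp]: "y \<in> carr X \<Longrightarrow> bra X x \<cdot> y = vinner X x y"
  by (simp add: bra_def)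

lemma bra_lin [simp]: "fd_hilbert X \<Longrightarrow> x \<in> carr X \<Longrightarrow> bra X x \<in> lin X cspace"
  unfolding bra_def by (rule lin_onI) auto

lemma dual_ap_sum:
  assumes X: "fd_hilbert X" and \<phi>: "\<phi> \<in> lin X cspace" and x: "x \<in> carr X"
  shows "(\<Sum>e\<in>onb X. vinner X e x * (\<phi> \<cdot> e)) = \<phi> \<cdot> x"
proof -
  have "\<phi> \<cdot> x = \<phi> \<cdot> lsum X (\<lambda>e. vscale X (vinner X e x) e) (basis X)"
    using onb_expand[OF X x] by simp
  also have "\<dots> = (\<Sum>e\<leftarrow>basis X. vinner X e x * (\<phi> \<cdot> e))"
    using X \<phi> x by (subst lin_lsum) (auto simp: lin_scale[OF \<phi>] intro!: arg_cong[where f = sum_list])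
  finally show ?thesis using basis_sum[OF X] by metis
qed

text \<open>The Hilbert-Schmidt sum is the expansion of \<open>x\<close> in the basis, pushed
  through \<phi>, so the chosen basis disappears. Evaluation at \<open>x\<close> thus becomes an
  inner product on the dual, which links pure tensors to rank-one operators and later lets the dual
  space determine the inner product of \<open>X\<close>.\<close>

lemma inner_bra:
  assumes X: "fd_hilbert X" and x: "x \<in> carr X" and \<phi>: "\<phi> \<in> lin X cspace"
  shows "vinner (dual X) (bra X x) \<phi> = \<phi> \<cdot> x"
proof -
  have "vinner (dual X) (bra X x) \<phi> = (\<Sum>e\<in>onb X. vinner X e x * (\<phi> \<cdot> e))"
    unfolding dual_def using X x \<phi>
    by (simp add: ops_inner) (auto intro!: sum.cong simp: fd_hilbert.inner_commute[OF X x])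
  then show ?thesis using dual_ap_sum[OF X \<phi> x] by simp
qed

lemma riesz:
  assumes X: "fd_hilbert X" and \<eta>: "\<eta> \<in> lin X cspace"
  obtains x where "x \<in> carr X" "\<eta> = bra X x"
proof
  \<comment> \<open>The coefficients are conjugated because \<open>vinner\<close> is conjugate
    linear in its first argument, where the representing vector stands.\<close>
  let ?x = "lsum X (\<lambda>e. vscale X (cnj (\<eta> \<cdot> e)) e) (basis X)"
  show x: "?x \<in> carr X" using X by simp
  show "\<eta> = bra X ?x"
  proof (rule lin_eqI[OF \<eta>])
    fix z assume z: "z \<in> carr X"
    have "vinner X z ?x = (\<Sum>e\<leftarrow>basis X. cnj (\<eta> \<cdot> e) * vinner X z e)"
      using X z by (subst inner_lsum) (auto intro!: arg_cong[where f = sum_list])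
    also have "\<dots> = (\<Sum>e\<in>onb X. cnj (vinner X e z * (\<eta> \<cdot> e)))"
      unfolding basis_sum[OF X] using X z by (intro sum.cong) (auto simp: fd_hilbert.inner_commute[OF X z])
    also have "\<dots> = cnj (\<eta> \<cdot> z)" unfolding cnj_sum[symmetric] using dual_ap_sum[OF X \<eta> z] by simp
    finally show "\<eta> \<cdot> z = bra X ?x \<cdot> z"
      using fd_hilbert.inner_commute[OF X x z] z by simp
  qed (use X x in simp)
qed

section \<open>Adjoints\<close>

lemma adj_unique:
  assumes X: "fd_hilbert X" and "w \<in> lin Y X" "w' \<in> lin Y X"
    and "\<And>x y. x \<in> carr X \<Longrightarrow> y \<in> carr Y \<Longrightarrow> vinner X (w \<cdot> y) x = vinner X (w' \<cdot> y) x"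
  shows "w = w'"
proof (rule lin_eqI[OF assms(2,3)])
  fix y assume y: "y \<in> carr Y"
  have "vinner X x (w \<cdot> y) = vinner X x (w' \<cdot> y)" if "x \<in> carr X" for x
    using assms(4)[OF that y] fd_hilbert.inner_commute[OF X that, of "w \<cdot> y"]
      fd_hilbert.inner_commute[OF X that, of "w' \<cdot> y"] assms(2,3) y by simp
  then show "w \<cdot> y = w' \<cdot> y" using assms(2,3) y by (intro vec_eqI[OF X]) auto
qed

lemma adj_exists:
  assumes X: "fd_hilbert X" and Y: "fd_hilbert Y" and v: "v \<in> lin X Y"
  shows "\<exists>w \<in> lin Y X. \<forall>x\<in>carr X. \<forall>y\<in>carr Y. vinner X (w \<cdot> y) x = vinner Y y (v \<cdot> x)"
proof
  \<comment> \<open>Forced by the expansion in the basis: the coefficient of the adjoint image of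
    \<open>y\<close> at \<open>e\<close> has to be <v e, y>.\<close>
  let ?f = "\<lambda>y. lsum X (\<lambda>e. vscale X (vinner Y (v \<cdot> e) y) e) (basis X)"
  show "on (carr Y) ?f \<in> lin Y X"
  proof (rule lin_onI)
    fix y y' assume "y \<in> carr Y" "y' \<in> carr Y"
    then show "?f (vadd Y y y') = vadd X (?f y) (?f y')"
      using X Y v by (subst lsum_add[symmetric]) (auto intro!: lsum_cong simp: fd_hilbert.add_scale)
  next
    fix c y assume "y \<in> carr Y"
    then show "?f (vscale Y c y) = vscale X c (?f y)"
      using X Y v by (subst lsum_scale[symmetric]) (auto intro!: lsum_cong)
  qed (use X Y v in auto)
  show "\<forall>x\<in>carr X. \<forall>y\<in>carr Y. vinner X (on (carr Y) ?f \<cdot> y) x = vinner Y y (v \<cdot> x)"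
  proof (intro ballI)
    fix x y assume x: "x \<in> carr X" and y: "y \<in> carr Y"
    have "vinner X x (?f y) = (\<Sum>e\<leftarrow>basis X. vinner Y (v \<cdot> e) y * vinner X x e)"
      using X Y v x y by (subst inner_lsum) (auto intro!: arg_cong[where f = sum_list])
    then have "vinner X (?f y) x = cnj (\<Sum>e\<leftarrow>basis X. vinner Y (v \<cdot> e) y * vinner X x e)"
      using X x y by (subst fd_hilbert.inner_commute[OF X]) auto
    also have "\<dots> = (\<Sum>e\<leftarrow>basis X. vinner Y y (v \<cdot> vscale X (vinner X e x) e))"
      unfolding basis_sum[OF X] cnj_sum
    proof (rule sum.cong)
      fix e assume "e \<in> onb X"
      then show "cnj (vinner Y (v \<cdot> e) y * vinner X x e) = vinner Y y (v \<cdot> vscale X (vinner X e x) e)"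
        using X Y v x y fd_hilbert.inner_commute[OF Y y, of "v \<cdot> e"] fd_hilbert.inner_commute[OF X _ x, of e]
        by (simp add: mult.commute)
    qed simp
    also have "\<dots> = vinner Y y (lsum Y (\<lambda>e. v \<cdot> vscale X (vinner X e x) e) (basis X))"
      using X Y v x y by (subst inner_lsum) auto
    also have "lsum Y (\<lambda>e. v \<cdot> vscale X (vinner X e x) e) (basis X) = v \<cdot> x"
      using X Y v x by (subst lin_lsum[symmetric]) (auto simp: onb_expand)
    finally show "vinner X (on (carr Y) ?f \<cdot> y) x = vinner Y y (v \<cdot> x)" using y by simp
  qed
qed

lemma
  assumes "fd_hilbert X" "fd_hilbert Y" "v \<in> lin X Y"
  shows adj_lin [simp]: "adj_op X Y v \<in> lin Y X"
    and adj_inner: "\<And>x y. x \<in> carr X \<Longrightarrow> y \<in> carr Y \<Longrightarrow>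
      vinner X (adj_op X Y v \<cdot> y) x = vinner Y y (v \<cdot> x)"
proof -
  obtain w where w: "w \<in> lin Y X" "\<forall>x\<in>carr X. \<forall>y\<in>carr Y. vinner X (w \<cdot> y) x = vinner Y y (v \<cdot> x)"
    using adj_exists[OF assms] by blast
  have "adj_op X Y v \<in> lin Y X \<and>
     (\<forall>x\<in>carr X. \<forall>y\<in>carr Y. vinner X (adj_op X Y v \<cdot> y) x = vinner Y y (v \<cdot> x))"
    unfolding adj_op_def
    by (rule theI[where a = w]) (use w in \<open>auto intro!: adj_unique[OF assms(1)]\<close>)
  then show "adj_op X Y v \<in> lin Y X" "\<And>x y. x \<in> carr X \<Longrightarrow> y \<in> carr Y \<Longrightarrow>
      vinner X (adj_op X Y v \<cdot> y) x = vinner Y y (v \<cdot> x)" by auto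
qed

lemma adj_inner':
  assumes "fd_hilbert X" "fd_hilbert Y" "v \<in> lin X Y" "x \<in> carr X" "y \<in> carr Y"
  shows "vinner X x (adj_op X Y v \<cdot> y) = vinner Y (v \<cdot> x) y"
  using adj_inner[OF assms] assms fd_hilbert.inner_commute[of X x "adj_op X Y v \<cdot> y"]
    fd_hilbert.inner_commute[of Y "v \<cdot> x" y] adj_lin[OF assms(1-3)] by simp

lemma adj_eqI:
  assumes "fd_hilbert X" "fd_hilbert Y" "v \<in> lin X Y" "w \<in> lin Y X"
    and "\<And>x y. x \<in> carr X \<Longrightarrow> y \<in> carr Y \<Longrightarrow> vinner X (w \<cdot> y) x = vinner Y y (v \<cdot> x)"
  shows "adj_op X Y v = w"
  by (rule adj_unique[OF assms(1)]) (use assms in \<open>auto simp: adj_inner\<close>)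

lemma adj_adj [simp]:
  assumes "fd_hilbert X" "fd_hilbert Y" "v \<in> lin X Y"
  shows "adj_op Y X (adj_op X Y v) = v"
  by (rule adj_eqI) (use assms in \<open>auto simp: adj_inner'\<close>)

lemma adj_id [simp]: "fd_hilbert X \<Longrightarrow> adj_op X X (id_op X) = id_op X"
  by (rule adj_eqI) auto

lemma adj_comp:
  assumes "fd_hilbert X" "fd_hilbert Y" "fd_hilbert Z" and r: "r \<in> lin X Y" and s: "s \<in> lin Y Z"
  shows "adj_op X Z (s \<circ>\<^sub>m r) = adj_op X Y r \<circ>\<^sub>m adj_op Y Z s"
proof -
  note a = adj_lin[OF assms(1,2) r] adj_lin[OF assms(2,3) s]
  show ?thesis
    by (rule adj_eqI) (use assms in \<open>auto simp: comp_ap[OF a(2)] adj_inner lin_closed[OF a(2)] intro!: comp_lin a\<close>)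
qed

text \<open>Both sides are sesquilinear: the second argument is extended from \<open>S\<close> to
  the carrier first, then the first.\<close>

lemma isometry_spans:
  assumes A: "fd_hilbert A" and B: "fd_hilbert B" and t: "t \<in> lin A B" and S: "spans A S"
    and iso: "\<And>s s'. s \<in> S \<Longrightarrow> s' \<in> S \<Longrightarrow> vinner B (t \<cdot> s) (t \<cdot> s') = vinner A s s'"
    and x: "x \<in> carr A" and y: "y \<in> carr A"
  shows "vinner B (t \<cdot> x) (t \<cdot> y) = vinner A x y"
proof -
  have "vinner B (t \<cdot> s) (t \<cdot> y) = vinner A s y" if s: "s \<in> S" for s
    using A S y
  proof (induction rule: spans_induct)
    case (base x) then show ?case using iso s by simp
  qed (use A B t s S in \<open>auto simp: spans_def subset_iff\<close>)
  with A S x show ?thesis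
    by (induction rule: spans_induct) (use A B t y in auto)
qed

text \<open>The range of a linear operator is a subspace, so surjectivity need only be checked on
  generators.\<close>

lemma spans_range:
  assumes A: "fd_hilbert A" and B: "fd_hilbert B" and t: "t \<in> lin A B" and T: "spans B T"
    and "\<And>y. y \<in> T \<Longrightarrow> \<exists>x\<in>carr A. t \<cdot> x = y" and "y \<in> carr B"
  shows "\<exists>x\<in>carr A. t \<cdot> x = y"
  using B T assms(6)
proof (induction rule: spans_induct)
  case zero show ?case using A B t by (intro bexI[of _ "vzero A"]) auto
next
  case (add x y)
  then obtain a b where "a \<in> carr A" "b \<in> carr A" "t \<cdot> a = x" "t \<cdot> b = y" by blast
  then show ?case using A t by (intro bexI[of _ "vadd A a b"]) auto
next
  case (scale c x)
  then obtain a where "a \<in> carr A" "t \<cdot> a = x" by blast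
  then show ?case using A t by (intro bexI[of _ "vscale A c a"]) auto
qed (use assms in auto)

section \<open>Tensor products\<close>

lemma carr_tag: "carr (tag t H) = Pair t ` carr H"
  by (simp add: tag_def)

lemma tag_simps [simp]:
  "vzero (tag t H) = (t, vzero H)"
  "(t, x) \<in> carr (tag t H) \<longleftrightarrow> x \<in> carr H"
  "\<lbrakk>x \<in> carr H; y \<in> carr H\<rbrakk> \<Longrightarrow> vadd (tag t H) (t, x) (t, y) = (t, vadd H x y)"
  "x \<in> carr H \<Longrightarrow> vscale (tag t H) c (t, x) = (t, vscale H c x)"
  "\<lbrakk>x \<in> carr H; y \<in> carr H\<rbrakk> \<Longrightarrow> vinner (tag t H) (t, x) (t, y) = vinner H x y"
  by (auto simp: tag_def)

lemma subspace_untag: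
  "hsubspace (tag t H) V \<Longrightarrow> hsubspace H {x \<in> carr H. (t, x) \<in> V}" if "fd_hilbert H"
  using that unfolding hsubspace_def
  by (auto simp: carr_tag) (metis tag_simps(3), metis tag_simps(4))

text \<open>A subspace of the tagged space pulls back to a subspace of \<open>H\<close> containing
  \<open>B\<close>, hence containing \<open>x\<close>.\<close>

lemma hspan_tag:
  assumes H: "fd_hilbert H" and B: "B \<subseteq> carr H" and x: "x \<in> hspan H B"
  shows "(t, x) \<in> hspan (tag t H) (Pair t ` B)"
  unfolding hspan_def
proof clarify
  fix V assume V: "hsubspace (tag t H) V" "Pair t ` B \<subseteq> V"
  have "hspan H B \<subseteq> {x \<in> carr H. (t, x) \<in> V}"
    by (rule hspan_minimal[OF subspace_untag[OF H V(1)]]) (use V(2) B in auto)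
  then show "(t, x) \<in> V" using x by auto
qed

lemma fd_hilbert_tag: assumes H: "fd_hilbert H" shows "fd_hilbert (tag t H)"
proof (rule fd_hilbert_mkI[OF tag_def], goal_cases)
  case 16
  obtain B where "finite B" "B \<subseteq> carr H" "hspan H B = carr H"
    using fd_hilbert.finite_dim[OF H] by blast
  then show ?case
    by (intro exI[of _ "Pair t ` B"]) (auto simp: carr_tag intro!: hspan_tag[OF H])
next
  case (7 x)
  then obtain y where "x = (t, y)" "y \<in> carr H" by (auto simp: carr_tag)
  moreover from this have "vadd H y (vscale H (-1) y) = vzero H"
    using H by (intro vec_eqI[OF H]) auto
  ultimately show ?case using H by simp
qed (use H in \<open>auto simp: carr_tag fd_hilbert.add_assoc fd_hilbert.scale_add fd_hilbert.add_scale
  intro: fd_hilbert.add_commute fd_hilbert.inner_commute fd_hilbert.inner_pos\<close>)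

lemma fd_hilbert_tensor [simp]: "\<lbrakk>fd_hilbert X; fd_hilbert Y\<rbrakk> \<Longrightarrow> fd_hilbert (X \<otimes>\<^sub>H Y)"
  by (simp add: tensor_def fd_hilbert_tag)

text \<open>Every vector of the product carries the pair of factors as its tag, so the zero vector
  alone reveals them.\<close>

lemma tensor_inject [simp]: "X \<otimes>\<^sub>H Y = X' \<otimes>\<^sub>H Y' \<longleftrightarrow> X = X' \<and> Y = Y'"
proof
  assume "X \<otimes>\<^sub>H Y = X' \<otimes>\<^sub>H Y'"
  then have "vzero (X \<otimes>\<^sub>H Y) = vzero (X' \<otimes>\<^sub>H Y')" by simp
  then show "X = X' \<and> Y = Y'" by (simp add: tensor_def)
qed auto

lemma onb_dual [simp]: "fd_hilbert X \<Longrightarrow> \<eta> \<in> onb (dual X) \<Longrightarrow> \<eta> \<in> lin X cspace"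
  using onb_carr[of "dual X" \<eta>] by simp

text \<open>By \<open>inner_bra\<close>, evaluating \<phi> at \<open>x\<close> is pairing it with
  \<open>bra X x\<close>. A pure tensor is thus a rank-one operator out of the dual, and the results
  on \<open>ketbra\<close> apply.\<close>

lemma tens_eq:
  assumes "fd_hilbert X" "fd_hilbert Y" "x \<in> carr X" "y \<in> carr Y"
  shows "tens X Y x y = ((X, Y), ketbra (dual X) Y (bra X x) y)"
  unfolding tens_def ketbra_def using assms by (auto intro!: on_cong simp: inner_bra)

lemma tens_carr [simp]:
  "\<lbrakk>fd_hilbert X; fd_hilbert Y; x \<in> carr X; y \<in> carr Y\<rbrakk> \<Longrightarrow> tens X Y x y \<in> carr (X \<otimes>\<^sub>H Y)"
  by (simp add: tens_eq tensor_def)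

text \<open>Linear, not conjugate linear, in the left factor: the conjugations in \<open>bra\<close>
  and in the first argument of \<open>ketbra\<close> cancel.\<close>

lemma
  assumes "fd_hilbert X" "fd_hilbert Y"
  shows tens_add_left: "\<lbrakk>x \<in> carr X; x' \<in> carr X; y \<in> carr Y\<rbrakk> \<Longrightarrow>
      tens X Y (vadd X x x') y = vadd (X \<otimes>\<^sub>H Y) (tens X Y x y) (tens X Y x' y)"
    and tens_add_right: "\<lbrakk>x \<in> carr X; y \<in> carr Y; y' \<in> carr Y\<rbrakk> \<Longrightarrow>
      tens X Y x (vadd Y y y') = vadd (X \<otimes>\<^sub>H Y) (tens X Y x y) (tens X Y x y')"
    and tens_scale_left: "\<lbrakk>x \<in> carr X; y \<in> carr Y\<rbrakk> \<Longrightarrow>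
      tens X Y (vscale X c x) y = vscale (X \<otimes>\<^sub>H Y) c (tens X Y x y)"
    and tens_scale_right: "\<lbrakk>x \<in> carr X; y \<in> carr Y\<rbrakk> \<Longrightarrow>
      tens X Y x (vscale Y c y) = vscale (X \<otimes>\<^sub>H Y) c (tens X Y x y)"
  using assms
  by (auto simp: tens_eq tensor_def inner_bra fd_hilbert.add_scale fd_hilbert.scale_add mult.commute
      intro!: lin_eqI[of _ "dual X" Y] ops_add_lin ops_scale_lin)

lemma tens_zero_left:
  "\<lbrakk>fd_hilbert X; fd_hilbert Y; y \<in> carr Y\<rbrakk> \<Longrightarrow> tens X Y (vzero X) y = vzero (X \<otimes>\<^sub>H Y)"
  using tens_scale_left[of X Y "vzero X" y 0] by simp

lemma tens_zero_right:
  "\<lbrakk>fd_hilbert X; fd_hilbert Y; x \<in> carr X\<rbrakk> \<Longrightarrow> tens X Y x (vzero Y) = vzero (X \<otimes>\<^sub>H Y)"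
  using tens_scale_right[of X Y x "vzero Y" 0] by simp

text \<open>The trace runs over an orthonormal basis of the dual, where Parseval collapses it to the
  inner product of the two bras. These appear in reversed order, and a second reversal through
  \<open>inner_bra\<close> gives <x, x'>.\<close>

lemma inner_tens [simp]:
  assumes X: "fd_hilbert X" and Y: "fd_hilbert Y" and xy: "x \<in> carr X" "x' \<in> carr X" "y \<in> carr Y" "y' \<in> carr Y"
  shows "vinner (X \<otimes>\<^sub>H Y) (tens X Y x y) (tens X Y x' y') = vinner X x x' * vinner Y y y'"
proof -
  let ?D = "dual X"
  have D: "fd_hilbert ?D" and b: "bra X x \<in> carr ?D" "bra X x' \<in> carr ?D" using X xy by auto
  have "vinner (X \<otimes>\<^sub>H Y) (tens X Y x y) (tens X Y x' y') =
     (\<Sum>\<eta>\<in>onb ?D. vinner ?D (bra X x') \<eta> * vinner ?D \<eta> (bra X x) * vinner Y y y')"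
    using X Y xy D b
    by (auto simp: tens_eq tensor_def ops_inner fd_hilbert.inner_commute[OF D b(1)] intro!: sum.cong)
  also have "\<dots> = vinner X x x' * vinner Y y y'"
    using parseval[OF D b(2,1)] inner_bra[OF X xy(2), of "bra X x"] fd_hilbert.inner_commute[OF D b(2,1)] X xy
    by (simp add: sum_distrib_right[symmetric] inner_bra)
  finally show ?thesis .
qed

lemma spans_superset: "\<lbrakk>fd_hilbert H; T \<subseteq> carr H; carr H \<subseteq> hspan H T\<rbrakk> \<Longrightarrow> spans H T"
  by (simp add: spans_def hspan_carr subset_antisym)

lemma spans_pure:
  assumes X: "fd_hilbert X" and Y: "fd_hilbert Y"
  shows "spans (X \<otimes>\<^sub>H Y) {tens X Y x y | x y. x \<in> carr X \<and> y \<in> carr Y}" (is "spans _ ?P")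
proof (rule spans_superset)
  let ?K = "{ketbra (dual X) Y \<eta> y | \<eta> y. \<eta> \<in> carr (dual X) \<and> y \<in> carr Y}"
  \<comment> \<open>By Riesz every functional on \<open>X\<close> is a bra, so all the rank-one
    operators out of the dual are pure tensors.\<close>
  have K: "Pair (X, Y) ` ?K \<subseteq> ?P"
  proof clarify
    fix \<eta> y assume "\<eta> \<in> carr (dual X)" and y: "y \<in> carr Y"
    then obtain x where "x \<in> carr X" "\<eta> = bra X x" using riesz[OF X] by auto
    then show "\<exists>x' y'. ((X, Y), ketbra (dual X) Y \<eta> y) = tens X Y x' y' \<and> x' \<in> carr X \<and> y' \<in> carr Y"
      using tens_eq[OF X Y _ y] y by metis
  qed
  have sp: "spans (ops (dual X) Y) ?K" using X Y by (intro spans_ketbra) auto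
  show "carr (X \<otimes>\<^sub>H Y) \<subseteq> hspan (X \<otimes>\<^sub>H Y) ?P"
  proof
    fix u assume "u \<in> carr (X \<otimes>\<^sub>H Y)"
    then obtain w where w: "u = ((X, Y), w)" "w \<in> carr (ops (dual X) Y)"
      by (auto simp: tensor_def carr_tag)
    then have "w \<in> hspan (ops (dual X) Y) ?K" using sp by (simp add: spans_def)
    then have "u \<in> hspan (X \<otimes>\<^sub>H Y) (Pair (X, Y) ` ?K)"
      unfolding w tensor_def using X Y sp by (intro hspan_tag) (auto simp: spans_def)
    then show "u \<in> hspan (X \<otimes>\<^sub>H Y) ?P" using hspan_mono[OF K] by blast
  qed
  show "?P \<subseteq> carr (X \<otimes>\<^sub>H Y)" using tens_carr[OF X Y] by blast
qed (use X Y in auto)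

text \<open>One factor at a time: for fixed \<open>y\<close> in \<open>T\<close> the left factor
  grows from \<open>S\<close> to the carrier, then the right factor from \<open>T\<close>. Iterating
  gives nested pure tensors as generators of triple and quadruple products.\<close>

lemma spans_tens:
  assumes X: "fd_hilbert X" and Y: "fd_hilbert Y" and S: "spans X S" and T: "spans Y T"
  shows "spans (X \<otimes>\<^sub>H Y) {tens X Y x y | x y. x \<in> S \<and> y \<in> T}" (is "spans _ ?P")
proof (rule spans_superset)
  have ST: "S \<subseteq> carr X" "T \<subseteq> carr Y" using S T by (auto simp: spans_def)
  show P: "?P \<subseteq> carr (X \<otimes>\<^sub>H Y)" using tens_carr[OF X Y] ST by blast
  define W where "W = hspan (X \<otimes>\<^sub>H Y) ?P"
  have sub: "hsubspace (X \<otimes>\<^sub>H Y) W" unfolding W_def using P X Y by (intro hspan_subspace) auto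
  then have V: "vzero (X \<otimes>\<^sub>H Y) \<in> W"
    "\<And>u v. \<lbrakk>u \<in> W; v \<in> W\<rbrakk> \<Longrightarrow> vadd (X \<otimes>\<^sub>H Y) u v \<in> W"
    "\<And>c u. u \<in> W \<Longrightarrow> vscale (X \<otimes>\<^sub>H Y) c u \<in> W"
    unfolding hsubspace_def by blast+
  have 1: "tens X Y x y \<in> W" if x: "x \<in> carr X" and y: "y \<in> T" for x y
    using X S x
  proof (induction rule: spans_induct)
    case (base x) then show ?case using y hspan_base[of ?P] unfolding W_def by blast
  qed (use X Y y ST(2) V in \<open>simp_all add: tens_zero_left[OF X Y] tens_add_left tens_scale_left subsetD[OF ST(2)]\<close>)
  have 2: "tens X Y x y \<in> W" if x: "x \<in> carr X" and y: "y \<in> carr Y" for x y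
    using Y T y
  proof (induction rule: spans_induct)
    case (base y) then show ?case using x 1 by blast
  qed (use X Y x V in \<open>simp_all add: tens_zero_right[OF X Y] tens_add_right tens_scale_right\<close>)
  have "hspan (X \<otimes>\<^sub>H Y) {tens X Y x y | x y. x \<in> carr X \<and> y \<in> carr Y} \<subseteq> W"
    using 2 by (intro hspan_minimal[OF sub]) auto
  then show "carr (X \<otimes>\<^sub>H Y) \<subseteq> hspan (X \<otimes>\<^sub>H Y) ?P"
    using spans_pure[OF X Y] by (simp add: spans_def W_def)
qed (use X Y in simp)

lemma tensor_ext:
  assumes "fd_hilbert X" "fd_hilbert Y" "fd_hilbert Z" "v \<in> lin (X \<otimes>\<^sub>H Y) Z" "w \<in> lin (X \<otimes>\<^sub>H Y) Z"
    and "spans X S" "spans Y T"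
    and "\<And>x y. x \<in> S \<Longrightarrow> y \<in> T \<Longrightarrow> v \<cdot> tens X Y x y = w \<cdot> tens X Y x y"
  shows "v = w"
  by (rule lin_eq_spansI[OF _ _ assms(4,5) spans_tens[OF assms(1,2,6,7)]]) (use assms in auto)

text \<open>The universal property of the tensor product, with unique existence in the form needed
  to evaluate the definite descriptions of the structure operators. Uniqueness holds because pure
  tensors span.\<close>

lemma tensor_lift:
  assumes X: "fd_hilbert X" and Y: "fd_hilbert Y" and Z: "fd_hilbert Z"
    and cl: "\<And>x y. x \<in> carr X \<Longrightarrow> y \<in> carr Y \<Longrightarrow> f x y \<in> carr Z"
    and al: "\<And>x x' y. x \<in> carr X \<Longrightarrow> x' \<in> carr X \<Longrightarrow> y \<in> carr Y \<Longrightarrow> f (vadd X x x') y = vadd Z (f x y) (f x' y)"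
    and ar: "\<And>x y y'. x \<in> carr X \<Longrightarrow> y \<in> carr Y \<Longrightarrow> y' \<in> carr Y \<Longrightarrow> f x (vadd Y y y') = vadd Z (f x y) (f x y')"
    and sl: "\<And>c x y. x \<in> carr X \<Longrightarrow> y \<in> carr Y \<Longrightarrow> f (vscale X c x) y = vscale Z c (f x y)"
    and sr: "\<And>c x y. x \<in> carr X \<Longrightarrow> y \<in> carr Y \<Longrightarrow> f x (vscale Y c y) = vscale Z c (f x y)"
  shows "\<exists>!t. t \<in> lin (X \<otimes>\<^sub>H Y) Z \<and> (\<forall>x\<in>carr X. \<forall>y\<in>carr Y. t \<cdot> tens X Y x y = f x y)"
proof (rule ex_ex1I)
  \<comment> \<open>An element \<open>u\<close> is an operator \<open>w\<close> from the dual of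
    \<open>X\<close> to \<open>Y\<close>, and it equals the sum of the pure tensors of
    \<open>e\<close> and \<open>w \<cdot> bra X e\<close> over the basis. This forces the value of
    the lift.\<close>
  define g where "g u = lsum Z (\<lambda>e. f e (snd u \<cdot> bra X e)) (basis X)" for u :: "('a, 'b) tens"
  have u: "\<exists>w. u = ((X, Y), w) \<and> w \<in> lin (dual X) Y" if "u \<in> carr (X \<otimes>\<^sub>H Y)" for u
    using that by (auto simp: tensor_def carr_tag)
  have "on (carr (X \<otimes>\<^sub>H Y)) g \<in> lin (X \<otimes>\<^sub>H Y) Z"
  proof (rule lin_onI)
    fix u assume "u \<in> carr (X \<otimes>\<^sub>H Y)"
    from u[OF this] show "g u \<in> carr Z" unfolding g_def using X Y Z by (auto intro!: lsum_closed cl)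
  next
    fix u v assume "u \<in> carr (X \<otimes>\<^sub>H Y)" "v \<in> carr (X \<otimes>\<^sub>H Y)"
    with u obtain a b where [simp]: "u = ((X, Y), a)" "v = ((X, Y), b)"
      and ab: "a \<in> lin (dual X) Y" "b \<in> lin (dual X) Y" by meson
    have "g (vadd (X \<otimes>\<^sub>H Y) u v) = lsum Z (\<lambda>e. vadd Z (f e (a \<cdot> bra X e)) (f e (b \<cdot> bra X e))) (basis X)"
      unfolding g_def using X ab by (intro lsum_cong) (simp add: tensor_def lin_closed[OF ab(1)] lin_closed[OF ab(2)] ar)
    also have "\<dots> = vadd Z (g u) (g v)"
      unfolding g_def using X Z by (subst lsum_add) (auto intro!: cl lin_closed[OF ab(1)] lin_closed[OF ab(2)])
    finally show "g (vadd (X \<otimes>\<^sub>H Y) u v) = vadd Z (g u) (g v)" .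
  next
    fix c u assume "u \<in> carr (X \<otimes>\<^sub>H Y)"
    with u obtain a where [simp]: "u = ((X, Y), a)" and a: "a \<in> lin (dual X) Y" by meson
    have "g (vscale (X \<otimes>\<^sub>H Y) c u) = lsum Z (\<lambda>e. vscale Z c (f e (a \<cdot> bra X e))) (basis X)"
      unfolding g_def using X a by (intro lsum_cong) (simp add: tensor_def lin_closed[OF a] sr)
    also have "\<dots> = vscale Z c (g u)"
      unfolding g_def using X Z by (subst lsum_scale) (auto intro!: cl lin_closed[OF a])
    finally show "g (vscale (X \<otimes>\<^sub>H Y) c u) = vscale Z c (g u)" .
  qed (use X Y in auto)
  moreover have "g (tens X Y x y) = f x y" if x: "x \<in> carr X" and y: "y \<in> carr Y" for x y
  proof -
    have fl: "on (carr X) (\<lambda>x. f x y) \<in> lin X Z"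
      using X y by (intro lin_onI) (auto intro: cl al sl)
    \<comment> \<open>At \<open>bra X e\<close> the pure tensor takes the value <e, x> y; the scalar
      moves to the first argument of \<open>f\<close>, where \<open>x\<close> is then reassembled
      from its coordinates.\<close>
    have "g (tens X Y x y) = lsum Z (\<lambda>e. on (carr X) (\<lambda>x. f x y) \<cdot> vscale X (vinner X e x) e) (basis X)"
      unfolding g_def using X Y x y
      by (intro lsum_cong) (auto simp: tens_eq inner_bra sl sr)
    also have "\<dots> = on (carr X) (\<lambda>x. f x y) \<cdot> lsum X (\<lambda>e. vscale X (vinner X e x) e) (basis X)"
      using X Z fl x by (subst lin_lsum) auto
    finally show ?thesis using X x by (simp add: onb_expand)
  qed
  ultimately show "\<exists>t. t \<in> lin (X \<otimes>\<^sub>H Y) Z \<and> (\<forall>x\<in>carr X. \<forall>y\<in>carr Y. t \<cdot> tens X Y x y = f x y)"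
    using X Y by (intro exI[of _ "on (carr (X \<otimes>\<^sub>H Y)) g"]) auto
next
  fix t t'
  assume "t \<in> lin (X \<otimes>\<^sub>H Y) Z \<and> (\<forall>x\<in>carr X. \<forall>y\<in>carr Y. t \<cdot> tens X Y x y = f x y)"
    and "t' \<in> lin (X \<otimes>\<^sub>H Y) Z \<and> (\<forall>x\<in>carr X. \<forall>y\<in>carr Y. t' \<cdot> tens X Y x y = f x y)"
  then show "t = t'"
    by (intro tensor_ext[OF X Y Z _ _ spans_carr[OF X] spans_carr[OF Y]]) auto
qed

section \<open>Structure operators\<close>

definition unitary_op :: "'a hilb \<Rightarrow> 'b hilb \<Rightarrow> ('a \<Rightarrow> 'b option) \<Rightarrow> bool" where
  "unitary_op A B t \<longleftrightarrow> t \<in> lin A B \<and> adj_op A B t \<circ>\<^sub>m t = id_op A \<and> t \<circ>\<^sub>m adj_op A B t = id_op B"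

text \<open>Preserving inner products makes the adjoint a left inverse, and surjectivity turns it
  into a two-sided one, without counting dimensions. Both properties are tested only on spanning
  sets.\<close>

lemma unitary_opI:
  assumes A: "fd_hilbert A" and B: "fd_hilbert B" and t: "t \<in> lin A B" and S: "spans A S"
    and iso: "\<And>s s'. s \<in> S \<Longrightarrow> s' \<in> S \<Longrightarrow> vinner B (t \<cdot> s) (t \<cdot> s') = vinner A s s'"
    and T: "spans B T" and sur: "\<And>y. y \<in> T \<Longrightarrow> \<exists>x\<in>carr A. t \<cdot> x = y"
  shows "unitary_op A B t"
proof -
  note a = adj_lin[OF A B t]
  have left: "adj_op A B t \<cdot> (t \<cdot> x) = x" if x: "x \<in> carr A" for x
    by (rule vec_eqI[OF A])
      (use A B t x a in \<open>auto simp: adj_inner' isometry_spans[OF A B t S iso] lin_closed[OF a]\<close>)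
  have "adj_op A B t \<circ>\<^sub>m t = id_op A"
    by (rule lin_eqI[of _ A A]) (use A B t a left in \<open>auto intro!: comp_lin\<close>)
  moreover have "t \<circ>\<^sub>m adj_op A B t = id_op B"
  proof (rule lin_eqI[of _ B B])
    fix y assume "y \<in> carr B"
    then obtain x where "x \<in> carr A" "t \<cdot> x = y" using spans_range[OF A B t T sur] by blast
    then show "(t \<circ>\<^sub>m adj_op A B t) \<cdot> y = id_op B \<cdot> y"
      using left t by (auto simp: comp_ap[OF a])
  qed (use A B t a in \<open>auto intro!: comp_lin\<close>)
  ultimately show ?thesis using t by (simp add: unitary_op_def)
qed

lemma unitary_lin: "unitary_op A B t \<Longrightarrow> t \<in> lin A B"
  by (simp add: unitary_op_def)

text \<open>Evaluates the adjoint of a unitary operator by exhibiting a preimage; the inverse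
  unitors and associators in the snake identities are computed this way.\<close>

lemma unitary_adj_ap:
  assumes "unitary_op A B t" "x \<in> carr A" "t \<cdot> x = y" shows "adj_op A B t \<cdot> y = x"
proof -
  have "(adj_op A B t \<circ>\<^sub>m t) \<cdot> x = x" using assms by (simp add: unitary_op_def)
  then show ?thesis using comp_ap[OF unitary_lin[OF assms(1)] assms(2), of "adj_op A B t"] assms(3) by simp
qed

lemma
  assumes "fd_hilbert X1" "fd_hilbert X2" "fd_hilbert Y1" "fd_hilbert Y2" "r1 \<in> lin X1 Y1" "r2 \<in> lin X2 Y2"
  shows tens_op_lin: "tens_op X1 X2 Y1 Y2 r1 r2 \<in> lin (X1 \<otimes>\<^sub>H X2) (Y1 \<otimes>\<^sub>H Y2)"
    and tens_op_ap [simp]: "\<And>x1 x2. x1 \<in> carr X1 \<Longrightarrow> x2 \<in> carr X2 \<Longrightarrow>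
      tens_op X1 X2 Y1 Y2 r1 r2 \<cdot> tens X1 X2 x1 x2 = tens Y1 Y2 (r1 \<cdot> x1) (r2 \<cdot> x2)"
proof -
  have "\<exists>!t. t \<in> lin (X1 \<otimes>\<^sub>H X2) (Y1 \<otimes>\<^sub>H Y2) \<and>
    (\<forall>x1\<in>carr X1. \<forall>x2\<in>carr X2. t \<cdot> tens X1 X2 x1 x2 = tens Y1 Y2 (r1 \<cdot> x1) (r2 \<cdot> x2))"
    by (rule tensor_lift)
      (use assms in \<open>auto simp: tens_add_left tens_add_right tens_scale_left tens_scale_right\<close>)
  from theI'[OF this] show "tens_op X1 X2 Y1 Y2 r1 r2 \<in> lin (X1 \<otimes>\<^sub>H X2) (Y1 \<otimes>\<^sub>H Y2)"
    "\<And>x1 x2. x1 \<in> carr X1 \<Longrightarrow> x2 \<in> carr X2 \<Longrightarrow>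
      tens_op X1 X2 Y1 Y2 r1 r2 \<cdot> tens X1 X2 x1 x2 = tens Y1 Y2 (r1 \<cdot> x1) (r2 \<cdot> x2)"
    by (auto simp: tens_op_def)
qed

lemma tensor_ext_carr:
  assumes "fd_hilbert X" "fd_hilbert Y" "fd_hilbert Z" "v \<in> lin (X \<otimes>\<^sub>H Y) Z" "w \<in> lin (X \<otimes>\<^sub>H Y) Z"
    and "\<And>x y. x \<in> carr X \<Longrightarrow> y \<in> carr Y \<Longrightarrow> v \<cdot> tens X Y x y = w \<cdot> tens X Y x y"
  shows "v = w"
  by (rule tensor_ext[OF assms(1-5) spans_carr spans_carr]) (use assms in auto)

lemma tensor_ext_left:
  assumes "fd_hilbert X" "fd_hilbert Y" "fd_hilbert Z" "fd_hilbert V"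
    and "v \<in> lin ((X \<otimes>\<^sub>H Y) \<otimes>\<^sub>H Z) V" "w \<in> lin ((X \<otimes>\<^sub>H Y) \<otimes>\<^sub>H Z) V"
    and "\<And>x y z. \<lbrakk>x \<in> carr X; y \<in> carr Y; z \<in> carr Z\<rbrakk> \<Longrightarrow>
      v \<cdot> tens (X \<otimes>\<^sub>H Y) Z (tens X Y x y) z = w \<cdot> tens (X \<otimes>\<^sub>H Y) Z (tens X Y x y) z"
  shows "v = w"
  by (rule tensor_ext[OF _ _ _ assms(5,6) spans_pure spans_carr]) (use assms in auto)

text \<open>\<open>tensor_lift\<close> handles two factors, the associator three. For fixed
  \<open>z\<close> the map bilinear in \<open>x\<close> and \<open>y\<close> lifts to
  \<open>h z\<close>; this operator depends linearly on \<open>z\<close>, so applying it to the left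
  factor is bilinear again and lifts a second time.\<close>

lemma
  assumes X: "fd_hilbert X" and Y: "fd_hilbert Y" and Z: "fd_hilbert Z"
  shows assoc_lin: "assoc_op X Y Z \<in> lin ((X \<otimes>\<^sub>H Y) \<otimes>\<^sub>H Z) (X \<otimes>\<^sub>H (Y \<otimes>\<^sub>H Z))"
    and assoc_ap [simp]: "\<And>x y z. \<lbrakk>x \<in> carr X; y \<in> carr Y; z \<in> carr Z\<rbrakk> \<Longrightarrow>
      assoc_op X Y Z \<cdot> tens (X \<otimes>\<^sub>H Y) Z (tens X Y x y) z = tens X (Y \<otimes>\<^sub>H Z) x (tens Y Z y z)"
proof -
  let ?R = "X \<otimes>\<^sub>H (Y \<otimes>\<^sub>H Z)"
  note lins = tens_add_left tens_add_right tens_scale_left tens_scale_right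
  have "\<exists>!t. t \<in> lin (X \<otimes>\<^sub>H Y) ?R \<and>
      (\<forall>x\<in>carr X. \<forall>y\<in>carr Y. t \<cdot> tens X Y x y = tens X (Y \<otimes>\<^sub>H Z) x (tens Y Z y z))"
    if "z \<in> carr Z" for z
    by (rule tensor_lift) (use X Y Z that in \<open>auto simp: lins\<close>)
  then obtain h where h: "\<And>z. z \<in> carr Z \<Longrightarrow> h z \<in> lin (X \<otimes>\<^sub>H Y) ?R"
    "\<And>x y z. \<lbrakk>x \<in> carr X; y \<in> carr Y; z \<in> carr Z\<rbrakk> \<Longrightarrow> h z \<cdot> tens X Y x y = tens X (Y \<otimes>\<^sub>H Z) x (tens Y Z y z)"
    by metis
  \<comment> \<open>Linearity of \<open>h\<close> in \<open>z\<close> comes from uniqueness: both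
    sides agree on pure tensors.\<close>
  have h_add: "h (vadd Z z z') = vadd (ops (X \<otimes>\<^sub>H Y) ?R) (h z) (h z')" if "z \<in> carr Z" "z' \<in> carr Z" for z z'
    by (rule tensor_ext_carr[OF X Y, of ?R]) (use X Y Z h that in \<open>auto simp: lins intro!: ops_add_lin\<close>)
  have h_scale: "h (vscale Z c z) = vscale (ops (X \<otimes>\<^sub>H Y) ?R) c (h z)" if "z \<in> carr Z" for c z
    by (rule tensor_ext_carr[OF X Y, of ?R]) (use X Y Z h that in \<open>auto simp: lins intro!: ops_scale_lin\<close>)
  have "\<exists>!t. t \<in> lin ((X \<otimes>\<^sub>H Y) \<otimes>\<^sub>H Z) ?R \<and>
      (\<forall>u\<in>carr (X \<otimes>\<^sub>H Y). \<forall>z\<in>carr Z. t \<cdot> tens (X \<otimes>\<^sub>H Y) Z u z = h z \<cdot> u)"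
    by (rule tensor_lift)
      (use X Y Z in \<open>auto simp: h_add h_scale lin_closed[OF h(1)] lin_add[OF h(1)] lin_scale[OF h(1)] h(1)\<close>)
  then obtain t where t: "t \<in> lin ((X \<otimes>\<^sub>H Y) \<otimes>\<^sub>H Z) ?R"
    "\<And>u z. u \<in> carr (X \<otimes>\<^sub>H Y) \<Longrightarrow> z \<in> carr Z \<Longrightarrow> t \<cdot> tens (X \<otimes>\<^sub>H Y) Z u z = h z \<cdot> u" by metis
  have t': "t \<cdot> tens (X \<otimes>\<^sub>H Y) Z (tens X Y x y) z = tens X (Y \<otimes>\<^sub>H Z) x (tens Y Z y z)"
    if "x \<in> carr X" "y \<in> carr Y" "z \<in> carr Z" for x y z
    using t(2)[OF tens_carr[OF X Y that(1,2)] that(3)] h(2)[OF that] by simp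
  have "assoc_op X Y Z \<in> lin ((X \<otimes>\<^sub>H Y) \<otimes>\<^sub>H Z) ?R \<and>
     (\<forall>x\<in>carr X. \<forall>y\<in>carr Y. \<forall>z\<in>carr Z.
        assoc_op X Y Z \<cdot> tens (X \<otimes>\<^sub>H Y) Z (tens X Y x y) z = tens X (Y \<otimes>\<^sub>H Z) x (tens Y Z y z))"
    unfolding assoc_op_def
    by (rule theI[where a = t]) (use X Y Z t(1) t' in \<open>auto intro!: tensor_ext_left[OF X Y Z, of ?R]\<close>)
  then show "assoc_op X Y Z \<in> lin ((X \<otimes>\<^sub>H Y) \<otimes>\<^sub>H Z) ?R"
    "\<And>x y z. \<lbrakk>x \<in> carr X; y \<in> carr Y; z \<in> carr Z\<rbrakk> \<Longrightarrow>
      assoc_op X Y Z \<cdot> tens (X \<otimes>\<^sub>H Y) Z (tens X Y x y) z = tens X (Y \<otimes>\<^sub>H Z) x (tens Y Z y z)" by auto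
qed

lemma assoc_unitary:
  assumes X: "fd_hilbert X" and Y: "fd_hilbert Y" and Z: "fd_hilbert Z"
  shows "unitary_op ((X \<otimes>\<^sub>H Y) \<otimes>\<^sub>H Z) (X \<otimes>\<^sub>H (Y \<otimes>\<^sub>H Z)) (assoc_op X Y Z)"
proof (rule unitary_opI[OF _ _ assoc_lin[OF X Y Z]])
  let ?S = "{tens (X \<otimes>\<^sub>H Y) Z u z | u z. u \<in> {tens X Y x y | x y. x \<in> carr X \<and> y \<in> carr Y} \<and> z \<in> carr Z}"
  let ?T = "{tens X (Y \<otimes>\<^sub>H Z) x u | x u. x \<in> carr X \<and> u \<in> {tens Y Z y z | y z. y \<in> carr Y \<and> z \<in> carr Z}}"
  show "spans ((X \<otimes>\<^sub>H Y) \<otimes>\<^sub>H Z) ?S"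
    using X Y Z by (intro spans_tens spans_pure spans_carr) auto
  show "spans (X \<otimes>\<^sub>H (Y \<otimes>\<^sub>H Z)) ?T"
    using X Y Z by (intro spans_tens spans_pure spans_carr) auto
  show "\<exists>u\<in>carr ((X \<otimes>\<^sub>H Y) \<otimes>\<^sub>H Z). assoc_op X Y Z \<cdot> u = w"
    if "w \<in> ?T" for w
  proof -
    from that obtain x y z where "x \<in> carr X" "y \<in> carr Y" "z \<in> carr Z" "w = tens X (Y \<otimes>\<^sub>H Z) x (tens Y Z y z)"
      by blast
    with X Y Z show ?thesis
      by (intro bexI[of _ "tens (X \<otimes>\<^sub>H Y) Z (tens X Y x y) z"]) auto
  qed
  fix s s'
  assume "s \<in> ?S"
    and "s' \<in> ?S"
  then obtain x y z x' y' z' where "x \<in> carr X" "y \<in> carr Y" "z \<in> carr Z" "x' \<in> carr X" "y' \<in> carr Y" "z' \<in> carr Z"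
    "s = tens (X \<otimes>\<^sub>H Y) Z (tens X Y x y) z" "s' = tens (X \<otimes>\<^sub>H Y) Z (tens X Y x' y') z'" by blast
  with X Y Z show "vinner (X \<otimes>\<^sub>H (Y \<otimes>\<^sub>H Z)) (assoc_op X Y Z \<cdot> s) (assoc_op X Y Z \<cdot> s') = vinner ((X \<otimes>\<^sub>H Y) \<otimes>\<^sub>H Z) s s'"
    by simp
qed (use X Y Z in simp_all)

lemma adj_assoc_ap [simp]:
  assumes "fd_hilbert X" "fd_hilbert Y" "fd_hilbert Z" "x \<in> carr X" "y \<in> carr Y" "z \<in> carr Z"
  shows "adj_op ((X \<otimes>\<^sub>H Y) \<otimes>\<^sub>H Z) (X \<otimes>\<^sub>H (Y \<otimes>\<^sub>H Z)) (assoc_op X Y Z) \<cdot> tens X (Y \<otimes>\<^sub>H Z) x (tens Y Z y z) =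
    tens (X \<otimes>\<^sub>H Y) Z (tens X Y x y) z"
  by (rule unitary_adj_ap[OF assoc_unitary]) (use assms in auto)

lemma unitary_tensor_lift:
  assumes X: "fd_hilbert X" and Y: "fd_hilbert Y" and Z: "fd_hilbert Z"
    and t: "t \<in> lin (X \<otimes>\<^sub>H Y) Z"
    and iso: "\<And>x y x' y'. \<lbrakk>x \<in> carr X; y \<in> carr Y; x' \<in> carr X; y' \<in> carr Y\<rbrakk> \<Longrightarrow>
      vinner Z (t \<cdot> tens X Y x y) (t \<cdot> tens X Y x' y') = vinner X x x' * vinner Y y y'"
    and T: "spans Z T" and sur: "\<And>z. z \<in> T \<Longrightarrow> \<exists>x\<in>carr X. \<exists>y\<in>carr Y. t \<cdot> tens X Y x y = z"
  shows "unitary_op (X \<otimes>\<^sub>H Y) Z t"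
proof (rule unitary_opI[OF _ Z t spans_pure[OF X Y] _ T])
  show "\<exists>u\<in>carr (X \<otimes>\<^sub>H Y). t \<cdot> u = z" if "z \<in> T" for z
    using sur[OF that] tens_carr[OF X Y] by metis
  fix s s'
  assume "s \<in> {tens X Y x y | x y. x \<in> carr X \<and> y \<in> carr Y}" "s' \<in> {tens X Y x y | x y. x \<in> carr X \<and> y \<in> carr Y}"
  then obtain x y x' y' where "x \<in> carr X" "y \<in> carr Y" "x' \<in> carr X" "y' \<in> carr Y" "s = tens X Y x y" "s' = tens X Y x' y'"
    by blast
  with X Y iso show "vinner Z (t \<cdot> s) (t \<cdot> s') = vinner (X \<otimes>\<^sub>H Y) s s'" by simp
qed (use X Y in simp)

lemma
  assumes X: "fd_hilbert X"
  shows lunit_lin: "lunit_op X \<in> lin (cspace \<otimes>\<^sub>H X) X"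
    and lunit_ap [simp]: "\<And>x c. x \<in> carr X \<Longrightarrow> lunit_op X \<cdot> tens cspace X c x = vscale X c x"
    and lunit_unitary: "unitary_op (cspace \<otimes>\<^sub>H X) X (lunit_op X)"
proof -
  have "\<exists>!t. t \<in> lin (cspace \<otimes>\<^sub>H X) X \<and> (\<forall>c\<in>carr cspace. \<forall>x\<in>carr X. t \<cdot> tens cspace X c x = vscale X c x)"
    by (rule tensor_lift) (use X in \<open>auto simp: fd_hilbert.add_scale fd_hilbert.scale_add mult.commute\<close>)
  from theI'[OF this] show 1: "lunit_op X \<in> lin (cspace \<otimes>\<^sub>H X) X"
    and 2: "\<And>x c. x \<in> carr X \<Longrightarrow> lunit_op X \<cdot> tens cspace X c x = vscale X c x"
    by (auto simp: lunit_op_def)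
  show "unitary_op (cspace \<otimes>\<^sub>H X) X (lunit_op X)"
    by (rule unitary_tensor_lift[OF _ X X 1 _ spans_carr[OF X]])
      (use X 2 in \<open>auto intro!: exI[of _ 1] bexI\<close>)
qed

lemma
  assumes X: "fd_hilbert X"
  shows runit_lin: "runit_op X \<in> lin (X \<otimes>\<^sub>H cspace) X"
    and runit_ap [simp]: "\<And>x c. x \<in> carr X \<Longrightarrow> runit_op X \<cdot> tens X cspace x c = vscale X c x"
    and runit_unitary: "unitary_op (X \<otimes>\<^sub>H cspace) X (runit_op X)"
proof -
  have ex: "\<exists>!t. t \<in> lin (X \<otimes>\<^sub>H cspace) X \<and> (\<forall>x\<in>carr X. \<forall>c\<in>carr cspace. t \<cdot> tens X cspace x c = vscale X c x)"
    by (rule tensor_lift) (use X in \<open>auto simp: fd_hilbert.add_scale fd_hilbert.scale_add mult.commute\<close>)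
  \<comment> \<open>The definition quantifies over the scalar first and without a bound; this is the
    same condition in the order used by \<open>tensor_lift\<close>.\<close>
  have eq: "runit_op X = (THE t. t \<in> lin (X \<otimes>\<^sub>H cspace) X \<and>
      (\<forall>x\<in>carr X. \<forall>c\<in>carr cspace. t \<cdot> tens X cspace x c = vscale X c x))"
    unfolding runit_op_def by (rule arg_cong[where f = The]) auto
  have "runit_op X \<in> lin (X \<otimes>\<^sub>H cspace) X \<and>
      (\<forall>x\<in>carr X. \<forall>c\<in>carr cspace. runit_op X \<cdot> tens X cspace x c = vscale X c x)"
    unfolding eq by (rule theI'[OF ex])
  then show 1: "runit_op X \<in> lin (X \<otimes>\<^sub>H cspace) X"
    and 2: "\<And>x c. x \<in> carr X \<Longrightarrow> runit_op X \<cdot> tens X cspace x c = vscale X c x"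
    by auto
  show "unitary_op (X \<otimes>\<^sub>H cspace) X (runit_op X)"
    by (rule unitary_tensor_lift[OF X _ X 1 _ spans_carr[OF X]])
      (use X 2 in \<open>auto intro!: exI[of _ 1] bexI\<close>)
qed

lemma adj_lunit_ap [simp]:
  "fd_hilbert X \<Longrightarrow> x \<in> carr X \<Longrightarrow> adj_op (cspace \<otimes>\<^sub>H X) X (lunit_op X) \<cdot> x = tens cspace X 1 x"
  by (rule unitary_adj_ap[OF lunit_unitary]) auto

lemma adj_runit_ap [simp]:
  "fd_hilbert X \<Longrightarrow> x \<in> carr X \<Longrightarrow> adj_op (X \<otimes>\<^sub>H cspace) X (runit_op X) \<cdot> x = tens X cspace x 1"
  by (rule unitary_adj_ap[OF runit_unitary]) auto

lemma
  assumes X: "fd_hilbert X" and Y: "fd_hilbert Y"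
  shows braid_lin: "braid_op X Y \<in> lin (X \<otimes>\<^sub>H Y) (Y \<otimes>\<^sub>H X)"
    and braid_ap [simp]: "\<And>x y. x \<in> carr X \<Longrightarrow> y \<in> carr Y \<Longrightarrow> braid_op X Y \<cdot> tens X Y x y = tens Y X y x"
    and braid_unitary: "unitary_op (X \<otimes>\<^sub>H Y) (Y \<otimes>\<^sub>H X) (braid_op X Y)"
proof -
  have "\<exists>!t. t \<in> lin (X \<otimes>\<^sub>H Y) (Y \<otimes>\<^sub>H X) \<and> (\<forall>x\<in>carr X. \<forall>y\<in>carr Y. t \<cdot> tens X Y x y = tens Y X y x)"
    by (rule tensor_lift)
      (use X Y in \<open>auto simp: tens_add_left tens_add_right tens_scale_left tens_scale_right\<close>)
  from theI'[OF this] show 1: "braid_op X Y \<in> lin (X \<otimes>\<^sub>H Y) (Y \<otimes>\<^sub>H X)"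
    and 2: "\<And>x y. x \<in> carr X \<Longrightarrow> y \<in> carr Y \<Longrightarrow> braid_op X Y \<cdot> tens X Y x y = tens Y X y x"
    by (auto simp: braid_op_def)
  show "unitary_op (X \<otimes>\<^sub>H Y) (Y \<otimes>\<^sub>H X) (braid_op X Y)"
    by (rule unitary_tensor_lift[OF X Y _ 1 _ spans_pure[OF Y X]])
      (use X Y 2 in \<open>simp_all add: mult.commute, blast\<close>)
qed

lemma
  assumes X: "fd_hilbert X"
  shows counit_lin: "counit_op X \<in> lin (X \<otimes>\<^sub>H dual X) cspace"
    and counit_ap [simp]: "\<And>x \<phi>. x \<in> carr X \<Longrightarrow> \<phi> \<in> lin X cspace \<Longrightarrow> counit_op X \<cdot> tens X (dual X) x \<phi> = \<phi> \<cdot> x"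
proof -
  have "\<exists>!t. t \<in> lin (X \<otimes>\<^sub>H dual X) cspace \<and>
     (\<forall>x\<in>carr X. \<forall>\<phi>\<in>carr (dual X). t \<cdot> tens X (dual X) x \<phi> = \<phi> \<cdot> x)"
    by (rule tensor_lift) (use X in auto)
  from theI'[OF this] show "counit_op X \<in> lin (X \<otimes>\<^sub>H dual X) cspace"
    "\<And>x \<phi>. x \<in> carr X \<Longrightarrow> \<phi> \<in> lin X cspace \<Longrightarrow> counit_op X \<cdot> tens X (dual X) x \<phi> = \<phi> \<cdot> x"
    by (auto simp: counit_op_def)
qed

lemma inner_dual:
  "\<lbrakk>\<phi> \<in> lin X cspace; \<psi> \<in> lin X cspace\<rbrakk> \<Longrightarrow> vinner (dual X) \<phi> \<psi> = (\<Sum>e\<in>onb X. cnj (\<phi> \<cdot> e) * (\<psi> \<cdot> e))"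
  by (simp add: dual_def ops_inner)

text \<open>Like \<open>ketbra\<close>, but with a functional in place of a vector, hence linear in
  both arguments as a map on the tensor product of the dual with \<open>X\<close> must be.\<close>

definition rank_one :: "'a hilb \<Rightarrow> ('a \<Rightarrow> complex option) \<Rightarrow> 'a \<Rightarrow> 'a \<Rightarrow> 'a option" where
  "rank_one X \<phi> x = on (carr X) (\<lambda>y. vscale X (\<phi> \<cdot> y) x)"

lemma rank_one_ap [simp]: "y \<in> carr X \<Longrightarrow> rank_one X \<phi> x \<cdot> y = vscale X (\<phi> \<cdot> y) x"
  by (simp add: rank_one_def)

lemma rank_one_lin [simp]:
  "\<lbrakk>fd_hilbert X; \<phi> \<in> lin X cspace; x \<in> carr X\<rbrakk> \<Longrightarrow> rank_one X \<phi> x \<in> lin X X"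
  unfolding rank_one_def by (rule lin_onI) (auto simp: fd_hilbert.add_scale)

lemma
  assumes X: "fd_hilbert X"
  shows rank_one_iso_lin: "rank_one_iso X \<in> lin (dual X \<otimes>\<^sub>H X) (ops X X)"
    and rank_one_iso_ap [simp]: "\<And>\<phi> x. \<phi> \<in> lin X cspace \<Longrightarrow> x \<in> carr X \<Longrightarrow>
      rank_one_iso X \<cdot> tens (dual X) X \<phi> x = rank_one X \<phi> x"
    and rank_one_iso_unitary: "unitary_op (dual X \<otimes>\<^sub>H X) (ops X X) (rank_one_iso X)"
proof -
  have "\<exists>!t. t \<in> lin (dual X \<otimes>\<^sub>H X) (ops X X) \<and>
     (\<forall>\<phi>\<in>carr (dual X). \<forall>x\<in>carr X. t \<cdot> tens (dual X) X \<phi> x = rank_one X \<phi> x)"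
    by (rule tensor_lift)
      (use X in \<open>auto intro!: lin_eqI[of _ X X] ops_add_lin ops_scale_lin
        simp: fd_hilbert.add_scale fd_hilbert.scale_add mult.commute\<close>)
  from theI'[OF this] show 1: "rank_one_iso X \<in> lin (dual X \<otimes>\<^sub>H X) (ops X X)"
    and 2: "\<And>\<phi> x. \<phi> \<in> lin X cspace \<Longrightarrow> x \<in> carr X \<Longrightarrow>
      rank_one_iso X \<cdot> tens (dual X) X \<phi> x = rank_one X \<phi> x"
    by (auto simp: rank_one_iso_def rank_one_def)
  show "unitary_op (dual X \<otimes>\<^sub>H X) (ops X X) (rank_one_iso X)"
  proof (rule unitary_tensor_lift[OF _ X _ 1 _ spans_ketbra[OF X X]])
    fix \<phi> x \<phi>' x' assume "\<phi> \<in> carr (dual X)" "x \<in> carr X" "\<phi>' \<in> carr (dual X)" "x' \<in> carr X"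
    with X show "vinner (ops X X) (rank_one_iso X \<cdot> tens (dual X) X \<phi> x) (rank_one_iso X \<cdot> tens (dual X) X \<phi>' x') =
      vinner (dual X) \<phi> \<phi>' * vinner X x x'"
      by (simp add: 2 ops_inner inner_dual sum_distrib_right) (simp add: algebra_simps)
  next
    \<comment> \<open>|f><e| is the image of the pure tensor of \<open>bra X e\<close> and
      \<open>f\<close>.\<close>
    fix z assume "z \<in> {ketbra X X e f | e f. e \<in> carr X \<and> f \<in> carr X}"
    then obtain e f where "e \<in> carr X" "f \<in> carr X" "z = ketbra X X e f" by blast
    with X show "\<exists>\<phi>\<in>carr (dual X). \<exists>x\<in>carr X. rank_one_iso X \<cdot> tens (dual X) X \<phi> x = z"
      by (intro bexI[of _ "bra X e"] bexI[of _ f]) (auto simp: 2 intro!: lin_eqI[of _ X X])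
  qed (use X in auto)
qed

text \<open>Unitarity of \<open>rank_one_iso\<close> makes the description meaningful: the adjoint
  image of the identity represents it, and the left inverse makes it unique.\<close>

lemma
  assumes X: "fd_hilbert X"
  shows canonical_carr [simp]: "canonical X \<in> carr (dual X \<otimes>\<^sub>H X)"
    and canonical: "rank_one_iso X \<cdot> canonical X = id_op X"
proof -
  let ?t = "rank_one_iso X" and ?a = "adj_op (dual X \<otimes>\<^sub>H X) (ops X X) (rank_one_iso X)"
  note u = rank_one_iso_unitary[OF X]
  have a: "?a \<in> lin (ops X X) (dual X \<otimes>\<^sub>H X)" using X rank_one_iso_lin[OF X] by simp
  have "(?t \<circ>\<^sub>m ?a) \<cdot> id_op X = id_op X" using u X by (simp add: unitary_op_def)
  then have *: "?t \<cdot> (?a \<cdot> id_op X) = id_op X" using comp_ap[OF a, of "id_op X" ?t] X by simp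
  have "canonical X \<in> carr (dual X \<otimes>\<^sub>H X) \<and> ?t \<cdot> canonical X = id_op X"
    unfolding canonical_def
    by (rule theI[where a = "?a \<cdot> id_op X"]) (use X a * unitary_adj_ap[OF u] in auto)
  then show "canonical X \<in> carr (dual X \<otimes>\<^sub>H X)" "?t \<cdot> canonical X = id_op X" by auto
qed

lemma
  assumes X: "fd_hilbert X"
  shows unit_lin: "unit_op X \<in> lin cspace (dual X \<otimes>\<^sub>H X)"
    and unit_ap [simp]: "unit_op X \<cdot> c = vscale (dual X \<otimes>\<^sub>H X) c (canonical X)"
proof -
  show "unit_op X \<in> lin cspace (dual X \<otimes>\<^sub>H X)"
    unfolding unit_op_def by (rule lin_onI) (use X in \<open>auto simp: fd_hilbert.add_scale\<close>)
qed (simp add: unit_op_def)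

lemma
  assumes X: "fd_hilbert X" and Y: "fd_hilbert Y" and v: "v \<in> lin X Y"
  shows dual_op_lin: "dual_op Y v \<in> lin (dual Y) (dual X)"
  unfolding dual_op_def
proof (rule lin_onI)
  show "\<phi> \<circ>\<^sub>m v \<in> carr (dual X)" if "\<phi> \<in> carr (dual Y)" for \<phi>
    using comp_lin[OF X v] that by simp
  show "vadd (dual Y) \<phi> \<psi> \<circ>\<^sub>m v = vadd (dual X) (\<phi> \<circ>\<^sub>m v) (\<psi> \<circ>\<^sub>m v)"
    if "\<phi> \<in> carr (dual Y)" "\<psi> \<in> carr (dual Y)" for \<phi> \<psi>
    by (rule lin_eqI[of _ X cspace])
      (use X Y v that comp_lin[OF X v, where Z = cspace] in \<open>auto simp: comp_ap[OF v] lin_closed[OF v]\<close>)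
  show "vscale (dual Y) c \<phi> \<circ>\<^sub>m v = vscale (dual X) c (\<phi> \<circ>\<^sub>m v)"
    if "\<phi> \<in> carr (dual Y)" for c \<phi>
    by (rule lin_eqI[of _ X cspace])
      (use X Y v that comp_lin[OF X v, where Z = cspace] in \<open>auto simp: comp_ap[OF v] lin_closed[OF v]\<close>)
qed (use Y in auto)

lemma dual_op_ap [simp]: "\<phi> \<in> lin Y cspace \<Longrightarrow> dual_op Y v \<cdot> \<phi> = \<phi> \<circ>\<^sub>m v"
  by (simp add: dual_op_def)

section \<open>Identities between operators\<close>

lemmas op_lin [simp] = tens_op_lin assoc_lin lunit_lin runit_lin braid_lin counit_lin unit_lin
  dual_op_lin

text \<open>The spaces in the premises of \<open>comp_ap\<close> are absent from its conclusion;
  these instances take them from the inner operator as far as it names them.\<close>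

lemmas comp_aps [simp] = comp_ap[OF id_lin] comp_ap[OF tens_op_lin] comp_ap[OF assoc_lin]
  comp_ap[OF lunit_lin] comp_ap[OF runit_lin] comp_ap[OF braid_lin] comp_ap[OF counit_lin]
  comp_ap[OF unit_lin] comp_ap[OF dual_op_lin] comp_ap[OF adj_lin]

lemma rank_one_iso_closed [simp]:
  "fd_hilbert X \<Longrightarrow> u \<in> carr (dual X \<otimes>\<^sub>H X) \<Longrightarrow> rank_one_iso X \<cdot> u \<in> lin X X"
  using lin_closed[OF rank_one_iso_lin] by simp

lemma rank_one_iso_ap_closed [simp]:
  "fd_hilbert X \<Longrightarrow> u \<in> carr (dual X \<otimes>\<^sub>H X) \<Longrightarrow> x \<in> carr X \<Longrightarrow> rank_one_iso X \<cdot> u \<cdot> x \<in> carr X"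
  by (rule lin_closed[OF rank_one_iso_closed])

lemma tens_op_comp:
  assumes "fd_hilbert X1" "fd_hilbert X2" "fd_hilbert Y1" "fd_hilbert Y2" "fd_hilbert Z1" "fd_hilbert Z2"
    and "r1 \<in> lin X1 Y1" "r2 \<in> lin X2 Y2" "s1 \<in> lin Y1 Z1" "s2 \<in> lin Y2 Z2"
  shows "tens_op Y1 Y2 Z1 Z2 s1 s2 \<circ>\<^sub>m tens_op X1 X2 Y1 Y2 r1 r2 =
    tens_op X1 X2 Z1 Z2 (s1 \<circ>\<^sub>m r1) (s2 \<circ>\<^sub>m r2)"
  by (rule tensor_ext_carr[of X1 X2 "Z1 \<otimes>\<^sub>H Z2"])
    (use assms in \<open>auto intro!: comp_lin[OF _ tens_op_lin tens_op_lin]\<close>)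

lemma tens_op_id:
  assumes "fd_hilbert X" "fd_hilbert Y"
  shows "tens_op X Y X Y (id_op X) (id_op Y) = id_op (X \<otimes>\<^sub>H Y)"
  by (rule tensor_ext_carr[of X Y "X \<otimes>\<^sub>H Y"]) (use assms in auto)

text \<open>The defining equation of the adjoint is linear in \<open>x\<close> and conjugate linear
  in \<open>y\<close>, so generators suffice on both sides.\<close>

lemma adj_eq_spansI:
  assumes X: "fd_hilbert X" and Y: "fd_hilbert Y" and v: "v \<in> lin X Y" and w: "w \<in> lin Y X"
    and S: "spans X S" and T: "spans Y T"
    and eq: "\<And>x y. x \<in> S \<Longrightarrow> y \<in> T \<Longrightarrow> vinner X (w \<cdot> y) x = vinner Y y (v \<cdot> x)"
  shows "adj_op X Y v = w"
proof (rule adj_eqI[OF X Y v w])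
  fix x y assume x: "x \<in> carr X" and y: "y \<in> carr Y"
  have "vinner X (w \<cdot> t) x = vinner Y t (v \<cdot> x)" if t: "t \<in> T" for t
  proof -
    have t': "t \<in> carr Y" using T t by (auto simp: spans_def)
    from X S x show ?thesis by (induction rule: spans_induct) (use X Y v w t t' eq in auto)
  qed
  with Y T y show "vinner X (w \<cdot> y) x = vinner Y y (v \<cdot> x)"
    by (induction rule: spans_induct) (use X Y v w x in auto)
qed

lemma adj_tens_op:
  assumes "fd_hilbert X1" "fd_hilbert X2" "fd_hilbert Y1" "fd_hilbert Y2"
    and r: "r1 \<in> lin X1 Y1" "r2 \<in> lin X2 Y2"
  shows "adj_op (X1 \<otimes>\<^sub>H X2) (Y1 \<otimes>\<^sub>H Y2) (tens_op X1 X2 Y1 Y2 r1 r2) =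
    tens_op Y1 Y2 X1 X2 (adj_op X1 Y1 r1) (adj_op X2 Y2 r2)"
proof (rule adj_eq_spansI[OF _ _ _ _ spans_pure spans_pure])
  note a = adj_lin[OF assms(1,3) r(1)] adj_lin[OF assms(2,4) r(2)]
  fix u v
  assume "u \<in> {tens X1 X2 x y | x y. x \<in> carr X1 \<and> y \<in> carr X2}"
    and "v \<in> {tens Y1 Y2 x y | x y. x \<in> carr Y1 \<and> y \<in> carr Y2}"
  then obtain x1 x2 y1 y2 where "x1 \<in> carr X1" "x2 \<in> carr X2" "y1 \<in> carr Y1" "y2 \<in> carr Y2"
    "u = tens X1 X2 x1 x2" "v = tens Y1 Y2 y1 y2" by blast
  with assms show "vinner (X1 \<otimes>\<^sub>H X2) (tens_op Y1 Y2 X1 X2 (adj_op X1 Y1 r1) (adj_op X2 Y2 r2) \<cdot> v) u =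
    vinner (Y1 \<otimes>\<^sub>H Y2) v (tens_op X1 X2 Y1 Y2 r1 r2 \<cdot> u)"
    by (simp add: adj_inner lin_closed[OF a(1)] lin_closed[OF a(2)])
qed (use assms in auto)

lemma assoc_natural:
  assumes "fd_hilbert X" "fd_hilbert Y" "fd_hilbert Z" "fd_hilbert X'" "fd_hilbert Y'" "fd_hilbert Z'"
    and "r \<in> lin X X'" "s \<in> lin Y Y'" "t \<in> lin Z Z'"
  shows "assoc_op X' Y' Z' \<circ>\<^sub>m tens_op (X \<otimes>\<^sub>H Y) Z (X' \<otimes>\<^sub>H Y') Z' (tens_op X Y X' Y' r s) t =
    tens_op X (Y \<otimes>\<^sub>H Z) X' (Y' \<otimes>\<^sub>H Z') r (tens_op Y Z Y' Z' s t) \<circ>\<^sub>m assoc_op X Y Z"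
  by (rule tensor_ext_left[of X Y Z "X' \<otimes>\<^sub>H (Y' \<otimes>\<^sub>H Z')"])
    (use assms in \<open>auto intro!: comp_lin[OF _ tens_op_lin assoc_lin] comp_lin[OF _ assoc_lin tens_op_lin]\<close>)

lemma lunit_natural:
  assumes "fd_hilbert X" "fd_hilbert Y" "r \<in> lin X Y"
  shows "lunit_op Y \<circ>\<^sub>m tens_op cspace X cspace Y (id_op cspace) r = r \<circ>\<^sub>m lunit_op X"
  by (rule tensor_ext_carr[of cspace X Y])
    (use assms in \<open>auto intro!: comp_lin[OF _ tens_op_lin lunit_lin] comp_lin[OF _ lunit_lin]\<close>)

lemma runit_natural:
  assumes "fd_hilbert X" "fd_hilbert Y" "r \<in> lin X Y"
  shows "runit_op Y \<circ>\<^sub>m tens_op X cspace Y cspace r (id_op cspace) = r \<circ>\<^sub>m runit_op X"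
  by (rule tensor_ext_carr[of X cspace Y])
    (use assms in \<open>auto intro!: comp_lin[OF _ tens_op_lin runit_lin] comp_lin[OF _ runit_lin]\<close>)

lemma braid_natural:
  assumes "fd_hilbert X" "fd_hilbert Y" "fd_hilbert X'" "fd_hilbert Y'" "r \<in> lin X X'" "s \<in> lin Y Y'"
  shows "braid_op X' Y' \<circ>\<^sub>m tens_op X Y X' Y' r s = tens_op Y X Y' X' s r \<circ>\<^sub>m braid_op X Y"
  by (rule tensor_ext_carr[of X Y "Y' \<otimes>\<^sub>H X'"])
    (use assms in \<open>auto intro!: comp_lin[OF _ tens_op_lin braid_lin] comp_lin[OF _ braid_lin tens_op_lin]\<close>)

lemma braid_braid:
  assumes "fd_hilbert X" "fd_hilbert Y"
  shows "braid_op Y X \<circ>\<^sub>m braid_op X Y = id_op (X \<otimes>\<^sub>H Y)"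
  by (rule tensor_ext_carr[of X Y "X \<otimes>\<^sub>H Y"])
    (use assms in \<open>auto intro!: comp_lin[OF _ braid_lin braid_lin]\<close>)

lemma pentagon:
  assumes "fd_hilbert W" "fd_hilbert X" "fd_hilbert Y" "fd_hilbert Z"
  shows "tens_op W ((X \<otimes>\<^sub>H Y) \<otimes>\<^sub>H Z) W (X \<otimes>\<^sub>H (Y \<otimes>\<^sub>H Z)) (id_op W) (assoc_op X Y Z) \<circ>\<^sub>m
      (assoc_op W (X \<otimes>\<^sub>H Y) Z \<circ>\<^sub>m
       tens_op ((W \<otimes>\<^sub>H X) \<otimes>\<^sub>H Y) Z (W \<otimes>\<^sub>H (X \<otimes>\<^sub>H Y)) Z (assoc_op W X Y) (id_op Z)) =
    assoc_op W X (Y \<otimes>\<^sub>H Z) \<circ>\<^sub>m assoc_op (W \<otimes>\<^sub>H X) Y Z" (is "?l = ?r")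
proof (rule tensor_ext)
  let ?S = "{tens (W \<otimes>\<^sub>H X) Y u y | u y. u \<in> {tens W X w x | w x. w \<in> carr W \<and> x \<in> carr X} \<and> y \<in> carr Y}"
  let ?A = "((W \<otimes>\<^sub>H X) \<otimes>\<^sub>H Y) \<otimes>\<^sub>H Z" and ?B = "W \<otimes>\<^sub>H (X \<otimes>\<^sub>H (Y \<otimes>\<^sub>H Z))"
  show "?l \<in> lin ?A ?B" "?r \<in> lin ?A ?B"
    by ((rule comp_lin op_lin id_lin | simp add: assms)+)
  show "spans ((W \<otimes>\<^sub>H X) \<otimes>\<^sub>H Y) ?S"
    using assms by (intro spans_tens spans_pure spans_carr) auto
  show "spans Z (carr Z)" using assms by (intro spans_carr)
  fix u z
  assume "u \<in> ?S"
    and z: "z \<in> carr Z"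
  then obtain w x y where "w \<in> carr W" "x \<in> carr X" "y \<in> carr Y" "u = tens (W \<otimes>\<^sub>H X) Y (tens W X w x) y"
    by blast
  with z assms show "?l \<cdot> tens ((W \<otimes>\<^sub>H X) \<otimes>\<^sub>H Y) Z u z = ?r \<cdot> tens ((W \<otimes>\<^sub>H X) \<otimes>\<^sub>H Y) Z u z"
    \<comment> \<open>Nested to the left, the composite exposes a single structure operator as the
      first one applied, and its value on the current pure tensor is known.\<close>
    by (simp flip: map_comp_assoc)
qed (use assms in simp_all)

lemma triangle:
  assumes "fd_hilbert X" "fd_hilbert Y"
  shows "tens_op X (cspace \<otimes>\<^sub>H Y) X Y (id_op X) (lunit_op Y) \<circ>\<^sub>m assoc_op X cspace Y =
    tens_op (X \<otimes>\<^sub>H cspace) Y X Y (runit_op X) (id_op Y)"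
  by (rule tensor_ext_left[of X cspace Y "X \<otimes>\<^sub>H Y"])
    (use assms in \<open>auto intro!: comp_lin[OF _ assoc_lin tens_op_lin] simp: tens_scale_left tens_scale_right\<close>)

lemma hexagon:
  assumes "fd_hilbert X" "fd_hilbert Y" "fd_hilbert Z"
  shows "assoc_op Y Z X \<circ>\<^sub>m (braid_op X (Y \<otimes>\<^sub>H Z) \<circ>\<^sub>m assoc_op X Y Z) =
    tens_op Y (X \<otimes>\<^sub>H Z) Y (Z \<otimes>\<^sub>H X) (id_op Y) (braid_op X Z) \<circ>\<^sub>m
      (assoc_op Y X Z \<circ>\<^sub>m tens_op (X \<otimes>\<^sub>H Y) Z (Y \<otimes>\<^sub>H X) Z (braid_op X Y) (id_op Z))" (is "?l = ?r")
proof (rule tensor_ext_left[of X Y Z "Y \<otimes>\<^sub>H (Z \<otimes>\<^sub>H X)"])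
  let ?A = "(X \<otimes>\<^sub>H Y) \<otimes>\<^sub>H Z" and ?B = "Y \<otimes>\<^sub>H (Z \<otimes>\<^sub>H X)"
  show "?l \<in> lin ?A ?B" "?r \<in> lin ?A ?B"
    by ((rule comp_lin op_lin id_lin | simp add: assms)+)
  fix x y z assume "x \<in> carr X" "y \<in> carr Y" "z \<in> carr Z"
  with assms show "?l \<cdot> tens (X \<otimes>\<^sub>H Y) Z (tens X Y x y) z = ?r \<cdot> tens (X \<otimes>\<^sub>H Y) Z (tens X Y x y) z"
    by (simp flip: map_comp_assoc)
qed (use assms in simp_all)

section \<open>The transpose and the snake identities for operators\<close>

lemma dual_op_id: "fd_hilbert X \<Longrightarrow> dual_op X (id_op X) = id_op (dual X)"
  by (rule lin_eqI[of _ "dual X" "dual X"]) auto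

lemma dual_op_comp:
  assumes "fd_hilbert X" "fd_hilbert Y" "fd_hilbert Z" "r \<in> lin X Y" "s \<in> lin Y Z"
  shows "dual_op Z (s \<circ>\<^sub>m r) = dual_op Y r \<circ>\<^sub>m dual_op Z s"
proof -
  note d = dual_op_lin[OF assms(2,3,5)] dual_op_lin[OF assms(1,2,4)]
    dual_op_lin[OF assms(1,3) comp_lin[OF assms(1,4,5)]]
  have "\<phi> \<circ>\<^sub>m s \<in> lin Y cspace" if "\<phi> \<in> lin Z cspace" for \<phi>
    using comp_lin[OF assms(2,5) that] .
  then show ?thesis
    by (intro lin_eqI[OF d(3) comp_lin[OF _ d(1,2)]])
      (use assms in \<open>auto simp: comp_ap[OF d(1)] map_comp_assoc\<close>)
qed

text \<open>The first snake with its invertible structure operators restored. The middle operator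
  \<open>d\<close> is a parameter because at the level of arrows it appears as a transpose whose
  original atoms are known only through their duals.\<close>

definition left_snake :: "'a hilb \<Rightarrow> 'b hilb \<Rightarrow> (('b \<Rightarrow> complex option) \<Rightarrow> ('a \<Rightarrow> complex option) option) \<Rightarrow> 'a \<Rightarrow> 'b option" where
  "left_snake X Y d = lunit_op Y \<circ>\<^sub>m (tens_op (X \<otimes>\<^sub>H dual X) Y cspace Y (counit_op X) (id_op Y) \<circ>\<^sub>m
     (adj_op ((X \<otimes>\<^sub>H dual X) \<otimes>\<^sub>H Y) (X \<otimes>\<^sub>H (dual X \<otimes>\<^sub>H Y)) (assoc_op X (dual X) Y) \<circ>\<^sub>m
     (tens_op X (dual Y \<otimes>\<^sub>H Y) X (dual X \<otimes>\<^sub>H Y) (id_op X)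
        (tens_op (dual Y) Y (dual X) Y d (id_op Y)) \<circ>\<^sub>m
     (tens_op X cspace X (dual Y \<otimes>\<^sub>H Y) (id_op X) (unit_op Y) \<circ>\<^sub>m adj_op (X \<otimes>\<^sub>H cspace) X (runit_op X)))))"

lemma snake_left:
  assumes X: "fd_hilbert X" and Y: "fd_hilbert Y" and r: "r \<in> lin X Y"
  shows "left_snake X Y (dual_op Y r) = r"
proof (rule lin_eqI[OF _ r])
  show "left_snake X Y (dual_op Y r) \<in> lin X Y"
    unfolding left_snake_def by ((rule comp_lin op_lin id_lin adj_lin r | simp add: X Y)+)
  define D where "D = dual_op Y r"
  have D: "D \<in> lin (dual Y) (dual X)" using X Y r by (simp add: D_def)
  \<comment> \<open>The snake without its first two operators, which only insert the canonical
    element; \<open>K\<close> therefore accepts an arbitrary \<open>u\<close> in that place.\<close>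
  define K where "K = lunit_op Y \<circ>\<^sub>m (tens_op (X \<otimes>\<^sub>H dual X) Y cspace Y (counit_op X) (id_op Y) \<circ>\<^sub>m
     (adj_op ((X \<otimes>\<^sub>H dual X) \<otimes>\<^sub>H Y) (X \<otimes>\<^sub>H (dual X \<otimes>\<^sub>H Y)) (assoc_op X (dual X) Y) \<circ>\<^sub>m
     tens_op X (dual Y \<otimes>\<^sub>H Y) X (dual X \<otimes>\<^sub>H Y) (id_op X) (tens_op (dual Y) Y (dual X) Y D (id_op Y))))"
  have K: "K \<in> lin (X \<otimes>\<^sub>H (dual Y \<otimes>\<^sub>H Y)) Y"
    unfolding K_def by ((rule comp_lin op_lin id_lin adj_lin D | simp add: X Y)+)
  note R = rank_one_iso_lin[OF Y]
  \<comment> \<open>Both sides are linear in \<open>u\<close>. For the pure tensor of \<phi> and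
    \<open>y\<close> each equals \<phi>(r x) y.\<close>
  have K_ap: "K \<cdot> tens X (dual Y \<otimes>\<^sub>H Y) x u = (rank_one_iso Y \<cdot> u) \<cdot> (r \<cdot> x)"
    if x: "x \<in> carr X" and u: "u \<in> carr (dual Y \<otimes>\<^sub>H Y)" for x u
    using fd_hilbert_tensor[OF fd_hilbert_dual[OF Y] Y] spans_pure[OF fd_hilbert_dual[OF Y] Y] u
  proof (induction rule: spans_induct)
    case (base u)
    then obtain \<phi> y where *: "\<phi> \<in> lin Y cspace" "y \<in> carr Y" "u = tens (dual Y) Y \<phi> y" by auto
    have "\<phi> \<circ>\<^sub>m r \<in> lin X cspace" using comp_lin[OF X r *(1)] .
    with * X Y D r x show ?case
      by (simp add: K_def flip: map_comp_assoc) (simp add: D_def)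
  qed (use X Y K r x R in \<open>simp_all add: tens_zero_right tens_add_right tens_scale_right\<close>)
  fix x assume x: "x \<in> carr X"
  have "left_snake X Y (dual_op Y r) \<cdot> x = K \<cdot> tens X (dual Y \<otimes>\<^sub>H Y) x (canonical Y)"
    using X Y r D x canonical_carr[OF Y]
    unfolding left_snake_def K_def D_def[symmetric] by (simp flip: map_comp_assoc)
  also have "\<dots> = r \<cdot> x" using X Y r x K_ap[OF x canonical_carr[OF Y]] canonical[OF Y] by simp
  finally show "left_snake X Y (dual_op Y r) \<cdot> x = r \<cdot> x" .
qed

definition right_snake :: "'a hilb \<Rightarrow> 'b hilb \<Rightarrow> ('a \<Rightarrow> 'b option) \<Rightarrow> ('b \<Rightarrow> complex option) \<Rightarrow> ('a \<Rightarrow> complex option) option" where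
  "right_snake X Y r = runit_op (dual X) \<circ>\<^sub>m (tens_op (dual X) (Y \<otimes>\<^sub>H dual Y) (dual X) cspace (id_op (dual X)) (counit_op Y) \<circ>\<^sub>m
     (assoc_op (dual X) Y (dual Y) \<circ>\<^sub>m
     (tens_op (dual X \<otimes>\<^sub>H X) (dual Y) (dual X \<otimes>\<^sub>H Y) (dual Y)
        (tens_op (dual X) X (dual X) Y (id_op (dual X)) r) (id_op (dual Y)) \<circ>\<^sub>m
     (tens_op cspace (dual Y) (dual X \<otimes>\<^sub>H X) (dual Y) (unit_op X) (id_op (dual Y)) \<circ>\<^sub>m
      adj_op (cspace \<otimes>\<^sub>H dual Y) (dual Y) (lunit_op (dual Y))))))"

lemma snake_right:
  assumes X: "fd_hilbert X" and Y: "fd_hilbert Y" and r: "r \<in> lin X Y"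
  shows "right_snake X Y r = dual_op Y r"
proof (rule lin_eqI[of _ "dual Y" "dual X"])
  show "right_snake X Y r \<in> lin (dual Y) (dual X)"
    unfolding right_snake_def by ((rule comp_lin op_lin id_lin adj_lin r | simp add: X Y)+)
  define K where "K = runit_op (dual X) \<circ>\<^sub>m (tens_op (dual X) (Y \<otimes>\<^sub>H dual Y) (dual X) cspace (id_op (dual X)) (counit_op Y) \<circ>\<^sub>m
     (assoc_op (dual X) Y (dual Y) \<circ>\<^sub>m
     tens_op (dual X \<otimes>\<^sub>H X) (dual Y) (dual X \<otimes>\<^sub>H Y) (dual Y)
        (tens_op (dual X) X (dual X) Y (id_op (dual X)) r) (id_op (dual Y))))"
  have K: "K \<in> lin ((dual X \<otimes>\<^sub>H X) \<otimes>\<^sub>H dual Y) (dual X)"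
    unfolding K_def by ((rule comp_lin op_lin id_lin adj_lin r | simp add: X Y)+)
  note R = rank_one_iso_lin[OF X]
  have K_closed: "\<And>u. u \<in> carr ((dual X \<otimes>\<^sub>H X) \<otimes>\<^sub>H dual Y) \<Longrightarrow> K \<cdot> u \<in> lin X cspace"
    using lin_closed[OF K] by simp
  \<comment> \<open>For \<open>u\<close> the pure tensor of \<psi> and \<open>y\<close>, both sides
    equal \<psi>(z) \<phi>(r y).\<close>
  have K_ap: "(K \<cdot> tens (dual X \<otimes>\<^sub>H X) (dual Y) u \<phi>) \<cdot> z = \<phi> \<cdot> (r \<cdot> ((rank_one_iso X \<cdot> u) \<cdot> z))"
    if \<phi>: "\<phi> \<in> lin Y cspace" and z: "z \<in> carr X" and u: "u \<in> carr (dual X \<otimes>\<^sub>H X)" for \<phi> z u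
    using fd_hilbert_tensor[OF fd_hilbert_dual[OF X] X] spans_pure[OF fd_hilbert_dual[OF X] X] u
  proof (induction rule: spans_induct)
    case (base u)
    then obtain \<psi> y where *: "\<psi> \<in> lin X cspace" "y \<in> carr X" "u = tens (dual X) X \<psi> y" by auto
    with X Y r z \<phi> show ?case
      by (simp add: K_def flip: map_comp_assoc)
  qed (use X Y K r \<phi> z R K_closed in \<open>simp_all add: tens_zero_left tens_add_left tens_scale_left\<close>)
  fix \<phi> assume "\<phi> \<in> carr (dual Y)"
  then have \<phi>: "\<phi> \<in> lin Y cspace" by simp
  have l: "right_snake X Y r \<cdot> \<phi> = K \<cdot> tens (dual X \<otimes>\<^sub>H X) (dual Y) (canonical X) \<phi>"
    using X Y r \<phi> canonical_carr[OF X] unfolding right_snake_def K_def by (simp flip: map_comp_assoc)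
  have "K \<cdot> tens (dual X \<otimes>\<^sub>H X) (dual Y) (canonical X) \<phi> = \<phi> \<circ>\<^sub>m r"
  proof (rule lin_eqI)
    show "K \<cdot> tens (dual X \<otimes>\<^sub>H X) (dual Y) (canonical X) \<phi> \<in> lin X cspace"
      using lin_closed[OF K] X Y \<phi> by simp
    show "\<phi> \<circ>\<^sub>m r \<in> lin X cspace" using comp_lin[OF X r \<phi>] .
  qed (use X r \<phi> K_ap[OF \<phi>] canonical[OF X] in simp)
  then show "right_snake X Y r \<cdot> \<phi> = dual_op Y r \<cdot> \<phi>" using l \<phi> by simp
qed (use X Y r in auto)

text \<open>Amounts to the statement that pairing with the swapped canonical element is evaluation.
  For the identity operator the sum in \<open>inner_braid\<close> is the basis expansion of
  \<open>x\<close> under \<phi>.\<close>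

lemma adj_counit:
  assumes X: "fd_hilbert X"
  shows "adj_op (X \<otimes>\<^sub>H dual X) cspace (counit_op X) = braid_op (dual X) X \<circ>\<^sub>m unit_op X"
proof (rule adj_eqI[OF _ _ counit_lin[OF X] comp_lin[OF _ unit_lin[OF X] braid_lin]])
  note R = rank_one_iso_lin[OF X] and B = braid_lin[OF fd_hilbert_dual[OF X] X]
  \<comment> \<open>Conjugate linear in \<open>u\<close>. On the pure tensor of \<psi> and
    \<open>y\<close> both sides are <y, x> times the inner product of \<psi> and \<phi>, written as
    a sum over the basis.\<close>
  have inner_braid: "vinner (X \<otimes>\<^sub>H dual X) (braid_op (dual X) X \<cdot> u) (tens X (dual X) x \<phi>) =
      (\<Sum>e\<in>onb X. vinner X ((rank_one_iso X \<cdot> u) \<cdot> e) x * (\<phi> \<cdot> e))"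
    if x: "x \<in> carr X" and \<phi>: "\<phi> \<in> lin X cspace" and u: "u \<in> carr (dual X \<otimes>\<^sub>H X)" for x \<phi> u
    using fd_hilbert_tensor[OF fd_hilbert_dual[OF X] X] spans_pure[OF fd_hilbert_dual[OF X] X] u
  proof (induction rule: spans_induct)
    case (base u)
    then obtain \<psi> y where *: "\<psi> \<in> lin X cspace" "y \<in> carr X" "u = tens (dual X) X \<psi> y" by auto
    with X x \<phi> show ?case by (simp add: inner_dual sum_distrib_left mult_ac)
  next
    case zero show ?case using X x \<phi> R by (simp add: lin_zero[OF B])
  next
    case (add u v)
    then show ?case using X x \<phi> R
      by (simp add: lin_add[OF B] lin_scale[OF B] lin_closed[OF B]) (simp add: algebra_simps sum.distrib)
  next
    case (scale c u)
    then show ?case using X x \<phi> R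
      by (simp add: lin_add[OF B] lin_scale[OF B] lin_closed[OF B]) (simp add: algebra_simps sum_distrib_left)
  qed
  have bc: "braid_op (dual X) X \<cdot> canonical X \<in> carr (X \<otimes>\<^sub>H dual X)"
    using lin_closed[OF B canonical_carr[OF X]] .
  have *: "vinner (X \<otimes>\<^sub>H dual X) (braid_op (dual X) X \<cdot> canonical X) w = counit_op X \<cdot> w"
    if w: "w \<in> carr (X \<otimes>\<^sub>H dual X)" for w
    using fd_hilbert_tensor[OF X fd_hilbert_dual[OF X]] spans_pure[OF X fd_hilbert_dual[OF X]] w
  proof (induction rule: spans_induct)
    case (base w)
    then obtain x \<phi> where w: "x \<in> carr X" "\<phi> \<in> lin X cspace" "w = tens X (dual X) x \<phi>" by auto
    with inner_braid[OF w(1,2) canonical_carr[OF X]] X dual_ap_sum[OF X w(2) w(1)] canonical[OF X]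
    show ?case by simp
  qed (use X bc in \<open>simp_all add: lin_zero[OF counit_lin] lin_add[OF counit_lin] lin_scale[OF counit_lin]\<close>)
  fix w c assume "w \<in> carr (X \<otimes>\<^sub>H dual X)" "c \<in> carr cspace"
  with X * B bc show "vinner (X \<otimes>\<^sub>H dual X) ((braid_op (dual X) X \<circ>\<^sub>m unit_op X) \<cdot> c) w =
      vinner cspace c (counit_op X \<cdot> w)"
    by (simp add: lin_scale[OF B])
qed (use X in auto)

section \<open>Semilinear maps and spans\<close>

text \<open>Covers linear maps and, with \<open>cnj\<close>, the adjoint. That
  \<open>\<sigma>\<close> is an involution is what closes images of subspaces under scaling: c f(x)
  is f at the multiple of x by \<open>\<sigma> c\<close>.\<close>

definition semilinear :: "(complex \<Rightarrow> complex) \<Rightarrow> 'a hilb \<Rightarrow> 'b hilb \<Rightarrow> ('a \<Rightarrow> 'b) \<Rightarrow> bool" where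
  "semilinear \<sigma> H K f \<longleftrightarrow> (\<forall>x\<in>carr H. f x \<in> carr K) \<and>
     (\<forall>x\<in>carr H. \<forall>y\<in>carr H. f (vadd H x y) = vadd K (f x) (f y)) \<and>
     (\<forall>c. \<forall>x\<in>carr H. f (vscale H c x) = vscale K (\<sigma> c) (f x)) \<and> (\<forall>c. \<sigma> (\<sigma> c) = c)"

lemma semilinear_zero:
  assumes "semilinear \<sigma> H K f" and H: "fd_hilbert H" and K: "fd_hilbert K"
  shows "f (vzero H) = vzero K"
proof -
  let ?z = "f (vzero H)"
  have "?z \<in> carr K" "vadd K ?z ?z = ?z"
    using assms(1) H unfolding semilinear_def by (auto dest!: bspec[where x = "vzero H"])
  then show ?thesis
    using fd_hilbert.inner_add[OF K, of ?z ?z ?z] by (intro inner_eq_0[OF K]) auto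
qed

text \<open>The image of a subspace is a subspace, which gives one inclusion; the preimage of a
  subspace is a subspace, which gives the other.\<close>

lemma semilinear_hspan:
  assumes f: "semilinear \<sigma> H K f" and H: "fd_hilbert H" and K: "fd_hilbert K" and S: "S \<subseteq> carr H"
  shows "hspan K (f ` S) = f ` hspan H S"
proof
  have sp: "hspan H S \<subseteq> carr H" "hsubspace H (hspan H S)"
    using H S by (auto intro: hspan_subspace dest: hspan_carr)
  have "hsubspace K (f ` hspan H S)"
    unfolding hsubspace_def
  proof (intro conjI ballI allI)
    show "f ` hspan H S \<subseteq> carr K" using f sp(1) by (auto simp: semilinear_def)
    show "vzero K \<in> f ` hspan H S"
      using semilinear_zero[OF f H K] sp(2) by (metis hsubspace_def image_eqI)
    fix u v assume "u \<in> f ` hspan H S" "v \<in> f ` hspan H S"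
    then obtain x y where xy: "x \<in> hspan H S" "y \<in> hspan H S" "u = f x" "v = f y" by blast
    then have "vadd K u v = f (vadd H x y)"
      using f subsetD[OF sp(1) xy(1)] subsetD[OF sp(1) xy(2)] by (auto simp: semilinear_def)
    then show "vadd K u v \<in> f ` hspan H S" using xy sp(2) by (auto simp: hsubspace_def)
  next
    fix c u assume "u \<in> f ` hspan H S"
    then obtain x where x: "x \<in> hspan H S" "u = f x" by blast
    then have "vscale K c u = f (vscale H (\<sigma> c) x)"
      using f subsetD[OF sp(1) x(1)] by (auto simp: semilinear_def)
    then show "vscale K c u \<in> f ` hspan H S" using x sp(2) by (auto simp: hsubspace_def)
  qed
  then show "hspan K (f ` S) \<subseteq> f ` hspan H S"
    using hspan_base[of S H] by (intro hspan_minimal) auto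
  have fS: "f ` S \<subseteq> carr K" using f S by (auto simp: semilinear_def)
  then have V: "hsubspace K (hspan K (f ` S))" by (rule hspan_subspace[OF K])
  have "hsubspace H {x \<in> carr H. f x \<in> hspan K (f ` S)}"
    using H V f semilinear_zero[OF f H K] unfolding hsubspace_def semilinear_def by simp
  then have "hspan H S \<subseteq> {x \<in> carr H. f x \<in> hspan K (f ` S)}"
    using S hspan_base[of "f ` S" K] by (intro hspan_minimal) auto
  then show "f ` hspan H S \<subseteq> hspan K (f ` S)" by auto
qed

text \<open>First \<open>y\<close> is released from the generators with the left argument fixed in
  \<open>S1\<close>, then \<open>x\<close>. With \<open>hspan_eqI\<close> this removes the inner
  spans from composites and products.\<close>

lemma bilinear_hspan:
  assumes H: "fd_hilbert H1" "fd_hilbert H2" and K: "fd_hilbert K"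
    and f1: "\<And>y. y \<in> carr H2 \<Longrightarrow> semilinear (\<lambda>c. c) H1 K (\<lambda>x. f x y)"
    and f2: "\<And>x. x \<in> carr H1 \<Longrightarrow> semilinear (\<lambda>c. c) H2 K (f x)"
    and S: "S1 \<subseteq> carr H1" "S2 \<subseteq> carr H2" and x: "x \<in> hspan H1 S1" and y: "y \<in> hspan H2 S2"
    and T: "T \<subseteq> carr K" "\<And>s1 s2. s1 \<in> S1 \<Longrightarrow> s2 \<in> S2 \<Longrightarrow> f s1 s2 \<in> T"
  shows "f x y \<in> hspan K T"
proof -
  have y': "y \<in> carr H2" using hspan_carr[OF H(2) S(2)] y by blast
  have 1: "f s y \<in> hspan K T" if s: "s \<in> S1" for s
  proof -
    have "f s y \<in> hspan K (f s ` S2)"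
      using semilinear_hspan[OF f2[of s] H(2) K S(2)] s S y by auto
    also have "\<dots> \<subseteq> hspan K T" using s T by (intro hspan_mono) auto
    finally show ?thesis .
  qed
  have "f x y \<in> hspan K ((\<lambda>x. f x y) ` S1)"
    using semilinear_hspan[OF f1[OF y'] H(1) K S(1)] x by auto
  also have "\<dots> \<subseteq> hspan K T"
    using 1 by (intro hspan_minimal hspan_subspace[OF K T(1)]) auto
  finally show ?thesis .
qed

lemma hspan_eqI:
  assumes "fd_hilbert H" "T \<subseteq> carr H" "T \<subseteq> S" "S \<subseteq> hspan H T"
  shows "hspan H S = hspan H T"
  using assms by (meson hspan_minimal hspan_mono hspan_subspace subset_antisym)

section \<open>Linearity of the operations on operators, and recovery of a space from its
  dual\<close>

lemma semilinear_comp_left: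
  assumes "fd_hilbert X" "fd_hilbert Y" "fd_hilbert Z" and r: "r \<in> lin X Y"
  shows "semilinear (\<lambda>c. c) (ops Y Z) (ops X Z) (\<lambda>s. s \<circ>\<^sub>m r)"
proof -
  have [simp]: "s \<circ>\<^sub>m r \<in> lin X Z" if "s \<in> lin Y Z" for s using comp_lin[OF assms(1) r that] .
  note [simp] = ops_add_lin[OF assms(2,3)] ops_scale_lin[OF assms(2,3)]
    ops_add_lin[OF assms(1,3)] ops_scale_lin[OF assms(1,3)]
  show ?thesis
    unfolding semilinear_def
    by (auto intro!: lin_eqI[of _ X Z] simp: comp_ap[OF r] lin_closed[OF r])
qed

lemma semilinear_comp_right:
  assumes "fd_hilbert X" "fd_hilbert Y" "fd_hilbert Z" and s: "s \<in> lin Y Z"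
  shows "semilinear (\<lambda>c. c) (ops X Y) (ops X Z) (\<lambda>r. s \<circ>\<^sub>m r)"
proof -
  have [simp]: "s \<circ>\<^sub>m r \<in> lin X Z" if "r \<in> lin X Y" for r using comp_lin[OF assms(1) that s] .
  note [simp] = ops_add_lin[OF assms(1,2)] ops_scale_lin[OF assms(1,2)]
    ops_add_lin[OF assms(1,3)] ops_scale_lin[OF assms(1,3)]
  show ?thesis
    unfolding semilinear_def
    by (auto intro!: lin_eqI[of _ X Z] simp: comp_ap[of _ X Y] lin_closed[of _ X Y] lin_add[OF s] lin_scale[OF s])
qed

lemma semilinear_tens_op_left:
  assumes "fd_hilbert X1" "fd_hilbert X2" "fd_hilbert Y1" "fd_hilbert Y2" and "s \<in> lin X2 Y2"
  shows "semilinear (\<lambda>c. c) (ops X1 Y1) (ops (X1 \<otimes>\<^sub>H X2) (Y1 \<otimes>\<^sub>H Y2)) (\<lambda>r. tens_op X1 X2 Y1 Y2 r s)"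
  unfolding semilinear_def
  using assms
  by (auto intro!: tensor_ext_carr[of X1 X2 "Y1 \<otimes>\<^sub>H Y2"] ops_add_lin ops_scale_lin tens_op_lin
      simp: ops_add_lin ops_scale_lin tens_add_left tens_scale_left lin_closed[of _ X1 Y1])

lemma semilinear_tens_op_right:
  assumes "fd_hilbert X1" "fd_hilbert X2" "fd_hilbert Y1" "fd_hilbert Y2" and "r \<in> lin X1 Y1"
  shows "semilinear (\<lambda>c. c) (ops X2 Y2) (ops (X1 \<otimes>\<^sub>H X2) (Y1 \<otimes>\<^sub>H Y2)) (\<lambda>s. tens_op X1 X2 Y1 Y2 r s)"
  unfolding semilinear_def
  using assms
  by (auto intro!: tensor_ext_carr[of X1 X2 "Y1 \<otimes>\<^sub>H Y2"] ops_add_lin ops_scale_lin tens_op_lin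
      simp: ops_add_lin ops_scale_lin tens_add_right tens_scale_right lin_closed[of _ X2 Y2])

lemma semilinear_dual_op:
  assumes "fd_hilbert X" "fd_hilbert Y"
  shows "semilinear (\<lambda>c. c) (ops X Y) (ops (dual Y) (dual X)) (dual_op Y)"
proof -
  note [simp] = ops_add_lin[OF assms] ops_scale_lin[OF assms]
  have [simp]: "\<phi> \<circ>\<^sub>m v \<in> lin X cspace" if "v \<in> lin X Y" "\<phi> \<in> lin Y cspace" for \<phi> v
    using comp_lin[OF assms(1) that] .
  show ?thesis
    unfolding semilinear_def
  proof (intro conjI ballI allI)
    fix v w assume v: "v \<in> carr (ops X Y)" and w: "w \<in> carr (ops X Y)"
    show "dual_op Y (vadd (ops X Y) v w) = vadd (ops (dual Y) (dual X)) (dual_op Y v) (dual_op Y w)"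
      by (rule lin_eqI[of _ "dual Y" "dual X"])
        (use assms v w in \<open>auto intro!: lin_eqI[of _ X cspace] ops_add_lin dual_op_lin
          simp: comp_ap[of _ X Y] lin_closed[of _ X Y]\<close>)
  next
    fix a v assume v: "v \<in> carr (ops X Y)"
    show "dual_op Y (vscale (ops X Y) a v) = vscale (ops (dual Y) (dual X)) a (dual_op Y v)"
      by (rule lin_eqI[of _ "dual Y" "dual X"])
        (use assms v in \<open>auto intro!: lin_eqI[of _ X cspace] ops_scale_lin dual_op_lin
          simp: comp_ap[of _ X Y] lin_closed[of _ X Y]\<close>)
  qed (use assms in auto)
qed

lemma semilinear_adj_op:
  assumes "fd_hilbert X" "fd_hilbert Y"
  shows "semilinear cnj (ops X Y) (ops Y X) (adj_op X Y)"
proof -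
  note [simp] = ops_add_lin[OF assms] ops_scale_lin[OF assms]
    ops_add_lin[OF assms(2,1)] ops_scale_lin[OF assms(2,1)] adj_lin[OF assms] lin_closed[OF adj_lin[OF assms]]
  show ?thesis
    unfolding semilinear_def
    by (auto intro!: adj_eqI[OF assms]) (use assms in \<open>auto simp: adj_inner lin_closed[of _ X Y]\<close>)
qed

text \<open>The carrier is the common domain of the functionals, and functionals separate its
  points, so the set of functionals fixes zero, sum and scaling. The inner product of the dual then
  fixes that of the space. Off the carrier the values are normalised, which makes the records
  equal.\<close>

lemma dual_inject:
  assumes X: "fd_hilbert X" and X': "fd_hilbert X'" and eq: "dual X = dual X'"
  shows "X = X'"
proof -
  have lin: "lin X cspace = lin X' cspace" using carr_dual[of X] carr_dual[of X'] eq by simp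
  have carr: "carr X' = carr X"
    using lin_dom lin dual_lin(1)[OF X] by metis
  have sep: "x = y" if "x \<in> carr X" "y \<in> carr X" "\<And>\<phi>. \<phi> \<in> lin X cspace \<Longrightarrow> \<phi> \<cdot> x = \<phi> \<cdot> y" for x y
    using that(3)[of "bra X _"] X that(1,2) by (intro vec_eqI[OF X]) auto
  have lin': "\<phi> \<in> lin X' cspace" if "\<phi> \<in> lin X cspace" for \<phi> using that lin by simp
  have cl: "vzero X' \<in> carr X" "\<And>x y. x \<in> carr X \<Longrightarrow> y \<in> carr X \<Longrightarrow> vadd X' x y \<in> carr X"
    "\<And>c x. x \<in> carr X \<Longrightarrow> vscale X' c x \<in> carr X"
    using X' fd_hilbert.zero_closed[of X'] fd_hilbert.add_closed[of X'] fd_hilbert.scale_closed[of X'] carr by auto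
  have zero: "vzero X = vzero X'"
  proof (rule sep)
    fix \<phi> assume "\<phi> \<in> lin X cspace"
    then show "\<phi> \<cdot> vzero X = \<phi> \<cdot> vzero X'" using lin_zero[OF _ X, of \<phi> cspace] lin_zero[OF lin' X', of \<phi>] by simp
  qed (use X cl in auto)
  have add: "vadd X x y = vadd X' x y" for x y
  proof (cases "x \<in> carr X \<and> y \<in> carr X")
    case True
    show ?thesis
    proof (rule sep)
      fix \<phi> assume "\<phi> \<in> lin X cspace"
      then show "\<phi> \<cdot> vadd X x y = \<phi> \<cdot> vadd X' x y"
        using lin_add[of \<phi> X cspace x y] lin_add[OF lin', of \<phi> x y] True carr by simp
    qed (use X cl True in auto)
  qed (use fd_hilbert.add_off[OF X] fd_hilbert.add_off[OF X'] carr in simp)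
  have scale: "vscale X c x = vscale X' c x" for c x
  proof (cases "x \<in> carr X")
    case True
    show ?thesis
    proof (rule sep)
      fix \<phi> assume "\<phi> \<in> lin X cspace"
      then show "\<phi> \<cdot> vscale X c x = \<phi> \<cdot> vscale X' c x"
        using lin_scale[of \<phi> X cspace x c] lin_scale[OF lin', of \<phi> x c] True carr by simp
    qed (use X cl True in auto)
  qed (use fd_hilbert.scale_off[OF X] fd_hilbert.scale_off[OF X'] carr in simp)
  have inner: "vinner X x y = vinner X' x y" for x y
  proof (cases "x \<in> carr X \<and> y \<in> carr X")
    case True
    then have b: "bra X x \<in> carr (dual X)" "bra X' x \<in> carr (dual X)"
      using X X' carr lin by auto
    note D = fd_hilbert_dual[OF X]
    \<comment> \<open>Both bras represent evaluation at \<open>x\<close> with respect to the one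
      inner product of the common dual space.\<close>
    have "bra X x = bra X' x"
    proof (rule vec_eqI[OF D b])
      fix \<phi> assume \<phi>: "\<phi> \<in> carr (dual X)"
      have "vinner (dual X) (bra X x) \<phi> = vinner (dual X) (bra X' x) \<phi>"
        using inner_bra[OF X, of x \<phi>] inner_bra[OF X', of x \<phi>] \<phi> lin carr True eq by simp
      then show "vinner (dual X) \<phi> (bra X x) = vinner (dual X) \<phi> (bra X' x)"
        using fd_hilbert.inner_commute[OF D \<phi>] b by simp
    qed
    then have "bra X x \<cdot> y = bra X' x \<cdot> y" by simp
    then show ?thesis using True carr by simp
  qed (use fd_hilbert.inner_off[OF X] fd_hilbert.inner_off[OF X'] carr in simp)
  show ?thesis
    by (rule hilb.equality) (auto simp: carr zero add scale inner fun_eq_iff)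
qed

section \<open>Relations generated by arrows\<close>

text \<open>The atoms are part of the arrow so that one set can hold generators for all pairs of
  atoms, and composability is a match of middle components.\<close>

type_synonym ('a, 'b) arrow = "'a hilb \<times> 'b hilb \<times> ('a \<Rightarrow> 'b option)"

definition arrows :: "'a qset \<Rightarrow> 'b qset \<Rightarrow> ('a, 'b) arrow set" where
  "arrows \<X> \<Y> = {(A, B, v). A \<in> \<X> \<and> B \<in> \<Y> \<and> v \<in> lin A B}"

definition gen :: "'a qset \<Rightarrow> 'b qset \<Rightarrow> ('a, 'b) arrow set \<Rightarrow> ('a, 'b) qrel" where
  "gen \<X> \<Y> M = span_rel \<X> \<Y> (\<lambda>A B. {v. (A, B, v) \<in> M})"

definition acomp :: "('b, 'c) arrow set \<Rightarrow> ('a, 'b) arrow set \<Rightarrow> ('a, 'c) arrow set" where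
  "acomp N M = {(A, C, s \<circ>\<^sub>m r) | A B C r s. (A, B, r) \<in> M \<and> (B, C, s) \<in> N}"

definition aprod :: "('a, 'c) arrow set \<Rightarrow> ('b, 'd) arrow set \<Rightarrow> (('a, 'b) tens, ('c, 'd) tens) arrow set" where
  "aprod M N = {(A1 \<otimes>\<^sub>H A2, B1 \<otimes>\<^sub>H B2, tens_op A1 A2 B1 B2 r1 r2) | A1 A2 B1 B2 r1 r2.
     (A1, B1, r1) \<in> M \<and> (A2, B2, r2) \<in> N}"

definition adual :: "('a, 'b) arrow set \<Rightarrow> ('b \<Rightarrow> complex option, 'a \<Rightarrow> complex option) arrow set" where
  "adual M = {(dual B, dual A, dual_op B v) | A B v. (A, B, v) \<in> M}"

definition aadj :: "('a, 'b) arrow set \<Rightarrow> ('b, 'a) arrow set" where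
  "aadj M = {(B, A, adj_op A B v) | A B v. (A, B, v) \<in> M}"

lemma qset_fd: "is_qset \<X> \<Longrightarrow> A \<in> \<X> \<Longrightarrow> fd_hilbert A"
  by (simp add: is_qset_def)

lemma arrowsD:
  assumes "M \<subseteq> arrows \<X> \<Y>" "(A, B, v) \<in> M"
  shows "A \<in> \<X>" "B \<in> \<Y>" "v \<in> lin A B"
  using assms by (auto simp: arrows_def)

lemma arrows_fd:
  assumes "M \<subseteq> arrows \<X> \<Y>" "is_qset \<X>" "is_qset \<Y>" "(A, B, v) \<in> M"
  shows "fd_hilbert A" "fd_hilbert B" "v \<in> lin A B"
  using arrowsD[OF assms(1,4)] assms(2,3) by (auto simp: qset_fd)

lemma gen_sel [simp]: "src (gen \<X> \<Y> M) = \<X>" "tgt (gen \<X> \<Y> M) = \<Y>"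
  by (simp_all add: gen_def span_rel_def)

lemma rel_at_gen:
  "rel_at (gen \<X> \<Y> M) A B = (if A \<in> \<X> \<and> B \<in> \<Y> then hspan (ops A B) {v. (A, B, v) \<in> M} else {})"
  by (simp add: gen_def span_rel_def)

lemma span_rel_eqI:
  "(\<And>A B. A \<in> \<X> \<Longrightarrow> B \<in> \<Y> \<Longrightarrow> hspan (ops A B) (F A B) = hspan (ops A B) (G A B)) \<Longrightarrow>
    span_rel \<X> \<Y> F = span_rel \<X> \<Y> G"
  by (auto simp: span_rel_def fun_eq_iff)

lemma gen_qRel:
  assumes "is_qset \<X>" "is_qset \<Y>" "M \<subseteq> arrows \<X> \<Y>"
  shows "gen \<X> \<Y> M \<in> qRel \<X> \<Y>"
  using assms by (auto simp: qRel_def rel_at_gen qset_fd arrows_def intro!: hspan_subspace)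

text \<open>All operators of \<open>R\<close> serve as generators, since a subspace is its own span.
  Laws for relations are thereby reduced to laws for sets of arrows.\<close>

lemma qRel_cases:
  assumes "R \<in> qRel \<X> \<Y>"
  obtains M where "M \<subseteq> arrows \<X> \<Y>" "R = gen \<X> \<Y> M"
proof
  let ?M = "{(A, B, v). v \<in> rel_at R A B}"
  have R: "src R = \<X>" "tgt R = \<Y>"
    "\<And>A B. A \<in> \<X> \<Longrightarrow> B \<in> \<Y> \<Longrightarrow> hsubspace (ops A B) (rel_at R A B)"
    "\<And>A B. \<not> (A \<in> \<X> \<and> B \<in> \<Y>) \<Longrightarrow> rel_at R A B = {}"
    using assms by (auto simp: qRel_def split: if_splits)
  show "?M \<subseteq> arrows \<X> \<Y>"
  proof clarify
    fix A B v assume v: "v \<in> rel_at R A B"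
    then have "A \<in> \<X>" "B \<in> \<Y>" using R(4) by fastforce+
    with R(3)[OF this] v show "(A, B, v) \<in> arrows \<X> \<Y>" by (auto simp: arrows_def hsubspace_def)
  qed
  show "R = gen \<X> \<Y> ?M"
    by (rule qrel.equality) (use R in \<open>auto simp: rel_at_gen fun_eq_iff hspan_self\<close>)
qed

lemma acompI: "(A, B, r) \<in> M \<Longrightarrow> (B, C, s) \<in> N \<Longrightarrow> (A, C, s \<circ>\<^sub>m r) \<in> acomp N M"
  by (auto simp: acomp_def)

lemma aprodI: "(A1, B1, r1) \<in> M \<Longrightarrow> (A2, B2, r2) \<in> N \<Longrightarrow>
    (A1 \<otimes>\<^sub>H A2, B1 \<otimes>\<^sub>H B2, tens_op A1 A2 B1 B2 r1 r2) \<in> aprod M N"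
  by (auto simp: aprod_def)

lemma tensor_in_qprod [simp]: "A \<otimes>\<^sub>H B \<in> \<X> \<times>\<^sub>Q \<Y> \<longleftrightarrow> A \<in> \<X> \<and> B \<in> \<Y>"
  by (auto simp: qprod_def)

lemma acomp_arrows:
  assumes "is_qset \<X>" "M \<subseteq> arrows \<X> \<Y>" "N \<subseteq> arrows \<Y> \<Z>" shows "acomp N M \<subseteq> arrows \<X> \<Z>"
  using assms by (fastforce simp: acomp_def arrows_def intro: comp_lin[OF qset_fd])

lemma aprod_arrows:
  assumes "is_qset \<X>" "is_qset \<X>'" "is_qset \<Y>" "is_qset \<Y>'" "M \<subseteq> arrows \<X> \<X>'" "N \<subseteq> arrows \<Y> \<Y>'"
  shows "aprod M N \<subseteq> arrows (\<X> \<times>\<^sub>Q \<Y>) (\<X>' \<times>\<^sub>Q \<Y>')"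
  using assms by (fastforce simp: aprod_def arrows_def intro: tens_op_lin dest: qset_fd)

lemma aadj_arrows:
  assumes "is_qset \<X>" "is_qset \<Y>" "M \<subseteq> arrows \<X> \<Y>" shows "aadj M \<subseteq> arrows \<Y> \<X>"
  using assms by (fastforce simp: aadj_def arrows_def intro: adj_lin dest: qset_fd)

lemma adual_arrows:
  assumes "is_qset \<X>" "is_qset \<Y>" "M \<subseteq> arrows \<X> \<Y>" shows "adual M \<subseteq> arrows (qdual \<Y>) (qdual \<X>)"
  using assms by (fastforce simp: adual_def arrows_def qdual_def intro: dual_op_lin dest: qset_fd)

text \<open>Composites of generators are among the composites of elements; conversely bilinearity
  puts a composite of two elements of the spans into the span of composites of generators.\<close>

lemma gen_comp:
  assumes q: "is_qset \<X>" "is_qset \<Y>" "is_qset \<Z>" and M: "M \<subseteq> arrows \<X> \<Y>" and N: "N \<subseteq> arrows \<Y> \<Z>"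
  shows "gen \<Y> \<Z> N \<circ>\<^sub>R gen \<X> \<Y> M = gen \<X> \<Z> (acomp N M)"
  unfolding rcomp_def gen_sel gen_def[of \<X> \<Z>]
proof (rule span_rel_eqI, rule hspan_eqI)
  fix A C assume A: "A \<in> \<X>" and C: "C \<in> \<Z>"
  let ?T = "{v. (A, C, v) \<in> acomp N M}"
  let ?S = "{s \<circ>\<^sub>m r |s r B. B \<in> \<Y> \<and> s \<in> rel_at (gen \<Y> \<Z> N) B C \<and> r \<in> rel_at (gen \<X> \<Y> M) A B}"
  show fd: "fd_hilbert (ops A C)" using A C q by (simp add: qset_fd)
  show T: "?T \<subseteq> carr (ops A C)" using acomp_arrows[OF q(1) M N] by (auto simp: arrows_def)
  show "?T \<subseteq> ?S"
  proof
    fix v assume "v \<in> ?T"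
    then obtain B r s where *: "v = s \<circ>\<^sub>m r" "(A, B, r) \<in> M" "(B, C, s) \<in> N" by (auto simp: acomp_def)
    then have "B \<in> \<Y>" using arrowsD[OF M] by blast
    with * A C show "v \<in> ?S" by (fastforce simp: rel_at_gen intro: subsetD[OF hspan_base])
  qed
  show "?S \<subseteq> hspan (ops A C) ?T"
  proof clarify
    fix s r B assume B: "B \<in> \<Y>" and s: "s \<in> rel_at (gen \<Y> \<Z> N) B C" and r: "r \<in> rel_at (gen \<X> \<Y> M) A B"
    have f: "fd_hilbert A" "fd_hilbert B" "fd_hilbert C" using A B C q by (auto simp: qset_fd)
    show "s \<circ>\<^sub>m r \<in> hspan (ops A C) ?T"
    proof (rule bilinear_hspan[where f = "\<lambda>s r. s \<circ>\<^sub>m r"])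
      show "s \<in> hspan (ops B C) {v. (B, C, v) \<in> N}" "r \<in> hspan (ops A B) {v. (A, B, v) \<in> M}"
        using A B C s r by (simp_all add: rel_at_gen)
    qed (use f fd T arrowsD[OF M] arrowsD[OF N] in \<open>auto intro!: semilinear_comp_left semilinear_comp_right acompI\<close>)
  qed
qed

lemma gen_prod:
  assumes q: "is_qset \<X>" "is_qset \<X>'" "is_qset \<Y>" "is_qset \<Y>'"
    and M: "M \<subseteq> arrows \<X> \<X>'" and N: "N \<subseteq> arrows \<Y> \<Y>'"
  shows "gen \<X> \<X>' M \<times>\<^sub>R gen \<Y> \<Y>' N = gen (\<X> \<times>\<^sub>Q \<Y>) (\<X>' \<times>\<^sub>Q \<Y>') (aprod M N)"
  unfolding rprod_def gen_sel gen_def[of "_ \<times>\<^sub>Q _"]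
proof (rule span_rel_eqI, rule hspan_eqI)
  fix A B assume "A \<in> \<X> \<times>\<^sub>Q \<Y>" "B \<in> \<X>' \<times>\<^sub>Q \<Y>'"
  then obtain A1 A2 B1 B2 where [simp]: "A = A1 \<otimes>\<^sub>H A2" "B = B1 \<otimes>\<^sub>H B2"
    and AB: "A1 \<in> \<X>" "A2 \<in> \<Y>" "B1 \<in> \<X>'" "B2 \<in> \<Y>'" by (auto simp: qprod_def)
  let ?T = "{v. (A, B, v) \<in> aprod M N}"
  let ?S = "{tens_op X1 X2 Y1 Y2 r1 r2 |X1 X2 Y1 Y2 r1 r2.
        A = X1 \<otimes>\<^sub>H X2 \<and> B = Y1 \<otimes>\<^sub>H Y2 \<and> X1 \<in> \<X> \<and> X2 \<in> \<Y> \<and> Y1 \<in> \<X>' \<and> Y2 \<in> \<Y>' \<and>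
        r1 \<in> rel_at (gen \<X> \<X>' M) X1 Y1 \<and> r2 \<in> rel_at (gen \<Y> \<Y>' N) X2 Y2}"
  have f: "fd_hilbert A1" "fd_hilbert A2" "fd_hilbert B1" "fd_hilbert B2" using AB q by (auto simp: qset_fd)
  then show fd: "fd_hilbert (ops A B)" by simp
  show T: "?T \<subseteq> carr (ops A B)" using aprod_arrows[OF q M N] by (auto simp: arrows_def)
  \<comment> \<open>The factors of the two product atoms are unique, so the existential choice of
    factors collapses to the given ones.\<close>
  have S: "?S = {tens_op A1 A2 B1 B2 r1 r2 | r1 r2. r1 \<in> hspan (ops A1 B1) {v. (A1, B1, v) \<in> M} \<and>
      r2 \<in> hspan (ops A2 B2) {v. (A2, B2, v) \<in> N}}"
    using AB by (auto simp: rel_at_gen)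
  show "?T \<subseteq> ?S"
  proof
    fix v assume "v \<in> ?T"
    then obtain r1 r2 where *: "v = tens_op A1 A2 B1 B2 r1 r2" "(A1, B1, r1) \<in> M" "(A2, B2, r2) \<in> N"
      by (auto simp: aprod_def)
    then have "r1 \<in> hspan (ops A1 B1) {v. (A1, B1, v) \<in> M}" "r2 \<in> hspan (ops A2 B2) {v. (A2, B2, v) \<in> N}"
      by (auto intro: subsetD[OF hspan_base])
    with *(1) show "v \<in> ?S" unfolding S by blast
  qed
  show "?S \<subseteq> hspan (ops A B) ?T"
    unfolding S
  proof clarify
    fix r1 r2 assume r: "r1 \<in> hspan (ops A1 B1) {v. (A1, B1, v) \<in> M}" "r2 \<in> hspan (ops A2 B2) {v. (A2, B2, v) \<in> N}"
    show "tens_op A1 A2 B1 B2 r1 r2 \<in> hspan (ops A B) ?T"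
      by (rule bilinear_hspan[where f = "tens_op A1 A2 B1 B2", OF _ _ _ _ _ _ _ r])
        (use f fd T arrowsD[OF M] arrowsD[OF N] in
          \<open>auto intro!: semilinear_tens_op_left semilinear_tens_op_right aprodI\<close>)
  qed
qed

lemma gen_dag:
  assumes q: "is_qset \<X>" "is_qset \<Y>" and M: "M \<subseteq> arrows \<X> \<Y>"
  shows "rdag (gen \<X> \<Y> M) = gen \<Y> \<X> (aadj M)"
proof (rule qrel.equality)
  show "rel_at (rdag (gen \<X> \<Y> M)) = rel_at (gen \<Y> \<X> (aadj M))"
  proof (intro ext)
    fix B A
    show "rel_at (rdag (gen \<X> \<Y> M)) B A = rel_at (gen \<Y> \<X> (aadj M)) B A"
    proof (cases "A \<in> \<X> \<and> B \<in> \<Y>")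
      case True
      then have f: "fd_hilbert A" "fd_hilbert B" using q by (auto simp: qset_fd)
      have "{v. (B, A, v) \<in> aadj M} = adj_op A B ` {v. (A, B, v) \<in> M}" by (auto simp: aadj_def)
      moreover have "hspan (ops B A) (adj_op A B ` {v. (A, B, v) \<in> M}) = adj_op A B ` hspan (ops A B) {v. (A, B, v) \<in> M}"
        by (rule semilinear_hspan[OF semilinear_adj_op]) (use f arrowsD[OF M] in auto)
      ultimately show ?thesis using True by (simp add: rel_at_gen rdag_def)
    qed (auto simp: rel_at_gen rdag_def)
  qed
qed (auto simp: rdag_def)

text \<open>\<open>rdual\<close> takes images without a span, and linearity of the transpose makes
  the image of a span the span of the images. Injectivity of \<open>dual\<close> on atoms ensures
  that a pair of dual atoms collects the image of one subspace only; a union of several need not be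
  a subspace.\<close>

lemma gen_dual:
  assumes q: "is_qset \<X>" "is_qset \<Y>" and M: "M \<subseteq> arrows \<X> \<Y>"
  shows "rdual (gen \<X> \<Y> M) = gen (qdual \<Y>) (qdual \<X>) (adual M)"
proof (rule qrel.equality)
  have inj: "dual A = dual A' \<Longrightarrow> A = A'" if "A \<in> \<X>" "A' \<in> \<X>" for A A'
    using dual_inject qset_fd[OF q(1)] that by blast
  have inj': "dual A = dual A' \<Longrightarrow> A = A'" if "A \<in> \<Y>" "A' \<in> \<Y>" for A A'
    using dual_inject qset_fd[OF q(2)] that by blast
  show "rel_at (rdual (gen \<X> \<Y> M)) = rel_at (gen (qdual \<Y>) (qdual \<X>) (adual M))"
  proof (intro ext)
    fix B' A'
    show "rel_at (rdual (gen \<X> \<Y> M)) B' A' = rel_at (gen (qdual \<Y>) (qdual \<X>) (adual M)) B' A'"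
    proof (cases "A' \<in> qdual \<X> \<and> B' \<in> qdual \<Y>")
      case True
      then obtain A B where [simp]: "A' = dual A" "B' = dual B" and AB: "A \<in> \<X>" "B \<in> \<Y>"
        by (auto simp: qdual_def)
      have f: "fd_hilbert A" "fd_hilbert B" using AB q by (auto simp: qset_fd)
      have 1: "{v. (dual B, dual A, v) \<in> adual M} = dual_op B ` {v. (A, B, v) \<in> M}"
        using inj[OF AB(1) arrowsD(1)[OF M]] inj'[OF AB(2) arrowsD(2)[OF M]] by (fastforce simp: adual_def)
      have "A'' = A \<and> B'' = B" if "dual A = dual A''" "dual B = dual B''" "A'' \<in> \<X>" "B'' \<in> \<Y>" for A'' B''
        using inj[OF AB(1) that(3,1)] inj'[OF AB(2) that(4,2)] by simp
      then have "rel_at (rdual (gen \<X> \<Y> M)) B' A' = dual_op B ` rel_at (gen \<X> \<Y> M) A B"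
        unfolding rdual_def qrel.simps gen_sel using AB by (simp, blast)
      also have "\<dots> = hspan (ops B' A') (dual_op B ` {v. (A, B, v) \<in> M})"
        using AB semilinear_hspan[OF semilinear_dual_op[OF f], of "{v. (A, B, v) \<in> M}"] f arrowsD(3)[OF M]
        by (simp add: rel_at_gen subset_iff)
      finally show ?thesis using True by (simp add: rel_at_gen 1)
    qed (auto simp: rel_at_gen rdual_def qdual_def)
  qed
qed (auto simp: rdual_def)

section \<open>Quantum sets are closed under unit, product and dual\<close>

lemma is_qset_qone [simp]: "is_qset \<one>\<^sub>Q"
proof -
  have "(UNIV :: complex set) \<noteq> {0}" by (metis UNIV_I singletonD zero_neq_one)
  then show ?thesis by (simp add: is_qset_def qone_def)
qed

text \<open>Squared norms multiply on pure tensors and are preserved by \<open>bra\<close>, so in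
  this form nontriviality passes to products and duals.\<close>

lemma nonzero: "fd_hilbert H \<Longrightarrow> carr H \<noteq> {vzero H} \<longleftrightarrow> (\<exists>x\<in>carr H. vinner H x x \<noteq> 0)"
  using inner_eq_0[of H] by (auto dest: fd_hilbert.zero_closed)

lemma is_qset_qprod [simp]:
  assumes "is_qset \<X>" "is_qset \<Y>" shows "is_qset (\<X> \<times>\<^sub>Q \<Y>)"
  unfolding is_qset_def qprod_def
proof clarify
  fix A B assume "A \<in> \<X>" "B \<in> \<Y>"
  then have f: "fd_hilbert A" "fd_hilbert B" and "carr A \<noteq> {vzero A}" "carr B \<noteq> {vzero B}"
    using assms by (auto simp: is_qset_def)
  then obtain a b where ab: "a \<in> carr A" "vinner A a a \<noteq> 0" "b \<in> carr B" "vinner B b b \<noteq> 0"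
    using nonzero by metis
  then have "vinner (A \<otimes>\<^sub>H B) (tens A B a b) (tens A B a b) \<noteq> 0" using f by simp
  then have "carr (A \<otimes>\<^sub>H B) \<noteq> {vzero (A \<otimes>\<^sub>H B)}" 
    using nonzero[OF fd_hilbert_tensor[OF f]] tens_carr[OF f ab(1,3)] by blast
  then show "fd_hilbert (A \<otimes>\<^sub>H B) \<and> carr (A \<otimes>\<^sub>H B) \<noteq> {vzero (A \<otimes>\<^sub>H B)}" using f by simp
qed

lemma is_qset_qdual [simp]:
  assumes "is_qset \<X>" shows "is_qset (qdual \<X>)"
  unfolding is_qset_def qdual_def
proof clarify
  fix A assume "A \<in> \<X>"
  then have f: "fd_hilbert A" and "carr A \<noteq> {vzero A}" using assms by (auto simp: is_qset_def)
  then obtain a where a: "a \<in> carr A" "vinner A a a \<noteq> 0" using nonzero by metis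
  then have "vinner (dual A) (bra A a) (bra A a) \<noteq> 0" using f by (simp add: inner_bra)
  then have "carr (dual A) \<noteq> {vzero (dual A)}" using nonzero[of "dual A"] f a bra_lin[OF f a(1)] by (metis carr_dual fd_hilbert_dual)
  then show "fd_hilbert (dual A) \<and> carr (dual A) \<noteq> {vzero (dual A)}" using f by simp
qed

section \<open>Structure arrows\<close>

text \<open>One arrow for each atom. A pair of atoms without an arrow receives the span of the empty
  set, the zero subspace; the same convention makes the other structure morphisms vanish off
  matching atoms.\<close>

definition aid :: "'a qset \<Rightarrow> ('a, 'a) arrow set" where
  "aid \<X> = {(A, A, id_op A) | A. A \<in> \<X>}"

definition aassoc :: "'a qset \<Rightarrow> 'b qset \<Rightarrow> 'c qset \<Rightarrow>
    ((('a, 'b) tens, 'c) tens, ('a, ('b, 'c) tens) tens) arrow set" where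
  "aassoc \<X> \<Y> \<Z> = {((A \<otimes>\<^sub>H B) \<otimes>\<^sub>H C, A \<otimes>\<^sub>H (B \<otimes>\<^sub>H C), assoc_op A B C) | A B C. A \<in> \<X> \<and> B \<in> \<Y> \<and> C \<in> \<Z>}"

definition alunit :: "'a qset \<Rightarrow> ((complex, 'a) tens, 'a) arrow set" where
  "alunit \<X> = {(cspace \<otimes>\<^sub>H A, A, lunit_op A) | A. A \<in> \<X>}"

definition arunit :: "'a qset \<Rightarrow> (('a, complex) tens, 'a) arrow set" where
  "arunit \<X> = {(A \<otimes>\<^sub>H cspace, A, runit_op A) | A. A \<in> \<X>}"

definition abraid :: "'a qset \<Rightarrow> 'b qset \<Rightarrow> (('a, 'b) tens, ('b, 'a) tens) arrow set" where
  "abraid \<X> \<Y> = {(A \<otimes>\<^sub>H B, B \<otimes>\<^sub>H A, braid_op A B) | A B. A \<in> \<X> \<and> B \<in> \<Y>}"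

definition aunit :: "'a qset \<Rightarrow> (complex, ('a \<Rightarrow> complex option, 'a) tens) arrow set" where
  "aunit \<X> = {(cspace, dual A \<otimes>\<^sub>H A, unit_op A) | A. A \<in> \<X>}"

definition acounit :: "'a qset \<Rightarrow> (('a, 'a \<Rightarrow> complex option) tens, complex) arrow set" where
  "acounit \<X> = {(A \<otimes>\<^sub>H dual A, cspace, counit_op A) | A. A \<in> \<X>}"

lemmas structure_defs = aid_def aassoc_def alunit_def arunit_def abraid_def aunit_def acounit_def

lemma rid_gen: "rid \<X> = gen \<X> \<X> (aid \<X>)"
  unfolding rid_def gen_def by (intro span_rel_eqI arg_cong[where f = "hspan _"]) (auto simp: aid_def)

lemma rassoc_gen: "rassoc \<X> \<Y> \<Z> = gen ((\<X> \<times>\<^sub>Q \<Y>) \<times>\<^sub>Q \<Z>) (\<X> \<times>\<^sub>Q (\<Y> \<times>\<^sub>Q \<Z>)) (aassoc \<X> \<Y> \<Z>)"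
  unfolding rassoc_def gen_def by (intro span_rel_eqI arg_cong[where f = "hspan _"]) (auto simp: aassoc_def)

lemma rlunit_gen: "rlunit \<X> = gen (\<one>\<^sub>Q \<times>\<^sub>Q \<X>) \<X> (alunit \<X>)"
  unfolding rlunit_def gen_def by (intro span_rel_eqI arg_cong[where f = "hspan _"]) (auto simp: alunit_def)

lemma rrunit_gen: "rrunit \<X> = gen (\<X> \<times>\<^sub>Q \<one>\<^sub>Q) \<X> (arunit \<X>)"
  unfolding rrunit_def gen_def by (intro span_rel_eqI arg_cong[where f = "hspan _"]) (auto simp: arunit_def)

lemma rbraid_gen: "rbraid \<X> \<Y> = gen (\<X> \<times>\<^sub>Q \<Y>) (\<Y> \<times>\<^sub>Q \<X>) (abraid \<X> \<Y>)"
  unfolding rbraid_def gen_def by (intro span_rel_eqI arg_cong[where f = "hspan _"]) (auto simp: abraid_def)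

lemma qunit_gen: "qunit \<X> = gen \<one>\<^sub>Q (qdual \<X> \<times>\<^sub>Q \<X>) (aunit \<X>)"
  unfolding qunit_def gen_def by (intro span_rel_eqI arg_cong[where f = "hspan _"]) (auto simp: aunit_def)

lemma qcounit_gen: "qcounit \<X> = gen (\<X> \<times>\<^sub>Q qdual \<X>) \<one>\<^sub>Q (acounit \<X>)"
  unfolding qcounit_def gen_def by (intro span_rel_eqI arg_cong[where f = "hspan _"]) (auto simp: acounit_def)

lemmas rel_gens = rid_gen rassoc_gen rlunit_gen rrunit_gen rbraid_gen qunit_gen qcounit_gen

lemma cspace_qone [simp]: "A \<in> \<one>\<^sub>Q \<longleftrightarrow> A = cspace"
  by (simp add: qone_def)

lemma dual_qdual [simp]: "A \<in> \<X> \<Longrightarrow> dual A \<in> qdual \<X>"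
  by (simp add: qdual_def)

lemma structure_arrows [simp]:
  assumes "is_qset \<X>"
  shows "aid \<X> \<subseteq> arrows \<X> \<X>"
    and "alunit \<X> \<subseteq> arrows (\<one>\<^sub>Q \<times>\<^sub>Q \<X>) \<X>"
    and "arunit \<X> \<subseteq> arrows (\<X> \<times>\<^sub>Q \<one>\<^sub>Q) \<X>"
    and "aunit \<X> \<subseteq> arrows \<one>\<^sub>Q (qdual \<X> \<times>\<^sub>Q \<X>)"
    and "acounit \<X> \<subseteq> arrows (\<X> \<times>\<^sub>Q qdual \<X>) \<one>\<^sub>Q"
    and "is_qset \<Y> \<Longrightarrow> abraid \<X> \<Y> \<subseteq> arrows (\<X> \<times>\<^sub>Q \<Y>) (\<Y> \<times>\<^sub>Q \<X>)"
    and "is_qset \<Y> \<Longrightarrow> is_qset \<Z> \<Longrightarrow>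
      aassoc \<X> \<Y> \<Z> \<subseteq> arrows ((\<X> \<times>\<^sub>Q \<Y>) \<times>\<^sub>Q \<Z>) (\<X> \<times>\<^sub>Q (\<Y> \<times>\<^sub>Q \<Z>))"
  using assms by (auto simp: structure_defs arrows_def qset_fd)

lemma aidI: "A \<in> \<X> \<Longrightarrow> (A, A, id_op A) \<in> aid \<X>"
  by (auto simp: aid_def)

lemma aassocI: "A \<in> \<X> \<Longrightarrow> B \<in> \<Y> \<Longrightarrow> C \<in> \<Z> \<Longrightarrow>
    ((A \<otimes>\<^sub>H B) \<otimes>\<^sub>H C, A \<otimes>\<^sub>H (B \<otimes>\<^sub>H C), assoc_op A B C) \<in> aassoc \<X> \<Y> \<Z>"
  by (auto simp: aassoc_def)

lemma alunitI: "A \<in> \<X> \<Longrightarrow> (cspace \<otimes>\<^sub>H A, A, lunit_op A) \<in> alunit \<X>"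
  by (auto simp: alunit_def)

lemma arunitI: "A \<in> \<X> \<Longrightarrow> (A \<otimes>\<^sub>H cspace, A, runit_op A) \<in> arunit \<X>"
  by (auto simp: arunit_def)

lemma abraidI: "A \<in> \<X> \<Longrightarrow> B \<in> \<Y> \<Longrightarrow> (A \<otimes>\<^sub>H B, B \<otimes>\<^sub>H A, braid_op A B) \<in> abraid \<X> \<Y>"
  by (auto simp: abraid_def)

lemma aunitI: "A \<in> \<X> \<Longrightarrow> (cspace, dual A \<otimes>\<^sub>H A, unit_op A) \<in> aunit \<X>"
  by (auto simp: aunit_def)

lemma acounitI: "A \<in> \<X> \<Longrightarrow> (A \<otimes>\<^sub>H dual A, cspace, counit_op A) \<in> acounit \<X>"
  by (auto simp: acounit_def)

lemma aadjI: "(A, B, v) \<in> M \<Longrightarrow> (B, A, adj_op A B v) \<in> aadj M"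
  by (auto simp: aadj_def)

lemma adualI: "(A, B, v) \<in> M \<Longrightarrow> (dual B, dual A, dual_op B v) \<in> adual M"
  by (auto simp: adual_def)

lemma arrow_eqI:
  assumes "\<And>A B v. (A, B, v) \<in> M \<Longrightarrow> (A, B, v) \<in> N" "\<And>A B v. (A, B, v) \<in> N \<Longrightarrow> (A, B, v) \<in> M"
  shows "M = N"
  using assms by auto

section \<open>Identities between arrows\<close>

lemma acomp_assoc: "acomp (acomp T S) R = acomp T (acomp S R)"
proof (rule arrow_eqI)
  fix A D v assume "(A, D, v) \<in> acomp (acomp T S) R"
  then obtain B C r s t where "(A, B, r) \<in> R" "(B, C, s) \<in> S" "(C, D, t) \<in> T" "v = (t \<circ>\<^sub>m s) \<circ>\<^sub>m r"
    by (auto simp: acomp_def)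
  then show "(A, D, v) \<in> acomp T (acomp S R)" unfolding map_comp_assoc by (auto intro: acompI)
next
  fix A D v assume "(A, D, v) \<in> acomp T (acomp S R)"
  then obtain B C r s t where "(A, B, r) \<in> R" "(B, C, s) \<in> S" "(C, D, t) \<in> T" "v = t \<circ>\<^sub>m (s \<circ>\<^sub>m r)"
    by (auto simp: acomp_def)
  then show "(A, D, v) \<in> acomp (acomp T S) R" unfolding map_comp_assoc[symmetric] by (auto intro: acompI)
qed

lemma acomp_id_right:
  assumes "is_qset \<X>" "is_qset \<Y>" "M \<subseteq> arrows \<X> \<Y>" shows "acomp M (aid \<X>) = M"
proof (rule arrow_eqI)
  fix A B v assume "(A, B, v) \<in> acomp M (aid \<X>)"
  then obtain r where "(A, B, r) \<in> M" "v = r \<circ>\<^sub>m id_op A" by (auto simp: acomp_def aid_def)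
  then show "(A, B, v) \<in> M" using arrows_fd[OF assms(3,1,2)] by (metis comp_id)
next
  fix A B v assume h: "(A, B, v) \<in> M"
  then show "(A, B, v) \<in> acomp M (aid \<X>)"
    using acompI[OF aidI h] arrowsD[OF assms(3) h] arrows_fd[OF assms(3,1,2) h] by simp
qed

lemma acomp_id_left:
  assumes "is_qset \<X>" "is_qset \<Y>" "M \<subseteq> arrows \<X> \<Y>" shows "acomp (aid \<Y>) M = M"
proof (rule arrow_eqI)
  fix A B v assume "(A, B, v) \<in> acomp (aid \<Y>) M"
  then obtain r where "(A, B, r) \<in> M" "v = id_op B \<circ>\<^sub>m r" by (auto simp: acomp_def aid_def)
  then show "(A, B, v) \<in> M" using arrows_fd[OF assms(3,1,2)] by (metis id_comp)
next
  fix A B v assume h: "(A, B, v) \<in> M"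
  then show "(A, B, v) \<in> acomp (aid \<Y>) M"
    using acompI[OF h aidI] arrowsD[OF assms(3) h] arrows_fd[OF assms(3,1,2) h] by simp
qed

lemma aprod_id:
  assumes "is_qset \<X>" "is_qset \<Y>" shows "aprod (aid \<X>) (aid \<Y>) = aid (\<X> \<times>\<^sub>Q \<Y>)"
  using assms by (fastforce simp: aprod_def aid_def qprod_def tens_op_id qset_fd)

text \<open>Product atoms in the middle match only if both factors match, so the same quadruples of
  arrows occur on both sides; for each quadruple the operators agree by
  \<open>tens_op_comp\<close>.\<close>

lemma aprod_acomp:
  assumes q: "is_qset \<X>" "is_qset \<Y>" "is_qset \<Z>" "is_qset \<X>'" "is_qset \<Y>'" "is_qset \<Z>'"
    and R: "R \<subseteq> arrows \<X> \<Y>" and S: "S \<subseteq> arrows \<Y> \<Z>" and R': "R' \<subseteq> arrows \<X>' \<Y>'" and S': "S' \<subseteq> arrows \<Y>' \<Z>'"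
  shows "acomp (aprod S S') (aprod R R') = aprod (acomp S R) (acomp S' R')"
proof -
  have eq: "tens_op B B' C C' s s' \<circ>\<^sub>m tens_op A A' B B' r r' = tens_op A A' C C' (s \<circ>\<^sub>m r) (s' \<circ>\<^sub>m r')"
    if "(A, B, r) \<in> R" "(B, C, s) \<in> S" "(A', B', r') \<in> R'" "(B', C', s') \<in> S'" for A A' B B' C C' r r' s s'
    using arrows_fd[OF R q(1,2) that(1)] arrows_fd[OF S q(2,3) that(2)]
      arrows_fd[OF R' q(4,5) that(3)] arrows_fd[OF S' q(5,6) that(4)] by (intro tens_op_comp)
  show ?thesis
  proof (rule arrow_eqI)
    fix D E v assume "(D, E, v) \<in> acomp (aprod S S') (aprod R R')"
    then obtain A A' B B' C C' r r' s s' where h: "(A, B, r) \<in> R" "(B, C, s) \<in> S" "(A', B', r') \<in> R'" "(B', C', s') \<in> S'"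
      and "D = A \<otimes>\<^sub>H A'" "E = C \<otimes>\<^sub>H C'" "v = tens_op B B' C C' s s' \<circ>\<^sub>m tens_op A A' B B' r r'"
      by (auto simp: acomp_def aprod_def)
    then show "(D, E, v) \<in> aprod (acomp S R) (acomp S' R')"
      using aprodI[OF acompI[OF h(1,2)] acompI[OF h(3,4)]] eq[OF h] by simp
  next
    fix D E v assume "(D, E, v) \<in> aprod (acomp S R) (acomp S' R')"
    then obtain A A' B B' C C' r r' s s' where h: "(A, B, r) \<in> R" "(B, C, s) \<in> S" "(A', B', r') \<in> R'" "(B', C', s') \<in> S'"
      and "D = A \<otimes>\<^sub>H A'" "E = C \<otimes>\<^sub>H C'" "v = tens_op A A' C C' (s \<circ>\<^sub>m r) (s' \<circ>\<^sub>m r')"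
      by (auto simp: acomp_def aprod_def)
    then show "(D, E, v) \<in> acomp (aprod S S') (aprod R R')"
      using acompI[OF aprodI[OF h(1,3)] aprodI[OF h(2,4)]] eq[OF h] by simp
  qed
qed

lemma aassoc_natural:
  assumes q: "is_qset \<X>" "is_qset \<Y>" "is_qset \<Z>" "is_qset \<X>'" "is_qset \<Y>'" "is_qset \<Z>'"
    and R: "R \<subseteq> arrows \<X> \<X>'" and S: "S \<subseteq> arrows \<Y> \<Y>'" and T: "T \<subseteq> arrows \<Z> \<Z>'"
  shows "acomp (aassoc \<X>' \<Y>' \<Z>') (aprod (aprod R S) T) = acomp (aprod R (aprod S T)) (aassoc \<X> \<Y> \<Z>)"
proof -
  have eq: "assoc_op A' B' C' \<circ>\<^sub>m tens_op (A \<otimes>\<^sub>H B) C (A' \<otimes>\<^sub>H B') C' (tens_op A B A' B' r s) t =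
      tens_op A (B \<otimes>\<^sub>H C) A' (B' \<otimes>\<^sub>H C') r (tens_op B C B' C' s t) \<circ>\<^sub>m assoc_op A B C"
    if "(A, A', r) \<in> R" "(B, B', s) \<in> S" "(C, C', t) \<in> T" for A A' B B' C C' r s t
    using arrows_fd[OF R q(1,4) that(1)] arrows_fd[OF S q(2,5) that(2)]
      arrows_fd[OF T q(3,6) that(3)] by (intro assoc_natural)
  show ?thesis
  proof (rule arrow_eqI)
    fix D E v assume "(D, E, v) \<in> acomp (aassoc \<X>' \<Y>' \<Z>') (aprod (aprod R S) T)"
    then obtain A A' B B' C C' r s t where h: "(A, A', r) \<in> R" "(B, B', s) \<in> S" "(C, C', t) \<in> T"
      and "D = (A \<otimes>\<^sub>H B) \<otimes>\<^sub>H C" "E = A' \<otimes>\<^sub>H (B' \<otimes>\<^sub>H C')"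
      "v = assoc_op A' B' C' \<circ>\<^sub>m tens_op (A \<otimes>\<^sub>H B) C (A' \<otimes>\<^sub>H B') C' (tens_op A B A' B' r s) t"
      by (auto simp: acomp_def aprod_def aassoc_def)
    then show "(D, E, v) \<in> acomp (aprod R (aprod S T)) (aassoc \<X> \<Y> \<Z>)"
      using acompI[OF aassocI aprodI[OF h(1) aprodI[OF h(2,3)]]] eq[OF h]
        arrowsD[OF R h(1)] arrowsD[OF S h(2)] arrowsD[OF T h(3)] by simp
  next
    fix D E v assume "(D, E, v) \<in> acomp (aprod R (aprod S T)) (aassoc \<X> \<Y> \<Z>)"
    then obtain A A' B B' C C' r s t where h: "(A, A', r) \<in> R" "(B, B', s) \<in> S" "(C, C', t) \<in> T"
      and "D = (A \<otimes>\<^sub>H B) \<otimes>\<^sub>H C" "E = A' \<otimes>\<^sub>H (B' \<otimes>\<^sub>H C')"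
      "v = tens_op A (B \<otimes>\<^sub>H C) A' (B' \<otimes>\<^sub>H C') r (tens_op B C B' C' s t) \<circ>\<^sub>m assoc_op A B C"
      by (auto simp: acomp_def aprod_def aassoc_def)
    then show "(D, E, v) \<in> acomp (aassoc \<X>' \<Y>' \<Z>') (aprod (aprod R S) T)"
      using acompI[OF aprodI[OF aprodI[OF h(1,2)] h(3)] aassocI] eq[OF h]
        arrowsD[OF R h(1)] arrowsD[OF S h(2)] arrowsD[OF T h(3)] by simp
  qed
qed

lemma alunit_natural:
  assumes q: "is_qset \<X>" "is_qset \<Y>" and R: "R \<subseteq> arrows \<X> \<Y>"
  shows "acomp (alunit \<Y>) (aprod (aid \<one>\<^sub>Q) R) = acomp R (alunit \<X>)"
proof (rule arrow_eqI)
  fix D E v assume "(D, E, v) \<in> acomp (alunit \<Y>) (aprod (aid \<one>\<^sub>Q) R)"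
  then obtain A r where h: "(A, E, r) \<in> R"
    and "D = cspace \<otimes>\<^sub>H A" "v = lunit_op E \<circ>\<^sub>m tens_op cspace A cspace E (id_op cspace) r"
    by (auto simp: acomp_def aprod_def alunit_def aid_def)
  then show "(D, E, v) \<in> acomp R (alunit \<X>)"
    using acompI[OF alunitI h] arrowsD[OF R h] lunit_natural[OF arrows_fd[OF R q h]] by simp
next
  fix D E v assume "(D, E, v) \<in> acomp R (alunit \<X>)"
  then obtain A r where h: "(A, E, r) \<in> R" and "D = cspace \<otimes>\<^sub>H A" "v = r \<circ>\<^sub>m lunit_op A"
    by (auto simp: acomp_def alunit_def)
  then show "(D, E, v) \<in> acomp (alunit \<Y>) (aprod (aid \<one>\<^sub>Q) R)"
    using acompI[OF aprodI[OF aidI[of cspace "\<one>\<^sub>Q"] h] alunitI] arrowsD[OF R h] lunit_natural[OF arrows_fd[OF R q h]] by simp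
qed

lemma arunit_natural:
  assumes q: "is_qset \<X>" "is_qset \<Y>" and R: "R \<subseteq> arrows \<X> \<Y>"
  shows "acomp (arunit \<Y>) (aprod R (aid \<one>\<^sub>Q)) = acomp R (arunit \<X>)"
proof (rule arrow_eqI)
  fix D E v assume "(D, E, v) \<in> acomp (arunit \<Y>) (aprod R (aid \<one>\<^sub>Q))"
  then obtain A r where h: "(A, E, r) \<in> R"
    and "D = A \<otimes>\<^sub>H cspace" "v = runit_op E \<circ>\<^sub>m tens_op A cspace E cspace r (id_op cspace)"
    by (auto simp: acomp_def aprod_def arunit_def aid_def)
  then show "(D, E, v) \<in> acomp R (arunit \<X>)"
    using acompI[OF arunitI h] arrowsD[OF R h] runit_natural[OF arrows_fd[OF R q h]] by simp
next
  fix D E v assume "(D, E, v) \<in> acomp R (arunit \<X>)"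
  then obtain A r where h: "(A, E, r) \<in> R" and "D = A \<otimes>\<^sub>H cspace" "v = r \<circ>\<^sub>m runit_op A"
    by (auto simp: acomp_def arunit_def)
  then show "(D, E, v) \<in> acomp (arunit \<Y>) (aprod R (aid \<one>\<^sub>Q))"
    using acompI[OF aprodI[OF h aidI[of cspace "\<one>\<^sub>Q"]] arunitI] arrowsD[OF R h] runit_natural[OF arrows_fd[OF R q h]] by simp
qed

lemma abraid_natural:
  assumes q: "is_qset \<X>" "is_qset \<Y>" "is_qset \<X>'" "is_qset \<Y>'"
    and R: "R \<subseteq> arrows \<X> \<X>'" and S: "S \<subseteq> arrows \<Y> \<Y>'"
  shows "acomp (abraid \<X>' \<Y>') (aprod R S) = acomp (aprod S R) (abraid \<X> \<Y>)"
proof -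
  have eq: "braid_op A' B' \<circ>\<^sub>m tens_op A B A' B' r s = tens_op B A B' A' s r \<circ>\<^sub>m braid_op A B"
    if "(A, A', r) \<in> R" "(B, B', s) \<in> S" for A A' B B' r s
    using arrows_fd[OF R q(1,3) that(1)] arrows_fd[OF S q(2,4) that(2)] by (intro braid_natural)
  show ?thesis
  proof (rule arrow_eqI)
    fix D E v assume "(D, E, v) \<in> acomp (abraid \<X>' \<Y>') (aprod R S)"
    then obtain A A' B B' r s where h: "(A, A', r) \<in> R" "(B, B', s) \<in> S"
      and "D = A \<otimes>\<^sub>H B" "E = B' \<otimes>\<^sub>H A'" "v = braid_op A' B' \<circ>\<^sub>m tens_op A B A' B' r s"
      by (auto simp: acomp_def aprod_def abraid_def)
    then show "(D, E, v) \<in> acomp (aprod S R) (abraid \<X> \<Y>)"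
      using acompI[OF abraidI aprodI[OF h(2,1)]] eq[OF h] arrowsD[OF R h(1)] arrowsD[OF S h(2)] by simp
  next
    fix D E v assume "(D, E, v) \<in> acomp (aprod S R) (abraid \<X> \<Y>)"
    then obtain A A' B B' r s where h: "(A, A', r) \<in> R" "(B, B', s) \<in> S"
      and "D = A \<otimes>\<^sub>H B" "E = B' \<otimes>\<^sub>H A'" "v = tens_op B A B' A' s r \<circ>\<^sub>m braid_op A B"
      by (auto simp: acomp_def aprod_def abraid_def)
    then show "(D, E, v) \<in> acomp (abraid \<X>' \<Y>') (aprod R S)"
      using acompI[OF aprodI[OF h(1,2)] abraidI] eq[OF h] arrowsD[OF R h(1)] arrowsD[OF S h(2)] by simp
  qed
qed

lemma apentagon:
  assumes q: "is_qset \<W>" "is_qset \<X>" "is_qset \<Y>" "is_qset \<Z>"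
  shows "acomp (aprod (aid \<W>) (aassoc \<X> \<Y> \<Z>)) (acomp (aassoc \<W> (\<X> \<times>\<^sub>Q \<Y>) \<Z>) (aprod (aassoc \<W> \<X> \<Y>) (aid \<Z>))) =
    acomp (aassoc \<W> \<X> (\<Y> \<times>\<^sub>Q \<Z>)) (aassoc (\<W> \<times>\<^sub>Q \<X>) \<Y> \<Z>)" (is "?l = ?r")
proof (rule arrow_eqI)
  fix D E v assume "(D, E, v) \<in> ?l"
  then obtain A B C F where h: "A \<in> \<W>" "B \<in> \<X>" "C \<in> \<Y>" "F \<in> \<Z>"
    and "D = ((A \<otimes>\<^sub>H B) \<otimes>\<^sub>H C) \<otimes>\<^sub>H F" "E = A \<otimes>\<^sub>H (B \<otimes>\<^sub>H (C \<otimes>\<^sub>H F))"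
    "v = tens_op A ((B \<otimes>\<^sub>H C) \<otimes>\<^sub>H F) A (B \<otimes>\<^sub>H (C \<otimes>\<^sub>H F)) (id_op A) (assoc_op B C F) \<circ>\<^sub>m
      (assoc_op A (B \<otimes>\<^sub>H C) F \<circ>\<^sub>m
       tens_op ((A \<otimes>\<^sub>H B) \<otimes>\<^sub>H C) F (A \<otimes>\<^sub>H (B \<otimes>\<^sub>H C)) F (assoc_op A B C) (id_op F))"
    by (auto simp: acomp_def aprod_def aassoc_def aid_def)
  then show "(D, E, v) \<in> ?r"
    using acompI[OF aassocI[of "A \<otimes>\<^sub>H B" "\<W> \<times>\<^sub>Q \<X>" C \<Y> F \<Z>] aassocI[of A \<W> B \<X> "C \<otimes>\<^sub>H F" "\<Y> \<times>\<^sub>Q \<Z>"]]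
      pentagon[of A B C F] q by (simp add: qset_fd)
next
  fix D E v assume "(D, E, v) \<in> ?r"
  then obtain A B C F where h: "A \<in> \<W>" "B \<in> \<X>" "C \<in> \<Y>" "F \<in> \<Z>"
    and "D = ((A \<otimes>\<^sub>H B) \<otimes>\<^sub>H C) \<otimes>\<^sub>H F" "E = A \<otimes>\<^sub>H (B \<otimes>\<^sub>H (C \<otimes>\<^sub>H F))"
    "v = assoc_op A B (C \<otimes>\<^sub>H F) \<circ>\<^sub>m assoc_op (A \<otimes>\<^sub>H B) C F"
    by (auto simp: acomp_def aassoc_def)
  then show "(D, E, v) \<in> ?l"
    using acompI[OF acompI[OF aprodI[OF aassocI[OF h(1,2,3)] aidI[OF h(4)]]
        aassocI[of A \<W> "B \<otimes>\<^sub>H C" "\<X> \<times>\<^sub>Q \<Y>" F \<Z>]] aprodI[OF aidI[OF h(1)] aassocI[OF h(2,3,4)]]]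
      pentagon[of A B C F] q by (simp add: qset_fd)
qed

lemma atriangle:
  assumes q: "is_qset \<X>" "is_qset \<Y>"
  shows "acomp (aprod (aid \<X>) (alunit \<Y>)) (aassoc \<X> \<one>\<^sub>Q \<Y>) = aprod (arunit \<X>) (aid \<Y>)"
proof (rule arrow_eqI)
  fix D E v assume "(D, E, v) \<in> acomp (aprod (aid \<X>) (alunit \<Y>)) (aassoc \<X> \<one>\<^sub>Q \<Y>)"
  then obtain A B where h: "A \<in> \<X>" "B \<in> \<Y>" and "D = (A \<otimes>\<^sub>H cspace) \<otimes>\<^sub>H B" "E = A \<otimes>\<^sub>H B"
    "v = tens_op A (cspace \<otimes>\<^sub>H B) A B (id_op A) (lunit_op B) \<circ>\<^sub>m assoc_op A cspace B"
    by (auto simp: acomp_def aprod_def aassoc_def aid_def alunit_def)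
  then show "(D, E, v) \<in> aprod (arunit \<X>) (aid \<Y>)"
    using aprodI[OF arunitI[OF h(1)] aidI[OF h(2)]] triangle[of A B] q by (simp add: qset_fd)
next
  fix D E v assume "(D, E, v) \<in> aprod (arunit \<X>) (aid \<Y>)"
  then obtain A B where h: "A \<in> \<X>" "B \<in> \<Y>" and "D = (A \<otimes>\<^sub>H cspace) \<otimes>\<^sub>H B" "E = A \<otimes>\<^sub>H B"
    "v = tens_op (A \<otimes>\<^sub>H cspace) B A B (runit_op A) (id_op B)"
    by (auto simp: aprod_def aid_def arunit_def)
  then show "(D, E, v) \<in> acomp (aprod (aid \<X>) (alunit \<Y>)) (aassoc \<X> \<one>\<^sub>Q \<Y>)"
    using acompI[OF aassocI[of A \<X> cspace "\<one>\<^sub>Q" B \<Y>] aprodI[OF aidI[OF h(1)] alunitI[OF h(2)]]] triangle[of A B] q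
    by (simp add: qset_fd)
qed

lemma ahexagon:
  assumes q: "is_qset \<X>" "is_qset \<Y>" "is_qset \<Z>"
  shows "acomp (aassoc \<Y> \<Z> \<X>) (acomp (abraid \<X> (\<Y> \<times>\<^sub>Q \<Z>)) (aassoc \<X> \<Y> \<Z>)) =
    acomp (aprod (aid \<Y>) (abraid \<X> \<Z>)) (acomp (aassoc \<Y> \<X> \<Z>) (aprod (abraid \<X> \<Y>) (aid \<Z>)))" (is "?l = ?r")
proof (rule arrow_eqI)
  fix D E v assume "(D, E, v) \<in> ?l"
  then obtain A B C where h: "A \<in> \<X>" "B \<in> \<Y>" "C \<in> \<Z>"
    and "D = (A \<otimes>\<^sub>H B) \<otimes>\<^sub>H C" "E = B \<otimes>\<^sub>H (C \<otimes>\<^sub>H A)"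
    "v = assoc_op B C A \<circ>\<^sub>m (braid_op A (B \<otimes>\<^sub>H C) \<circ>\<^sub>m assoc_op A B C)"
    by (auto simp: acomp_def aassoc_def abraid_def)
  then show "(D, E, v) \<in> ?r"
    using acompI[OF acompI[OF aprodI[OF abraidI[OF h(1,2)] aidI[OF h(3)]] aassocI[OF h(2,1,3)]]
        aprodI[OF aidI[OF h(2)] abraidI[OF h(1,3)]]] hexagon[of A B C] q by (simp add: qset_fd)
next
  fix D E v assume "(D, E, v) \<in> ?r"
  then obtain A B C where h: "A \<in> \<X>" "B \<in> \<Y>" "C \<in> \<Z>"
    and "D = (A \<otimes>\<^sub>H B) \<otimes>\<^sub>H C" "E = B \<otimes>\<^sub>H (C \<otimes>\<^sub>H A)"
    "v = tens_op B (A \<otimes>\<^sub>H C) B (C \<otimes>\<^sub>H A) (id_op B) (braid_op A C) \<circ>\<^sub>m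
      (assoc_op B A C \<circ>\<^sub>m tens_op (A \<otimes>\<^sub>H B) C (B \<otimes>\<^sub>H A) C (braid_op A B) (id_op C))"
    by (auto simp: acomp_def aprod_def aassoc_def abraid_def aid_def)
  then show "(D, E, v) \<in> ?l"
    using acompI[OF acompI[OF aassocI[OF h] abraidI[of A \<X> "B \<otimes>\<^sub>H C" "\<Y> \<times>\<^sub>Q \<Z>"]] aassocI[OF h(2,3,1)]]
      hexagon[of A B C] q by (simp add: qset_fd)
qed

lemma abraid_abraid:
  assumes q: "is_qset \<X>" "is_qset \<Y>"
  shows "acomp (abraid \<Y> \<X>) (abraid \<X> \<Y>) = aid (\<X> \<times>\<^sub>Q \<Y>)"
  using q by (fastforce simp: acomp_def abraid_def aid_def qprod_def braid_braid qset_fd)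

lemma adual_id: "is_qset \<X> \<Longrightarrow> adual (aid \<X>) = aid (qdual \<X>)"
  by (fastforce simp: adual_def aid_def qdual_def dual_op_id qset_fd)

lemma adual_acomp:
  assumes q: "is_qset \<X>" "is_qset \<Y>" "is_qset \<Z>" and R: "R \<subseteq> arrows \<X> \<Y>" and S: "S \<subseteq> arrows \<Y> \<Z>"
  shows "adual (acomp S R) = acomp (adual R) (adual S)"
proof (rule arrow_eqI)
  have eq: "dual_op C (s \<circ>\<^sub>m r) = dual_op B r \<circ>\<^sub>m dual_op C s"
    if "(A, B, r) \<in> R" "(B, C, s) \<in> S" for A B C r s
    using arrows_fd[OF R q(1,2) that(1)] arrows_fd[OF S q(2,3) that(2)] by (intro dual_op_comp)
  fix D E v
  {
    assume "(D, E, v) \<in> adual (acomp S R)"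
    then obtain A B C r s where h: "(A, B, r) \<in> R" "(B, C, s) \<in> S"
      and "D = dual C" "E = dual A" "v = dual_op C (s \<circ>\<^sub>m r)" by (auto simp: adual_def acomp_def)
    then show "(D, E, v) \<in> acomp (adual R) (adual S)"
      using acompI[OF adualI[OF h(2)] adualI[OF h(1)]] eq[OF h] by simp
  next
    assume "(D, E, v) \<in> acomp (adual R) (adual S)"
    then obtain A B B' C r s where h: "(A, B, r) \<in> R" "(B', C, s) \<in> S" "dual B = dual B'"
      and v: "D = dual C" "E = dual A" "v = dual_op B r \<circ>\<^sub>m dual_op C s" by (auto simp: adual_def acomp_def)
    \<comment> \<open>Composability on the right side only says that the dual atoms in the middle
      agree.\<close>
    have "B' = B"
      using dual_inject[OF arrows_fd(2)[OF R q(1,2) h(1)] arrows_fd(1)[OF S q(2,3) h(2)] h(3)] by simp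
    show "(D, E, v) \<in> adual (acomp S R)"
      using v adualI[OF acompI[OF h(1) h(2)[unfolded \<open>B' = B\<close>]]] eq[OF h(1) h(2)[unfolded \<open>B' = B\<close>]] by simp
  }
qed

text \<open>The source fixes an atom of the left factor, and the counit accepts only its own dual
  beside it. This forces the dual of the source of the arrow of \<open>R\<close> to be the dual of
  that atom, so each composite is one operator snake.\<close>

lemma asnake_left:
  assumes q: "is_qset \<X>" "is_qset \<Y>" and R: "R \<subseteq> arrows \<X> \<Y>"
  shows "acomp (alunit \<Y>) (acomp (aprod (acounit \<X>) (aid \<Y>)) (acomp (aadj (aassoc \<X> (qdual \<X>) \<Y>))
    (acomp (aprod (aid \<X>) (aprod (adual R) (aid \<Y>))) (acomp (aprod (aid \<X>) (aunit \<Y>)) (aadj (arunit \<X>)))))) = R"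
    (is "?l = R")
proof (rule arrow_eqI)
  have inj: "A = A'" if "dual A = dual A'" "A \<in> \<X>" "A' \<in> \<X>" for A A'
    using dual_inject[OF _ _ that(1)] q that by (simp add: qset_fd)
  have inj': "A = A'" if "dual A = dual A'" "A \<in> \<Y>" "A' \<in> \<Y>" for A A'
    using dual_inject[OF _ _ that(1)] q that by (simp add: qset_fd)
  fix D E v
  {
    assume "(D, E, v) \<in> ?l"
    then obtain A B r where h: "(A, B, r) \<in> R" "dual A = dual D" "dual B = dual E" and D: "D \<in> \<X>" "E \<in> \<Y>"
      and v: "v = left_snake D E (dual_op B r)"
      by (auto simp: acomp_def aprod_def structure_defs aadj_def adual_def left_snake_def)
    \<comment> \<open>Unit and counit identify only the duals of the atoms; the atoms themselves
      follow by injectivity of \<open>dual\<close>.\<close>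
    have "A = D" "B = E" using inj[OF h(2)] inj'[OF h(3)] D arrowsD[OF R h(1)] by auto
    then show "(D, E, v) \<in> R" using h(1) v snake_left[OF arrows_fd[OF R q h(1)]] by simp
  next
    assume h: "(D, E, v) \<in> R"
    note D = arrowsD[OF R h]
    show "(D, E, v) \<in> ?l"
      \<comment> \<open>The innermost \<open>acompI\<close> joins the first two arrows of the
        composite, and each further one appends the next.\<close>
      using acompI[OF acompI[OF acompI[OF acompI[OF acompI[OF aadjI[OF arunitI[OF D(1)]]
        aprodI[OF aidI[OF D(1)] aunitI[OF D(2)]]] aprodI[OF aidI[OF D(1)] aprodI[OF adualI[OF h] aidI[OF D(2)]]]]
        aadjI[OF aassocI[OF D(1) dual_qdual[OF D(1)] D(2)]]] aprodI[OF acounitI[OF D(1)] aidI[OF D(2)]]] alunitI[OF D(2)]]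
        snake_left[OF arrows_fd[OF R q h], unfolded left_snake_def] by simp
  }
qed

text \<open>The counit forces the source of a composite to be the dual of the target of the chosen
  arrow of \<open>R\<close>, and the unit forces its target to be the dual of the source of that
  arrow.\<close>

lemma asnake_right:
  assumes q: "is_qset \<X>" "is_qset \<Y>" and R: "R \<subseteq> arrows \<X> \<Y>"
  shows "acomp (arunit (qdual \<X>)) (acomp (aprod (aid (qdual \<X>)) (acounit \<Y>)) (acomp (aassoc (qdual \<X>) \<Y> (qdual \<Y>))
    (acomp (aprod (aprod (aid (qdual \<X>)) R) (aid (qdual \<Y>))) (acomp (aprod (aunit \<X>) (aid (qdual \<Y>)))
      (aadj (alunit (qdual \<Y>))))))) = adual R"
    (is "?l = _")
proof (rule arrow_eqI)
  have inj: "A = A'" if "dual A = dual A'" "A \<in> \<Y>" "A' \<in> \<Y>" for A A'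
    using dual_inject[OF _ _ that(1)] q that by (simp add: qset_fd)
  fix D E v
  {
    assume "(D, E, v) \<in> ?l"
    then obtain A B r where h: "(A, B, r) \<in> R" and D: "D = dual B" "E = dual A"
      and v: "v = right_snake A B r"
      by (auto simp: acomp_def aprod_def structure_defs aadj_def right_snake_def)
    then show "(D, E, v) \<in> adual R" using v snake_right[OF arrows_fd[OF R q h]] adualI[OF h] by simp
  next
    assume "(D, E, v) \<in> adual R"
    then obtain A B r where h: "(A, B, r) \<in> R" and v: "D = dual B" "E = dual A" "v = dual_op B r"
      by (auto simp: adual_def)
    note D = arrowsD[OF R h]
    show "(D, E, v) \<in> ?l"
      using acompI[OF acompI[OF acompI[OF acompI[OF acompI[OF aadjI[OF alunitI[OF dual_qdual[OF D(2)]]]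
        aprodI[OF aunitI[OF D(1)] aidI[OF dual_qdual[OF D(2)]]]]
        aprodI[OF aprodI[OF aidI[OF dual_qdual[OF D(1)]] h] aidI[OF dual_qdual[OF D(2)]]]]
        aassocI[OF dual_qdual[OF D(1)] D(2) dual_qdual[OF D(2)]]]
        aprodI[OF aidI[OF dual_qdual[OF D(1)]] acounitI[OF D(2)]]] arunitI[OF dual_qdual[OF D(1)]]]
        snake_right[OF arrows_fd[OF R q h], unfolded right_snake_def] v by simp
  }
qed

lemma aadj_aadj:
  assumes q: "is_qset \<X>" "is_qset \<Y>" and M: "M \<subseteq> arrows \<X> \<Y>"
  shows "aadj (aadj M) = M"
proof (rule arrow_eqI)
  fix A B v assume "(A, B, v) \<in> aadj (aadj M)"
  then show "(A, B, v) \<in> M" using arrows_fd[OF M q] by (auto simp: aadj_def)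
next
  fix A B v assume h: "(A, B, v) \<in> M"
  show "(A, B, v) \<in> aadj (aadj M)" using aadjI[OF aadjI[OF h]] arrows_fd[OF M q h] by simp
qed

lemma aadj_id: "is_qset \<X> \<Longrightarrow> aadj (aid \<X>) = aid \<X>"
  by (fastforce simp: aadj_def aid_def qset_fd)

lemma aadj_acomp:
  assumes q: "is_qset \<X>" "is_qset \<Y>" "is_qset \<Z>" and R: "R \<subseteq> arrows \<X> \<Y>" and S: "S \<subseteq> arrows \<Y> \<Z>"
  shows "aadj (acomp S R) = acomp (aadj R) (aadj S)"
proof (rule arrow_eqI)
  have eq: "adj_op A C (s \<circ>\<^sub>m r) = adj_op A B r \<circ>\<^sub>m adj_op B C s"
    if "(A, B, r) \<in> R" "(B, C, s) \<in> S" for A B C r s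
    using arrows_fd[OF R q(1,2) that(1)] arrows_fd[OF S q(2,3) that(2)] by (intro adj_comp)
  fix D E v
  {
    assume "(D, E, v) \<in> aadj (acomp S R)"
    then obtain B r s where h: "(E, B, r) \<in> R" "(B, D, s) \<in> S" "v = adj_op E D (s \<circ>\<^sub>m r)"
      by (auto simp: aadj_def acomp_def)
    then show "(D, E, v) \<in> acomp (aadj R) (aadj S)"
      using acompI[OF aadjI[OF h(2)] aadjI[OF h(1)]] eq[OF h(1,2)] by simp
  next
    assume "(D, E, v) \<in> acomp (aadj R) (aadj S)"
    then obtain B r s where h: "(E, B, r) \<in> R" "(B, D, s) \<in> S" "v = adj_op E B r \<circ>\<^sub>m adj_op B D s"
      by (auto simp: aadj_def acomp_def)
    then show "(D, E, v) \<in> aadj (acomp S R)"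
      using aadjI[OF acompI[OF h(1,2)]] eq[OF h(1,2)] by simp
  }
qed

lemma aadj_aprod:
  assumes q: "is_qset \<X>" "is_qset \<X>'" "is_qset \<Y>" "is_qset \<Y>'"
    and R: "R \<subseteq> arrows \<X> \<X>'" and S: "S \<subseteq> arrows \<Y> \<Y>'"
  shows "aadj (aprod R S) = aprod (aadj R) (aadj S)"
proof (rule arrow_eqI)
  have eq: "adj_op (A \<otimes>\<^sub>H B) (A' \<otimes>\<^sub>H B') (tens_op A B A' B' r s) = tens_op A' B' A B (adj_op A A' r) (adj_op B B' s)"
    if "(A, A', r) \<in> R" "(B, B', s) \<in> S" for A A' B B' r s
    using arrows_fd[OF R q(1,2) that(1)] arrows_fd[OF S q(3,4) that(2)] by (intro adj_tens_op)
  fix D E v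
  {
    assume "(D, E, v) \<in> aadj (aprod R S)"
    then obtain A A' B B' r s where h: "(A, A', r) \<in> R" "(B, B', s) \<in> S"
      and "D = A' \<otimes>\<^sub>H B'" "E = A \<otimes>\<^sub>H B" "v = adj_op (A \<otimes>\<^sub>H B) (A' \<otimes>\<^sub>H B') (tens_op A B A' B' r s)"
      by (auto simp: aadj_def aprod_def)
    then show "(D, E, v) \<in> aprod (aadj R) (aadj S)"
      using aprodI[OF aadjI[OF h(1)] aadjI[OF h(2)]] eq[OF h] by simp
  next
    assume "(D, E, v) \<in> aprod (aadj R) (aadj S)"
    then obtain A A' B B' r s where h: "(A, A', r) \<in> R" "(B, B', s) \<in> S"
      and "D = A' \<otimes>\<^sub>H B'" "E = A \<otimes>\<^sub>H B" "v = tens_op A' B' A B (adj_op A A' r) (adj_op B B' s)"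
      by (auto simp: aadj_def aprod_def)
    then show "(D, E, v) \<in> aadj (aprod R S)" using aadjI[OF aprodI[OF h]] eq[OF h] by simp
  }
qed

lemma aadj_acounit:
  assumes q: "is_qset \<X>"
  shows "aadj (acounit \<X>) = acomp (abraid (qdual \<X>) \<X>) (aunit \<X>)"
proof (rule arrow_eqI)
  fix D E v assume "(D, E, v) \<in> aadj (acounit \<X>)"
  then obtain A where "A \<in> \<X>" "D = cspace" "E = A \<otimes>\<^sub>H dual A" "v = adj_op (A \<otimes>\<^sub>H dual A) cspace (counit_op A)"
    by (auto simp: aadj_def acounit_def)
  then show "(D, E, v) \<in> acomp (abraid (qdual \<X>) \<X>) (aunit \<X>)"
    using acompI[OF aunitI abraidI[OF dual_qdual]] adj_counit[of A] q by (simp add: qset_fd)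
next
  fix D E v assume "(D, E, v) \<in> acomp (abraid (qdual \<X>) \<X>) (aunit \<X>)"
  then obtain A where "A \<in> \<X>" "D = cspace" "E = A \<otimes>\<^sub>H dual A" "v = braid_op (dual A) A \<circ>\<^sub>m unit_op A"
    by (auto simp: acomp_def abraid_def aunit_def)
  then show "(D, E, v) \<in> aadj (acounit \<X>)"
    using aadjI[OF acounitI, of A \<X>] adj_counit[of A] q by (simp add: qset_fd)
qed

section \<open>The category of relations\<close>

lemma rid_qRel: "is_qset \<X> \<Longrightarrow> rid \<X> \<in> qRel \<X> \<X>"
  by (simp add: rid_gen gen_qRel)

lemma rcomp_qRel:
  assumes q: "is_qset \<X>" "is_qset \<Y>" "is_qset \<Z>" and R: "R \<in> qRel \<X> \<Y>" and S: "S \<in> qRel \<Y> \<Z>"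
  shows "S \<circ>\<^sub>R R \<in> qRel \<X> \<Z>"
proof -
  obtain M N where "M \<subseteq> arrows \<X> \<Y>" "N \<subseteq> arrows \<Y> \<Z>" "R = gen \<X> \<Y> M" "S = gen \<Y> \<Z> N"
    using R S by (metis qRel_cases)
  then show ?thesis using q by (simp add: gen_comp gen_qRel acomp_arrows)
qed

lemma
  assumes q: "is_qset \<X>" "is_qset \<Y>" and R: "R \<in> qRel \<X> \<Y>"
  shows rcomp_rid: "R \<circ>\<^sub>R rid \<X> = R" and rid_rcomp: "rid \<Y> \<circ>\<^sub>R R = R"
  using q by (auto intro: qRel_cases[OF R] simp: rid_gen gen_comp acomp_id_left acomp_id_right)

lemma rcomp_assoc:
  assumes q: "is_qset \<W>" "is_qset \<X>" "is_qset \<Y>" "is_qset \<Z>"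
    and R: "R \<in> qRel \<W> \<X>" and S: "S \<in> qRel \<X> \<Y>" and T: "T \<in> qRel \<Y> \<Z>"
  shows "(T \<circ>\<^sub>R S) \<circ>\<^sub>R R = T \<circ>\<^sub>R (S \<circ>\<^sub>R R)"
proof -
  obtain L M N where "L \<subseteq> arrows \<W> \<X>" "M \<subseteq> arrows \<X> \<Y>" "N \<subseteq> arrows \<Y> \<Z>"
    "R = gen \<W> \<X> L" "S = gen \<X> \<Y> M" "T = gen \<Y> \<Z> N"
    using R S T by (metis qRel_cases)
  then show ?thesis
    using q acomp_arrows[OF q(1), of L \<X> M \<Y>] acomp_arrows[OF q(2), of M \<Y> N \<Z>]
    by (simp add: gen_comp acomp_assoc)
qed

lemma rprod_qRel:
  assumes q: "is_qset \<X>" "is_qset \<X>'" "is_qset \<Y>" "is_qset \<Y>'" and R: "R \<in> qRel \<X> \<X>'" and S: "S \<in> qRel \<Y> \<Y>'"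
  shows "R \<times>\<^sub>R S \<in> qRel (\<X> \<times>\<^sub>Q \<Y>) (\<X>' \<times>\<^sub>Q \<Y>')"
proof -
  obtain M N where "M \<subseteq> arrows \<X> \<X>'" "N \<subseteq> arrows \<Y> \<Y>'" "R = gen \<X> \<X>' M" "S = gen \<Y> \<Y>' N"
    using R S by (metis qRel_cases)
  then show ?thesis using q by (simp add: gen_prod gen_qRel aprod_arrows)
qed

lemma rprod_rid: "is_qset \<X> \<Longrightarrow> is_qset \<Y> \<Longrightarrow> rid \<X> \<times>\<^sub>R rid \<Y> = rid (\<X> \<times>\<^sub>Q \<Y>)"
  by (simp add: rid_gen gen_prod aprod_id)

lemma rprod_rcomp:
  assumes q: "is_qset \<X>" "is_qset \<Y>" "is_qset \<Z>" "is_qset \<X>'" "is_qset \<Y>'" "is_qset \<Z>'"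
    and R: "R \<in> qRel \<X> \<Y>" and S: "S \<in> qRel \<Y> \<Z>" and R': "R' \<in> qRel \<X>' \<Y>'" and S': "S' \<in> qRel \<Y>' \<Z>'"
  shows "(S \<times>\<^sub>R S') \<circ>\<^sub>R (R \<times>\<^sub>R R') = (S \<circ>\<^sub>R R) \<times>\<^sub>R (S' \<circ>\<^sub>R R')"
proof -
  obtain M N where m: "M \<subseteq> arrows \<X> \<Y>" "N \<subseteq> arrows \<Y> \<Z>" "R = gen \<X> \<Y> M" "S = gen \<Y> \<Z> N"
    using R S by (metis qRel_cases)
  obtain M' N' where m': "M' \<subseteq> arrows \<X>' \<Y>'" "N' \<subseteq> arrows \<Y>' \<Z>'" "R' = gen \<X>' \<Y>' M'" "S' = gen \<Y>' \<Z>' N'"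
    using R' S' by (metis qRel_cases)
  show ?thesis
    using q m m' acomp_arrows[OF q(1) m(1,2)] acomp_arrows[OF q(4) m'(1,2)]
    by (simp add: gen_comp gen_prod aprod_arrows aprod_acomp)
qed

lemma rassoc_natural:
  assumes q: "is_qset \<X>" "is_qset \<Y>" "is_qset \<Z>" "is_qset \<X>'" "is_qset \<Y>'" "is_qset \<Z>'"
    and R: "R \<in> qRel \<X> \<X>'" and S: "S \<in> qRel \<Y> \<Y>'" and T: "T \<in> qRel \<Z> \<Z>'"
  shows "rassoc \<X>' \<Y>' \<Z>' \<circ>\<^sub>R ((R \<times>\<^sub>R S) \<times>\<^sub>R T) = (R \<times>\<^sub>R (S \<times>\<^sub>R T)) \<circ>\<^sub>R rassoc \<X> \<Y> \<Z>"
proof -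
  obtain L M N where "L \<subseteq> arrows \<X> \<X>'" "M \<subseteq> arrows \<Y> \<Y>'" "N \<subseteq> arrows \<Z> \<Z>'"
    "R = gen \<X> \<X>' L" "S = gen \<Y> \<Y>' M" "T = gen \<Z> \<Z>' N"
    using R S T by (metis qRel_cases)
  then show ?thesis using q by (simp add: rassoc_gen gen_comp gen_prod aprod_arrows aassoc_natural)
qed

lemma rlunit_natural:
  assumes q: "is_qset \<X>" "is_qset \<Y>" and R: "R \<in> qRel \<X> \<Y>"
  shows "rlunit \<Y> \<circ>\<^sub>R (rid \<one>\<^sub>Q \<times>\<^sub>R R) = R \<circ>\<^sub>R rlunit \<X>"
  using q by (auto intro: qRel_cases[OF R] simp: rid_gen rlunit_gen gen_comp gen_prod aprod_arrows alunit_natural)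

lemma rrunit_natural:
  assumes q: "is_qset \<X>" "is_qset \<Y>" and R: "R \<in> qRel \<X> \<Y>"
  shows "rrunit \<Y> \<circ>\<^sub>R (R \<times>\<^sub>R rid \<one>\<^sub>Q) = R \<circ>\<^sub>R rrunit \<X>"
  using q by (auto intro: qRel_cases[OF R] simp: rid_gen rrunit_gen gen_comp gen_prod aprod_arrows arunit_natural)

lemma rbraid_natural:
  assumes q: "is_qset \<X>" "is_qset \<Y>" "is_qset \<X>'" "is_qset \<Y>'" and R: "R \<in> qRel \<X> \<X>'" and S: "S \<in> qRel \<Y> \<Y>'"
  shows "rbraid \<X>' \<Y>' \<circ>\<^sub>R (R \<times>\<^sub>R S) = (S \<times>\<^sub>R R) \<circ>\<^sub>R rbraid \<X> \<Y>"
proof -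
  obtain M N where "M \<subseteq> arrows \<X> \<X>'" "N \<subseteq> arrows \<Y> \<Y>'" "R = gen \<X> \<X>' M" "S = gen \<Y> \<Y>' N"
    using R S by (metis qRel_cases)
  then show ?thesis using q by (simp add: rbraid_gen gen_comp gen_prod aprod_arrows abraid_natural)
qed

text \<open>The conditions say that \<open>M\<close> is a bijection between atoms with one unitary
  operator on each matched pair. Hence an arrow composes only with its own adjoint, giving
  identities on the diagonal and nothing elsewhere; uniqueness of inverses then evaluates the
  description in \<open>rinv\<close>.\<close>

lemma unitary_rel:
  assumes q: "is_qset \<X>" "is_qset \<Y>" and u: "\<And>A B u. (A, B, u) \<in> M \<Longrightarrow> unitary_op A B u"
    and dom: "\<And>A. A \<in> \<X> \<longleftrightarrow> (\<exists>B u. (A, B, u) \<in> M)" and cod: "\<And>B. B \<in> \<Y> \<longleftrightarrow> (\<exists>A u. (A, B, u) \<in> M)"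
    and func: "\<And>A B B' u u'. (A, B, u) \<in> M \<Longrightarrow> (A, B', u') \<in> M \<Longrightarrow> B = B' \<and> u = u'"
    and inj: "\<And>A A' B u u'. (A, B, u) \<in> M \<Longrightarrow> (A', B, u') \<in> M \<Longrightarrow> A = A' \<and> u = u'"
  shows "is_iso (gen \<X> \<Y> M) \<and> rinv (gen \<X> \<Y> M) = gen \<Y> \<X> (aadj M)"
proof
  have M: "M \<subseteq> arrows \<X> \<Y>" using u dom cod unitary_lin by (fastforce simp: arrows_def)
  have l: "acomp (aadj M) M = aid \<X>"
  proof (rule arrow_eqI)
    fix A A' v assume "(A, A', v) \<in> acomp (aadj M) M"
    then obtain B w w' where h: "(A, B, w) \<in> M" "(A', B, w') \<in> M" "v = adj_op A' B w' \<circ>\<^sub>m w"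
      by (auto simp: acomp_def aadj_def)
    then show "(A, A', v) \<in> aid \<X>"
      using inj[OF h(1,2)] u[OF h(1)] dom by (auto simp: aid_def unitary_op_def)
  next
    fix A A' v assume "(A, A', v) \<in> aid \<X>"
    then have v: "A \<in> \<X>" "A' = A" "v = id_op A" by (auto simp: aid_def)
    then obtain B w where h: "(A, B, w) \<in> M" using dom by blast
    then show "(A, A', v) \<in> acomp (aadj M) M"
      using acompI[OF h aadjI[OF h]] u[OF h] v by (simp add: unitary_op_def)
  qed
  have r: "acomp M (aadj M) = aid \<Y>"
  proof (rule arrow_eqI)
    fix B B' v assume "(B, B', v) \<in> acomp M (aadj M)"
    then obtain A w w' where h: "(A, B, w) \<in> M" "(A, B', w') \<in> M" "v = w' \<circ>\<^sub>m adj_op A B w"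
      by (auto simp: acomp_def aadj_def)
    then show "(B, B', v) \<in> aid \<Y>"
      using func[OF h(1,2)] u[OF h(1)] cod by (auto simp: aid_def unitary_op_def)
  next
    fix B B' v assume "(B, B', v) \<in> aid \<Y>"
    then have v: "B \<in> \<Y>" "B' = B" "v = id_op B" by (auto simp: aid_def)
    then obtain A w where h: "(A, B, w) \<in> M" using cod by blast
    then show "(B, B', v) \<in> acomp M (aadj M)"
      using acompI[OF aadjI[OF h] h] u[OF h] v by (simp add: unitary_op_def)
  qed
  let ?U = "gen \<X> \<Y> M" and ?V = "gen \<Y> \<X> (aadj M)"
  have U: "?U \<in> qRel \<X> \<Y>" and V: "?V \<in> qRel \<Y> \<X>" using q M by (simp_all add: gen_qRel aadj_arrows)
  have VU: "?V \<circ>\<^sub>R ?U = rid \<X>" and UV: "?U \<circ>\<^sub>R ?V = rid \<Y>"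
    using q M by (simp_all add: gen_comp aadj_arrows l r rid_gen)
  show "is_iso ?U" unfolding is_iso_def using V VU UV by auto
  show "rinv ?U = ?V"
    unfolding rinv_def
  proof (rule the_equality)
    fix W assume W: "W \<in> qRel (tgt ?U) (src ?U) \<and> W \<circ>\<^sub>R ?U = rid (src ?U) \<and> ?U \<circ>\<^sub>R W = rid (tgt ?U)"
    then have W': "W \<in> qRel \<Y> \<X>" by simp
    \<comment> \<open>Any other inverse \<open>W\<close> is compared with \<open>?V\<close> by
      inserting the identity and reassociating.\<close>
    have "W = W \<circ>\<^sub>R (?U \<circ>\<^sub>R ?V)" using rcomp_rid[OF q(2,1) W'] UV by simp
    also have "\<dots> = (W \<circ>\<^sub>R ?U) \<circ>\<^sub>R ?V" using rcomp_assoc[OF q(2,1,2,1) V U W'] by simp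
    also have "\<dots> = ?V" using rid_rcomp[OF q(2,1) V] W by simp
    finally show "W = ?V" .
  qed (use V VU UV in auto)
qed

section \<open>Unitarity of the associator, unitors and braiding\<close>

lemma in_qprod: "H \<in> \<X> \<times>\<^sub>Q \<Y> \<longleftrightarrow> (\<exists>A B. H = A \<otimes>\<^sub>H B \<and> A \<in> \<X> \<and> B \<in> \<Y>)"
  by (auto simp: qprod_def)

lemma rassoc_unitary:
  assumes "is_qset \<X>" "is_qset \<Y>" "is_qset \<Z>"
  shows "is_iso (rassoc \<X> \<Y> \<Z>) \<and> rinv (rassoc \<X> \<Y> \<Z>) = gen (\<X> \<times>\<^sub>Q (\<Y> \<times>\<^sub>Q \<Z>)) ((\<X> \<times>\<^sub>Q \<Y>) \<times>\<^sub>Q \<Z>) (aadj (aassoc \<X> \<Y> \<Z>))"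
  unfolding rassoc_gen
  by (rule unitary_rel) (use assms in \<open>auto simp: aassoc_def in_qprod qset_fd assoc_unitary\<close>)

lemmas rassoc_iso = rassoc_unitary[THEN conjunct1] and rinv_rassoc = rassoc_unitary[THEN conjunct2]

lemma rlunit_unitary:
  assumes "is_qset \<X>"
  shows "is_iso (rlunit \<X>) \<and> rinv (rlunit \<X>) = gen \<X> (\<one>\<^sub>Q \<times>\<^sub>Q \<X>) (aadj (alunit \<X>))"
  unfolding rlunit_gen
  by (rule unitary_rel) (use assms in \<open>auto simp: alunit_def in_qprod qset_fd lunit_unitary\<close>)

lemmas rlunit_iso = rlunit_unitary[THEN conjunct1] and rinv_rlunit = rlunit_unitary[THEN conjunct2]

lemma rrunit_unitary:
  assumes "is_qset \<X>"
  shows "is_iso (rrunit \<X>) \<and> rinv (rrunit \<X>) = gen \<X> (\<X> \<times>\<^sub>Q \<one>\<^sub>Q) (aadj (arunit \<X>))"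
  unfolding rrunit_gen
  by (rule unitary_rel) (use assms in \<open>auto simp: arunit_def in_qprod qset_fd runit_unitary\<close>)

lemmas rrunit_iso = rrunit_unitary[THEN conjunct1] and rinv_rrunit = rrunit_unitary[THEN conjunct2]

lemma rbraid_unitary:
  assumes "is_qset \<X>" "is_qset \<Y>"
  shows "is_iso (rbraid \<X> \<Y>) \<and> rinv (rbraid \<X> \<Y>) = gen (\<Y> \<times>\<^sub>Q \<X>) (\<X> \<times>\<^sub>Q \<Y>) (aadj (abraid \<X> \<Y>))"
  unfolding rbraid_gen
  by (rule unitary_rel) (use assms in \<open>auto simp: abraid_def in_qprod qset_fd braid_unitary\<close>)

lemmas rbraid_iso = rbraid_unitary[THEN conjunct1] and rinv_rbraid = rbraid_unitary[THEN conjunct2]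

text \<open>Inverse and adjoint are both generated by the adjoints of the associators of
  \<open>FdHilb\<close>.\<close>

lemma rinv_rassoc_dag:
  "is_qset \<X> \<Longrightarrow> is_qset \<Y> \<Longrightarrow> is_qset \<Z> \<Longrightarrow> rinv (rassoc \<X> \<Y> \<Z>) = rdag (rassoc \<X> \<Y> \<Z>)"
  by (subst rinv_rassoc) (simp_all add: rassoc_gen gen_dag)

lemma rinv_rlunit_dag:
  "is_qset \<X> \<Longrightarrow> rinv (rlunit \<X>) = rdag (rlunit \<X>)"
  by (subst rinv_rlunit) (simp_all add: rlunit_gen gen_dag)

lemma rinv_rrunit_dag:
  "is_qset \<X> \<Longrightarrow> rinv (rrunit \<X>) = rdag (rrunit \<X>)"
  by (subst rinv_rrunit) (simp_all add: rrunit_gen gen_dag)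

lemma rinv_rbraid_dag:
  "is_qset \<X> \<Longrightarrow> is_qset \<Y> \<Longrightarrow> rinv (rbraid \<X> \<Y>) = rdag (rbraid \<X> \<Y>)"
  by (subst rinv_rbraid) (simp_all add: rbraid_gen gen_dag)

lemma rassoc_pentagon:
  assumes q: "is_qset \<W>" "is_qset \<X>" "is_qset \<Y>" "is_qset \<Z>"
  shows "(rid \<W> \<times>\<^sub>R rassoc \<X> \<Y> \<Z>) \<circ>\<^sub>R rassoc \<W> (\<X> \<times>\<^sub>Q \<Y>) \<Z> \<circ>\<^sub>R (rassoc \<W> \<X> \<Y> \<times>\<^sub>R rid \<Z>) =
    rassoc \<W> \<X> (\<Y> \<times>\<^sub>Q \<Z>) \<circ>\<^sub>R rassoc (\<W> \<times>\<^sub>Q \<X>) \<Y> \<Z>"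
proof -
  \<comment> \<open>\<open>gen_comp\<close> applies to an iterated composite only once its inner
    part is known to consist of arrows between the right quantum sets, so the partial composites are
    typed beforehand.\<close>
  have 1: "aprod (aassoc \<W> \<X> \<Y>) (aid \<Z>) \<subseteq> arrows (((\<W> \<times>\<^sub>Q \<X>) \<times>\<^sub>Q \<Y>) \<times>\<^sub>Q \<Z>) ((\<W> \<times>\<^sub>Q (\<X> \<times>\<^sub>Q \<Y>)) \<times>\<^sub>Q \<Z>)"
    using q by (intro aprod_arrows) simp_all
  note 2 = acomp_arrows[OF _ 1 structure_arrows(7)]
  show ?thesis
    using q by (simp add: rel_gens gen_comp gen_prod aprod_arrows 1 2 apentagon)
qed

lemma rassoc_triangle:
  assumes q: "is_qset \<X>" "is_qset \<Y>"
  shows "(rid \<X> \<times>\<^sub>R rlunit \<Y>) \<circ>\<^sub>R rassoc \<X> \<one>\<^sub>Q \<Y> = rrunit \<X> \<times>\<^sub>R rid \<Y>"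
  using q by (simp add: rel_gens gen_comp gen_prod aprod_arrows atriangle)

lemma rbraid_hexagon:
  assumes q: "is_qset \<X>" "is_qset \<Y>" "is_qset \<Z>"
  shows "rassoc \<Y> \<Z> \<X> \<circ>\<^sub>R rbraid \<X> (\<Y> \<times>\<^sub>Q \<Z>) \<circ>\<^sub>R rassoc \<X> \<Y> \<Z> =
    (rid \<Y> \<times>\<^sub>R rbraid \<X> \<Z>) \<circ>\<^sub>R rassoc \<Y> \<X> \<Z> \<circ>\<^sub>R (rbraid \<X> \<Y> \<times>\<^sub>R rid \<Z>)"
proof -
  have 1: "acomp (abraid \<X> (\<Y> \<times>\<^sub>Q \<Z>)) (aassoc \<X> \<Y> \<Z>) \<subseteq> arrows ((\<X> \<times>\<^sub>Q \<Y>) \<times>\<^sub>Q \<Z>) ((\<Y> \<times>\<^sub>Q \<Z>) \<times>\<^sub>Q \<X>)"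
    using q by (intro acomp_arrows[OF _ structure_arrows(7) structure_arrows(6)]) auto
  have 2: "aprod (abraid \<X> \<Y>) (aid \<Z>) \<subseteq> arrows ((\<X> \<times>\<^sub>Q \<Y>) \<times>\<^sub>Q \<Z>) ((\<Y> \<times>\<^sub>Q \<X>) \<times>\<^sub>Q \<Z>)"
    using q by (intro aprod_arrows) simp_all
  note 3 = acomp_arrows[OF _ 2 structure_arrows(7)]
  show ?thesis
    using q by (simp add: rel_gens gen_comp gen_prod aprod_arrows 1 2 3 ahexagon)
qed

lemma rbraid_rbraid:
  "is_qset \<X> \<Longrightarrow> is_qset \<Y> \<Longrightarrow> rbraid \<Y> \<X> \<circ>\<^sub>R rbraid \<X> \<Y> = rid (\<X> \<times>\<^sub>Q \<Y>)"
  by (simp add: rel_gens gen_comp abraid_abraid)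

lemma rdual_qRel:
  assumes q: "is_qset \<X>" "is_qset \<Y>" and R: "R \<in> qRel \<X> \<Y>"
  shows "rdual R \<in> qRel (qdual \<Y>) (qdual \<X>)"
  using q by (auto intro: qRel_cases[OF R] simp: gen_dual gen_qRel adual_arrows)

lemma rdual_rid: "is_qset \<X> \<Longrightarrow> rdual (rid \<X>) = rid (qdual \<X>)"
  by (simp add: rid_gen gen_dual adual_id)

lemma rdual_rcomp:
  assumes q: "is_qset \<X>" "is_qset \<Y>" "is_qset \<Z>" and R: "R \<in> qRel \<X> \<Y>" and S: "S \<in> qRel \<Y> \<Z>"
  shows "rdual (S \<circ>\<^sub>R R) = rdual R \<circ>\<^sub>R rdual S"
proof -
  obtain M N where "M \<subseteq> arrows \<X> \<Y>" "N \<subseteq> arrows \<Y> \<Z>" "R = gen \<X> \<Y> M" "S = gen \<Y> \<Z> N"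
    using R S by (metis qRel_cases)
  then show ?thesis
    using q acomp_arrows[OF q(1), of M \<Y> N \<Z>] by (simp add: gen_comp gen_dual adual_arrows adual_acomp)
qed

lemma rsnake_left:
  assumes q: "is_qset \<X>" "is_qset \<Y>" and R: "R \<in> qRel \<X> \<Y>"
  shows "rlunit \<Y> \<circ>\<^sub>R (qcounit \<X> \<times>\<^sub>R rid \<Y>) \<circ>\<^sub>R rinv (rassoc \<X> (qdual \<X>) \<Y>) \<circ>\<^sub>R
    (rid \<X> \<times>\<^sub>R (rdual R \<times>\<^sub>R rid \<Y>)) \<circ>\<^sub>R (rid \<X> \<times>\<^sub>R qunit \<Y>) \<circ>\<^sub>R rinv (rrunit \<X>) = R"
proof -
  obtain M where M: "M \<subseteq> arrows \<X> \<Y>" "R = gen \<X> \<Y> M" using R by (rule qRel_cases)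
  let ?D = "qdual \<X>" and ?E = "qdual \<Y>"
  have 1: "aadj (arunit \<X>) \<subseteq> arrows \<X> (\<X> \<times>\<^sub>Q \<one>\<^sub>Q)" using q by (intro aadj_arrows) simp_all
  have 2: "aprod (aid \<X>) (aunit \<Y>) \<subseteq> arrows (\<X> \<times>\<^sub>Q \<one>\<^sub>Q) (\<X> \<times>\<^sub>Q (?E \<times>\<^sub>Q \<Y>))" using q by (intro aprod_arrows) simp_all
  have 3: "aprod (adual M) (aid \<Y>) \<subseteq> arrows (?E \<times>\<^sub>Q \<Y>) (?D \<times>\<^sub>Q \<Y>)"
    using q M by (intro aprod_arrows adual_arrows) simp_all
  have 4: "aprod (aid \<X>) (aprod (adual M) (aid \<Y>)) \<subseteq> arrows (\<X> \<times>\<^sub>Q (?E \<times>\<^sub>Q \<Y>)) (\<X> \<times>\<^sub>Q (?D \<times>\<^sub>Q \<Y>))"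
    using q M(1) by (intro aprod_arrows adual_arrows) simp_all
  have 5: "aadj (aassoc \<X> ?D \<Y>) \<subseteq> arrows (\<X> \<times>\<^sub>Q (?D \<times>\<^sub>Q \<Y>)) ((\<X> \<times>\<^sub>Q ?D) \<times>\<^sub>Q \<Y>)"
    using q by (intro aadj_arrows) simp_all
  have 6: "aprod (acounit \<X>) (aid \<Y>) \<subseteq> arrows ((\<X> \<times>\<^sub>Q ?D) \<times>\<^sub>Q \<Y>) (\<one>\<^sub>Q \<times>\<^sub>Q \<Y>)" using q by (intro aprod_arrows) simp_all
  \<comment> \<open>The composite is built up from its first factor; \<open>c1\<close> to
    \<open>c4\<close> type its successive partial composites.\<close>
  note c1 = acomp_arrows[OF q(1) 1 2] note c2 = acomp_arrows[OF q(1) c1 4]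
  note c3 = acomp_arrows[OF q(1) c2 5] note c4 = acomp_arrows[OF q(1) c3 6]
  show ?thesis
    unfolding M(2) rinv_rassoc[OF q(1) is_qset_qdual[OF q(1)] q(2)] rinv_rrunit[OF q(1)]
    using q M(1) by (simp add: rel_gens gen_dual adual_arrows gen_comp gen_prod 1 2 3 4 5 6 c1 c2 c3 c4
      asnake_left)
qed

lemma rsnake_right:
  assumes q: "is_qset \<X>" "is_qset \<Y>" and R: "R \<in> qRel \<X> \<Y>"
  shows "rrunit (qdual \<X>) \<circ>\<^sub>R (rid (qdual \<X>) \<times>\<^sub>R qcounit \<Y>) \<circ>\<^sub>R rassoc (qdual \<X>) \<Y> (qdual \<Y>) \<circ>\<^sub>R
    ((rid (qdual \<X>) \<times>\<^sub>R R) \<times>\<^sub>R rid (qdual \<Y>)) \<circ>\<^sub>R (qunit \<X> \<times>\<^sub>R rid (qdual \<Y>)) \<circ>\<^sub>R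
    rinv (rlunit (qdual \<Y>)) = rdual R"
proof -
  obtain M where M: "M \<subseteq> arrows \<X> \<Y>" "R = gen \<X> \<Y> M" using R by (rule qRel_cases)
  let ?D = "qdual \<X>" and ?E = "qdual \<Y>"
  have E: "is_qset ?E" using q by simp
  have 1: "aadj (alunit ?E) \<subseteq> arrows ?E (\<one>\<^sub>Q \<times>\<^sub>Q ?E)" using q by (intro aadj_arrows) simp_all
  have 2: "aprod (aunit \<X>) (aid ?E) \<subseteq> arrows (\<one>\<^sub>Q \<times>\<^sub>Q ?E) ((?D \<times>\<^sub>Q \<X>) \<times>\<^sub>Q ?E)" using q by (intro aprod_arrows) simp_all
  have 3: "aprod (aid ?D) M \<subseteq> arrows (?D \<times>\<^sub>Q \<X>) (?D \<times>\<^sub>Q \<Y>)"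
    using q M by (intro aprod_arrows) simp_all
  have 4: "aprod (aprod (aid ?D) M) (aid ?E) \<subseteq> arrows ((?D \<times>\<^sub>Q \<X>) \<times>\<^sub>Q ?E) ((?D \<times>\<^sub>Q \<Y>) \<times>\<^sub>Q ?E)"
    using q M(1) by (intro aprod_arrows adual_arrows) simp_all
  have 5: "aassoc ?D \<Y> ?E \<subseteq> arrows ((?D \<times>\<^sub>Q \<Y>) \<times>\<^sub>Q ?E) (?D \<times>\<^sub>Q (\<Y> \<times>\<^sub>Q ?E))" using q by simp
  have 6: "aprod (aid ?D) (acounit \<Y>) \<subseteq> arrows (?D \<times>\<^sub>Q (\<Y> \<times>\<^sub>Q ?E)) (?D \<times>\<^sub>Q \<one>\<^sub>Q)" using q by (intro aprod_arrows) simp_all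
  note c1 = acomp_arrows[OF E 1 2] note c2 = acomp_arrows[OF E c1 4]
  note c3 = acomp_arrows[OF E c2 5] note c4 = acomp_arrows[OF E c3 6]
  show ?thesis
    unfolding M(2) rinv_rlunit[OF E]
    using q M(1) by (simp add: rel_gens gen_dual gen_comp gen_prod 1 2 3 4 5 6 c1 c2 c3 c4 asnake_right)
qed

lemma rdag_qRel:
  assumes q: "is_qset \<X>" "is_qset \<Y>" and R: "R \<in> qRel \<X> \<Y>"
  shows "rdag R \<in> qRel \<Y> \<X>"
  using q by (auto intro: qRel_cases[OF R] simp: gen_dag gen_qRel aadj_arrows)

lemma rdag_rdag:
  assumes q: "is_qset \<X>" "is_qset \<Y>" and R: "R \<in> qRel \<X> \<Y>"
  shows "rdag (rdag R) = R"
  using q by (auto intro: qRel_cases[OF R] simp: gen_dag aadj_arrows aadj_aadj)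

lemma rdag_rid: "is_qset \<X> \<Longrightarrow> rdag (rid \<X>) = rid \<X>"
  by (simp add: rid_gen gen_dag aadj_id)

lemma rdag_rcomp:
  assumes q: "is_qset \<X>" "is_qset \<Y>" "is_qset \<Z>" and R: "R \<in> qRel \<X> \<Y>" and S: "S \<in> qRel \<Y> \<Z>"
  shows "rdag (S \<circ>\<^sub>R R) = rdag R \<circ>\<^sub>R rdag S"
proof -
  obtain M N where "M \<subseteq> arrows \<X> \<Y>" "N \<subseteq> arrows \<Y> \<Z>" "R = gen \<X> \<Y> M" "S = gen \<Y> \<Z> N"
    using R S by (metis qRel_cases)
  then show ?thesis
    using q acomp_arrows[OF q(1), of M \<Y> N \<Z>] by (simp add: gen_comp gen_dag aadj_arrows aadj_acomp)
qed

lemma rdag_rprod: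
  assumes q: "is_qset \<X>" "is_qset \<X>'" "is_qset \<Y>" "is_qset \<Y>'" and R: "R \<in> qRel \<X> \<X>'" and S: "S \<in> qRel \<Y> \<Y>'"
  shows "rdag (R \<times>\<^sub>R S) = rdag R \<times>\<^sub>R rdag S"
proof -
  obtain M N where "M \<subseteq> arrows \<X> \<X>'" "N \<subseteq> arrows \<Y> \<Y>'" "R = gen \<X> \<X>' M" "S = gen \<Y> \<Y>' N"
    using R S by (metis qRel_cases)
  then show ?thesis using q by (simp add: gen_prod gen_dag aprod_arrows aadj_arrows aadj_aprod)
qed

text \<open>Adjoining and composing act on one generator per atom here, so the operator identity
  \<open>adj_counit\<close> carries over directly.\<close>

lemma rdag_qcounit: "is_qset \<X> \<Longrightarrow> rdag (qcounit \<X>) = rbraid (qdual \<X>) \<X> \<circ>\<^sub>R qunit \<X>"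
  by (simp add: rel_gens gen_dag gen_comp aadj_acounit)

lemma
  assumes "is_qset \<X>"
  shows rlunit_qRel: "rlunit \<X> \<in> qRel (\<one>\<^sub>Q \<times>\<^sub>Q \<X>) \<X>"
    and rrunit_qRel: "rrunit \<X> \<in> qRel (\<X> \<times>\<^sub>Q \<one>\<^sub>Q) \<X>"
    and qunit_qRel: "qunit \<X> \<in> qRel \<one>\<^sub>Q (qdual \<X> \<times>\<^sub>Q \<X>)"
    and qcounit_qRel: "qcounit \<X> \<in> qRel (\<X> \<times>\<^sub>Q qdual \<X>) \<one>\<^sub>Q"
    and rbraid_qRel: "is_qset \<Y> \<Longrightarrow> rbraid \<X> \<Y> \<in> qRel (\<X> \<times>\<^sub>Q \<Y>) (\<Y> \<times>\<^sub>Q \<X>)"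
    and rassoc_qRel: "is_qset \<Y> \<Longrightarrow> is_qset \<Z> \<Longrightarrow>
      rassoc \<X> \<Y> \<Z> \<in> qRel ((\<X> \<times>\<^sub>Q \<Y>) \<times>\<^sub>Q \<Z>) (\<X> \<times>\<^sub>Q (\<Y> \<times>\<^sub>Q \<Z>))"
  using assms by (simp_all add: rel_gens gen_qRel)

theorem theorem3p6:
  fixes \<W> :: "'a qset" and \<X> :: "'b qset" and \<Y> :: "'c qset" and \<Z> :: "'d qset"
    and \<X>' :: "'e qset" and \<Y>' :: "'f qset" and \<Z>' :: "'g qset"
  assumes "is_qset \<W>" and "is_qset \<X>" and "is_qset \<Y>" and "is_qset \<Z>"
    and "is_qset \<X>'" and "is_qset \<Y>'" and "is_qset \<Z>'"
  shows
    \<comment> \<open>category\<close>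
    "(rid \<X> \<in> qRel \<X> \<X> \<and>
      (\<forall>R\<in>qRel \<X> \<Y>. \<forall>S\<in>qRel \<Y> \<Z>. S \<circ>\<^sub>R R \<in> qRel \<X> \<Z>) \<and>
      (\<forall>R\<in>qRel \<X> \<Y>. R \<circ>\<^sub>R rid \<X> = R \<and> rid \<Y> \<circ>\<^sub>R R = R) \<and>
      (\<forall>R\<in>qRel \<W> \<X>. \<forall>S\<in>qRel \<X> \<Y>. \<forall>T\<in>qRel \<Y> \<Z>. (T \<circ>\<^sub>R S) \<circ>\<^sub>R R = T \<circ>\<^sub>R (S \<circ>\<^sub>R R))) \<and>
    \<comment> \<open>product bifunctor and monoidal unit\<close>
     (is_qset \<one>\<^sub>Q \<and> is_qset (\<X> \<times>\<^sub>Q \<Y>) \<and>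
      (\<forall>R\<in>qRel \<X> \<X>'. \<forall>S\<in>qRel \<Y> \<Y>'. R \<times>\<^sub>R S \<in> qRel (\<X> \<times>\<^sub>Q \<Y>) (\<X>' \<times>\<^sub>Q \<Y>')) \<and>
      rid \<X> \<times>\<^sub>R rid \<Y> = rid (\<X> \<times>\<^sub>Q \<Y>) \<and>
      (\<forall>R\<in>qRel \<X> \<Y>. \<forall>S\<in>qRel \<Y> \<Z>. \<forall>R'\<in>qRel \<X>' \<Y>'. \<forall>S'\<in>qRel \<Y>' \<Z>'.
         (S \<times>\<^sub>R S') \<circ>\<^sub>R (R \<times>\<^sub>R R') = (S \<circ>\<^sub>R R) \<times>\<^sub>R (S' \<circ>\<^sub>R R'))) \<and>
    \<comment> \<open>associator, unitors and braiding are natural isomorphisms\<close>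
     (rassoc \<X> \<Y> \<Z> \<in> qRel ((\<X> \<times>\<^sub>Q \<Y>) \<times>\<^sub>Q \<Z>) (\<X> \<times>\<^sub>Q (\<Y> \<times>\<^sub>Q \<Z>)) \<and>
      rlunit \<X> \<in> qRel (\<one>\<^sub>Q \<times>\<^sub>Q \<X>) \<X> \<and>
      rrunit \<X> \<in> qRel (\<X> \<times>\<^sub>Q \<one>\<^sub>Q) \<X> \<and>
      rbraid \<X> \<Y> \<in> qRel (\<X> \<times>\<^sub>Q \<Y>) (\<Y> \<times>\<^sub>Q \<X>) \<and>
      is_iso (rassoc \<X> \<Y> \<Z>) \<and> is_iso (rlunit \<X>) \<and> is_iso (rrunit \<X>) \<and> is_iso (rbraid \<X> \<Y>) \<and>
      (\<forall>R\<in>qRel \<X> \<X>'. \<forall>S\<in>qRel \<Y> \<Y>'. \<forall>T\<in>qRel \<Z> \<Z>'.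
         rassoc \<X>' \<Y>' \<Z>' \<circ>\<^sub>R ((R \<times>\<^sub>R S) \<times>\<^sub>R T) = (R \<times>\<^sub>R (S \<times>\<^sub>R T)) \<circ>\<^sub>R rassoc \<X> \<Y> \<Z>) \<and>
      (\<forall>R\<in>qRel \<X> \<X>'. rlunit \<X>' \<circ>\<^sub>R (rid \<one>\<^sub>Q \<times>\<^sub>R R) = R \<circ>\<^sub>R rlunit \<X>) \<and>
      (\<forall>R\<in>qRel \<X> \<X>'. rrunit \<X>' \<circ>\<^sub>R (R \<times>\<^sub>R rid \<one>\<^sub>Q) = R \<circ>\<^sub>R rrunit \<X>) \<and>
      (\<forall>R\<in>qRel \<X> \<X>'. \<forall>S\<in>qRel \<Y> \<Y>'.
         rbraid \<X>' \<Y>' \<circ>\<^sub>R (R \<times>\<^sub>R S) = (S \<times>\<^sub>R R) \<circ>\<^sub>R rbraid \<X> \<Y>)) \<and>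
    \<comment> \<open>pentagon, triangle, hexagon, symmetry\<close>
     ((rid \<W> \<times>\<^sub>R rassoc \<X> \<Y> \<Z>) \<circ>\<^sub>R rassoc \<W> (\<X> \<times>\<^sub>Q \<Y>) \<Z> \<circ>\<^sub>R (rassoc \<W> \<X> \<Y> \<times>\<^sub>R rid \<Z>) =
        rassoc \<W> \<X> (\<Y> \<times>\<^sub>Q \<Z>) \<circ>\<^sub>R rassoc (\<W> \<times>\<^sub>Q \<X>) \<Y> \<Z> \<and>
      (rid \<X> \<times>\<^sub>R rlunit \<Y>) \<circ>\<^sub>R rassoc \<X> \<one>\<^sub>Q \<Y> = rrunit \<X> \<times>\<^sub>R rid \<Y> \<and>
      rassoc \<Y> \<Z> \<X> \<circ>\<^sub>R rbraid \<X> (\<Y> \<times>\<^sub>Q \<Z>) \<circ>\<^sub>R rassoc \<X> \<Y> \<Z> =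
        (rid \<Y> \<times>\<^sub>R rbraid \<X> \<Z>) \<circ>\<^sub>R rassoc \<Y> \<X> \<Z> \<circ>\<^sub>R (rbraid \<X> \<Y> \<times>\<^sub>R rid \<Z>) \<and>
      rbraid \<Y> \<X> \<circ>\<^sub>R rbraid \<X> \<Y> = rid (\<X> \<times>\<^sub>Q \<Y>)) \<and>
    \<comment> \<open>compact closed, with duals given by the contravariant functor\<close>
     (is_qset (qdual \<X>) \<and>
      (\<forall>R\<in>qRel \<X> \<Y>. rdual R \<in> qRel (qdual \<Y>) (qdual \<X>)) \<and>
      rdual (rid \<X>) = rid (qdual \<X>) \<and>
      (\<forall>R\<in>qRel \<X> \<Y>. \<forall>S\<in>qRel \<Y> \<Z>. rdual (S \<circ>\<^sub>R R) = rdual R \<circ>\<^sub>R rdual S) \<and>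
      qunit \<X> \<in> qRel \<one>\<^sub>Q (qdual \<X> \<times>\<^sub>Q \<X>) \<and>
      qcounit \<X> \<in> qRel (\<X> \<times>\<^sub>Q qdual \<X>) \<one>\<^sub>Q \<and>
      (\<forall>R\<in>qRel \<X> \<Y>.
         rlunit \<Y> \<circ>\<^sub>R (qcounit \<X> \<times>\<^sub>R rid \<Y>) \<circ>\<^sub>R rinv (rassoc \<X> (qdual \<X>) \<Y>) \<circ>\<^sub>R
           (rid \<X> \<times>\<^sub>R (rdual R \<times>\<^sub>R rid \<Y>)) \<circ>\<^sub>R (rid \<X> \<times>\<^sub>R qunit \<Y>) \<circ>\<^sub>R rinv (rrunit \<X>) = R) \<and>
      (\<forall>R\<in>qRel \<X> \<Y>.
         rrunit (qdual \<X>) \<circ>\<^sub>R (rid (qdual \<X>) \<times>\<^sub>R qcounit \<Y>) \<circ>\<^sub>R rassoc (qdual \<X>) \<Y> (qdual \<Y>) \<circ>\<^sub>R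
           ((rid (qdual \<X>) \<times>\<^sub>R R) \<times>\<^sub>R rid (qdual \<Y>)) \<circ>\<^sub>R (qunit \<X> \<times>\<^sub>R rid (qdual \<Y>)) \<circ>\<^sub>R
           rinv (rlunit (qdual \<Y>)) = rdual R)) \<and>
    \<comment> \<open>dagger\<close>
     ((\<forall>R\<in>qRel \<X> \<Y>. rdag R \<in> qRel \<Y> \<X> \<and> rdag (rdag R) = R) \<and>
      rdag (rid \<X>) = rid \<X> \<and>
      (\<forall>R\<in>qRel \<X> \<Y>. \<forall>S\<in>qRel \<Y> \<Z>. rdag (S \<circ>\<^sub>R R) = rdag R \<circ>\<^sub>R rdag S) \<and>
      (\<forall>R\<in>qRel \<X> \<X>'. \<forall>S\<in>qRel \<Y> \<Y>'. rdag (R \<times>\<^sub>R S) = rdag R \<times>\<^sub>R rdag S) \<and>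
      rinv (rassoc \<X> \<Y> \<Z>) = rdag (rassoc \<X> \<Y> \<Z>) \<and>
      rinv (rlunit \<X>) = rdag (rlunit \<X>) \<and>
      rinv (rrunit \<X>) = rdag (rrunit \<X>) \<and>
      rinv (rbraid \<X> \<Y>) = rdag (rbraid \<X> \<Y>) \<and>
      rdag (qcounit \<X>) = rbraid (qdual \<X>) \<X> \<circ>\<^sub>R qunit \<X>)"
  \<comment> \<open>Each conjunct is an instance of one lemma. Many conclusions do not mention every
    quantum set involved, such as the middle object of a composite, so these are fixed by
    instantiating with \<open>assms\<close>.\<close>
  by (intro conjI ballI; rule rid_qRel rcomp_qRel[OF assms(2-4)] rcomp_rid[OF assms(2,3)] rid_rcomp[OF assms(2,3)]
    rcomp_assoc[OF assms(1-4)] is_qset_qone is_qset_qprod rprod_qRel[OF assms(2,5,3,6)] rprod_rid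
    rprod_rcomp[OF assms(2-7)] rassoc_qRel rlunit_qRel rrunit_qRel rbraid_qRel rassoc_iso rlunit_iso rrunit_iso
    rbraid_iso rassoc_natural[OF assms(2-7)] rlunit_natural[OF assms(2,5)] rrunit_natural[OF assms(2,5)]
    rbraid_natural[OF assms(2,3,5,6)] rassoc_pentagon rassoc_triangle rbraid_hexagon rbraid_rbraid
    is_qset_qdual rdual_qRel[OF assms(2,3)] rdual_rid rdual_rcomp[OF assms(2-4)] qunit_qRel qcounit_qRel
    rsnake_left[OF assms(2,3)] rsnake_right[OF assms(2,3)] rdag_qRel[OF assms(2,3)] rdag_rdag[OF assms(2,3)]
    rdag_rid rdag_rcomp[OF assms(2-4)] rdag_rprod[OF assms(2,5,3,6)] rinv_rassoc_dag rinv_rlunit_dag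
    rinv_rrunit_dag rinv_rbraid_dag rdag_qcounit; (assumption | rule assms))

end
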